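(* Let $P$ be a finite connected poset with a proper autonomous subposet $S$ that is a chain of size $n\ge 1$. For $1\leq i\leq n$, let $P_i$ be the poset obtained from $P$ by replacing $S$ by an antichain of size $i$. Let $h_P(x), h_{P_1}(x),\ldots,h_{P_n}(x)$ be the $h$-polynomials of the poset associahedra $\mathscr{A}(P),\mathscr{A}(P_1),\ldots,\mathscr{A}(P_n)$, respectively. Then $$h_P(x)=\frac{1}{n!}\sum_{w\in\mathfrak{S}_n}B_w(x)\,h_{P_{\ell_w}}(x).$$
   Context: **Autonomous subposets.** A subposet $S$ of a poset $P$ is *autonomous* if for all $x,y\in S$ and $z\in P-S$: $(x\preceq z\Leftrightarrow y\preceq z)$ and $(z\preceq x\Leftrightarrow z\preceq y)$. It is *proper* if $S\neq P$. Replacing $S$ by a nonempty poset $Q$ means taking the poset on $(P-S)\sqcup Q$ in which $P-S$ and $Q$ keep their own orders and each element of $Q$ is related to each $z\in P-S$ exactly as the elements of $S$ were. **Poset associahedra.** Let $(P,\preceq)$ be a finite connected poset (its Hasse diagram is a connected graph). A subset $\tau\subseteq P$ is a *proper tube* if $1<|\tau|<|P|$, $\tau$ is connected as an induced subgraph of the Hasse diagram of $P$, and $\tau$ is convex (if $x,z\in\tau$, $y\in P$ and $x\preceq y\preceq z$, then $y\in\tau$). Write $\sigma\prec\tau$ if $\sigma\cap\tau=\emptyset$ and there exist $x\in\sigma$, $y\in\tau$ with $x\preceq y$. A *tubing* of $P$ is a (possibly empty) set $T$ of proper tubes such that any two tubes in $T$ are nested (one contains the other) or disjoint, and there is no subset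 $\{\tau_1,\ldots,\tau_k\}\subseteq T$ with $\tau_1\prec\tau_2\prec\cdots\prec\tau_k\prec\tau_1$. The *poset associahedron* $\mathscr{A}(P)$ is a simple convex polytope of dimension $|P|-2$ whose nonempty faces, ordered by inclusion, are isomorphic to the tubings of $P$ ordered by reverse inclusion; thus a tubing with $k$ tubes corresponds to a face of dimension $|P|-2-k$. **$f$- and $h$-polynomials.** For a $d$-dimensional polytope, $f(t)=\sum_{i=0}^d f_i t^i$, where $f_i$ is the number of $i$-dimensional faces (including $f_d=1$), and the $h$-polynomial is defined by $f(t)=h(t+1)$. **Type B Narayana polynomials.** $B_n(x)=\sum_{k=0}^{n-1}\binom{n-1}{k}^2x^k$. For a permutation $w\in\mathfrak{S}_n$ (the symmetric group) with cycle type $(\lambda_1,\ldots,\lambda_\ell)$ (fixed points counted as cycles), $\ell_w=\ell$ is the number of cycles of $w$ and $B_w(x)=B_{\lambda_1}(x)\cdots B_{\lambda_\ell}(x)$. *)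

theory Defs
  imports
    "HOL-Analysis.Analysis"
    "HOL-Computational_Algebra.Polynomial"
    "HOL-Combinatorics.Permutations"
    "HOL-Combinatorics.Orbits"
begin

text \<open>
  A poset is a carrier \<open>A\<close> with a relation \<open>r\<close> such that \<open>partial_order_on A r\<close> holds;
  this includes \<open>r \<subseteq> A \<times> A\<close> and reflexivity on \<open>A\<close>.
\<close>

section \<open>Autonomous subposets and replacement\<close>

definition autonomous :: "'a set \<Rightarrow> 'a rel \<Rightarrow> 'a set \<Rightarrow> bool" where
  "autonomous A r S \<longleftrightarrow> S \<subseteq> A \<and>
     (\<forall>x\<in>S. \<forall>y\<in>S. \<forall>z\<in>A - S.
        ((x, z) \<in> r \<longleftrightarrow> (y, z) \<in> r) \<and> ((z, x) \<in> r \<longleftrightarrow> (z, y) \<in> r))"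

definition replace_carrier :: "'a set \<Rightarrow> 'a set \<Rightarrow> 'b set \<Rightarrow> ('a + 'b) set" where
  "replace_carrier A S B = (A - S) <+> B"

text \<open>
  The relation between new elements and \<open>A - S\<close> is read off from some element of \<open>S\<close>; when \<open>S\<close>
  is nonempty and autonomous all its elements give the same answer.
\<close>

definition replace_order ::
    "'a set \<Rightarrow> 'a rel \<Rightarrow> 'a set \<Rightarrow> 'b set \<Rightarrow> 'b rel \<Rightarrow> ('a + 'b) rel" where
  "replace_order A r S B s =
     {(Inl x, Inl y) | x y. x \<in> A - S \<and> y \<in> A - S \<and> (x, y) \<in> r} \<union>
     {(Inr p, Inr q) | p q. p \<in> B \<and> q \<in> B \<and> (p, q) \<in> s} \<union>
     {(Inl z, Inr q) | z q. z \<in> A - S \<and> q \<in> B \<and> (\<exists>x\<in>S. (z, x) \<in> r)} \<union>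
     {(Inr q, Inl z) | z q. z \<in> A - S \<and> q \<in> B \<and> (\<exists>x\<in>S. (x, z) \<in> r)}"

lemma partial_order_on_replace_order:
  assumes "partial_order_on A r" "autonomous A r S" "S \<noteq> {}" "partial_order_on B s"
  shows "partial_order_on (replace_carrier A S B) (replace_order A r S B s)"
proof -
  have S: "S \<subseteq> A" and
    aut: "\<And>x y z. \<lbrakk>x \<in> S; y \<in> S; z \<in> A; z \<notin> S\<rbrakk> \<Longrightarrow>
      ((x, z) \<in> r \<longleftrightarrow> (y, z) \<in> r) \<and> ((z, x) \<in> r \<longleftrightarrow> (z, y) \<in> r)"
    using assms(2) unfolding autonomous_def by blast+
  obtain a where a: "a \<in> S" using assms(3) by blast
  have dn: "(\<exists>x\<in>S. (z, x) \<in> r) \<longleftrightarrow> (z, a) \<in> r" if "z \<in> A - S" for z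
    using aut a that by blast
  have up: "(\<exists>x\<in>S. (x, z) \<in> r) \<longleftrightarrow> (a, z) \<in> r" if "z \<in> A - S" for z
    using aut a that by blast
  have mem:
    "(Inl x, Inl y) \<in> replace_order A r S B s \<longleftrightarrow> x \<in> A - S \<and> y \<in> A - S \<and> (x, y) \<in> r"
    "(Inr p, Inr q) \<in> replace_order A r S B s \<longleftrightarrow> p \<in> B \<and> q \<in> B \<and> (p, q) \<in> s"
    "(Inl x, Inr q) \<in> replace_order A r S B s \<longleftrightarrow> x \<in> A - S \<and> q \<in> B \<and> (x, a) \<in> r"
    "(Inr q, Inl x) \<in> replace_order A r S B s \<longleftrightarrow> x \<in> A - S \<and> q \<in> B \<and> (a, x) \<in> r"
    for x y p q
    by (simp_all add: replace_order_def dn up cong: conj_cong)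
  have r: "r \<subseteq> A \<times> A" "refl_on A r" "trans r" "antisym r"
    and s: "s \<subseteq> B \<times> B" "refl_on B s" "trans s" "antisym s"
    using assms(1,4) by (auto simp: partial_order_on_def preorder_on_def)
  have no: "u \<in> S" if "(u, a) \<in> r" "(a, u) \<in> r" for u
    using antisymD[OF r(4) that] a by simp
  have "replace_order A r S B s \<subseteq> replace_carrier A S B \<times> replace_carrier A S B"
    unfolding replace_order_def replace_carrier_def by blast
  moreover have "refl_on (replace_carrier A S B) (replace_order A r S B s)"
    using refl_onD[OF r(2)] refl_onD[OF s(2)]
    by (auto intro!: refl_onI simp: replace_carrier_def mem)
  moreover have "trans (replace_order A r S B s)"
  proof (rule transI)
    fix x y z
    assume "(x, y) \<in> replace_order A r S B s" "(y, z) \<in> replace_order A r S B s"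
    then show "(x, z) \<in> replace_order A r S B s"
      by (cases x; cases y; cases z; simp add: mem) (metis no transD r(3) s(3))+
  qed
  moreover have "antisym (replace_order A r S B s)"
  proof (rule antisymI)
    fix x y
    assume "(x, y) \<in> replace_order A r S B s" "(y, x) \<in> replace_order A r S B s"
    then show "x = y"
      by (cases x; cases y; simp add: mem) (metis no antisymD r(4) s(4))+
  qed
  ultimately show ?thesis
    by (simp add: partial_order_on_def preorder_on_def)
qed


section \<open>Tubings\<close>

definition hasse :: "'a rel \<Rightarrow> 'a rel" where
  "hasse r = {(x, y) \<in> r. x \<noteq> y \<and> \<not> (\<exists>z. z \<noteq> x \<and> z \<noteq> y \<and> (x, z) \<in> r \<and> (z, y) \<in> r)}"

text \<open>
  Connectedness of the subgraph, induced on \<open>T\<close>, of the undirected Hasse diagram of the whole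
  poset.
\<close>

definition hasse_connected :: "'a rel \<Rightarrow> 'a set \<Rightarrow> bool" where
  "hasse_connected r T \<longleftrightarrow>
     (\<forall>x\<in>T. \<forall>y\<in>T. (x, y) \<in> ((hasse r \<union> (hasse r)\<inverse>) \<inter> T \<times> T)\<^sup>*)"

definition order_convex :: "'a set \<Rightarrow> 'a rel \<Rightarrow> 'a set \<Rightarrow> bool" where
  "order_convex A r T \<longleftrightarrow>
     (\<forall>x\<in>T. \<forall>z\<in>T. \<forall>y\<in>A. (x, y) \<in> r \<and> (y, z) \<in> r \<longrightarrow> y \<in> T)"

definition proper_tube :: "'a set \<Rightarrow> 'a rel \<Rightarrow> 'a set \<Rightarrow> bool" where
  "proper_tube A r T \<longleftrightarrow>
     T \<subseteq> A \<and> 1 < card T \<and> card T < card A \<and> hasse_connected r T \<and> order_convex A r T"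

definition tube_prec :: "'a rel \<Rightarrow> 'a set \<Rightarrow> 'a set \<Rightarrow> bool" where
  "tube_prec r U V \<longleftrightarrow> U \<inter> V = {} \<and> (\<exists>x\<in>U. \<exists>y\<in>V. (x, y) \<in> r)"

definition tubings :: "'a set \<Rightarrow> 'a rel \<Rightarrow> 'a set set set" where
  "tubings A r = {T. (\<forall>U\<in>T. proper_tube A r U) \<and>
     (\<forall>U\<in>T. \<forall>V\<in>T. U \<subseteq> V \<or> V \<subseteq> U \<or> U \<inter> V = {}) \<and>
     acyclic {(U, V). U \<in> T \<and> V \<in> T \<and> tube_prec r U V}}"


section \<open>Polytopes and poset associahedra\<close>

definition simple_polytope :: "'e::euclidean_space set \<Rightarrow> bool" where
  "simple_polytope Q \<longleftrightarrow> polytope Q \<and>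
     (\<forall>v. v extreme_point_of Q \<longrightarrow> int (card {F. F facet_of Q \<and> v \<in> F}) = aff_dim Q)"

text \<open>
  \<open>poset_associahedron A r Q\<close>: the polytope \<open>Q\<close> is a realization of the poset associahedron of
  \<open>(A, r)\<close>. The associahedron is determined only up to combinatorial equivalence, so this is a
  predicate rather than a function. The ambient space may have larger dimension than \<open>Q\<close>.
\<close>

definition poset_associahedron :: "'a set \<Rightarrow> 'a rel \<Rightarrow> 'e::euclidean_space set \<Rightarrow> bool" where
  "poset_associahedron A r Q \<longleftrightarrow>
     simple_polytope Q \<and> aff_dim Q = int (card A) - 2 \<and>
     (\<exists>\<phi>. bij_betw \<phi> {F. F face_of Q \<and> F \<noteq> {}} (tubings A r) \<and>
        (\<forall>F G. F face_of Q \<and> F \<noteq> {} \<and> G face_of Q \<and> G \<noteq> {} \<longrightarrow>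
           (F \<subseteq> G \<longleftrightarrow> \<phi> G \<subseteq> \<phi> F)))"

text \<open>
  In the library \<open>{}\<close> is a face of affine dimension \<open>-1\<close> and a set is a face of itself, so the
  coefficients below count the nonempty faces, with \<open>f\<^sub>d = 1\<close>.
\<close>

definition f_poly :: "'e::euclidean_space set \<Rightarrow> real poly" where
  "f_poly Q = (\<Sum>i\<le>nat (aff_dim Q). monom (real (card {F. F face_of Q \<and> aff_dim F = int i})) i)"

definition h_poly :: "'e::euclidean_space set \<Rightarrow> real poly" where
  "h_poly Q = f_poly Q \<circ>\<^sub>p [:-1, 1:]"

lemma h_poly_iff: "h = h_poly Q \<longleftrightarrow> f_poly Q = h \<circ>\<^sub>p [:1, 1:]"
proof -
  have "[:-1, 1:] \<circ>\<^sub>p [:1, 1:] = [:0, 1 :: real:]" "[:1, 1:] \<circ>\<^sub>p [:-1, 1:] = [:0, 1 :: real:]"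
    by (simp_all add: pcompose_pCons)
  then show ?thesis
    unfolding h_poly_def by (metis pcompose_assoc pcompose_idR)
qed


section \<open>Type B Narayana polynomials\<close>

definition narayana_B :: "nat \<Rightarrow> real poly" where
  "narayana_B n = (\<Sum>k<n. monom (real (((n - 1) choose k)\<^sup>2)) k)"

text \<open>
  For a permutation \<open>w\<close> of \<open>{1..n}\<close>, its cycles (fixed points included) are represented by their
  underlying sets, the orbits of \<open>w\<close>; the cycle type is the multiset of their cardinalities.
\<close>

definition perm_cycles :: "nat \<Rightarrow> (nat \<Rightarrow> nat) \<Rightarrow> nat set set" where
  "perm_cycles n w = orbit w ` {1..n}"

definition narayana_B_perm :: "nat \<Rightarrow> (nat \<Rightarrow> nat) \<Rightarrow> real poly" where
  "narayana_B_perm n w = (\<Prod>C\<in>perm_cycles n w. narayana_B (card C))"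

end

theory Submission
  imports Defs "HOL-Combinatorics.Stirling" "HOL-Computational_Algebra.Formal_Power_Series"
begin

text \<open>
  Let a nonempty poset \<open>B\<close> be substituted for \<open>S\<close>. A tubing of the result splits into the tubes
  inside \<open>B\<close> and the outer tubes. The outer tubes cut \<open>B\<close> into \<open>k\<close> consecutive nonempty blocks, that
  is, they determine an order-preserving surjection \<open>\<pi>\<close> of \<open>B\<close> onto a chain with \<open>k\<close> elements, and they
  are pulled back along \<open>\<pi>\<close> from a tubing of the poset in which \<open>S\<close> is replaced by that chain. These
  ``skeletons'' do not depend on \<open>B\<close>, and the tubes inside \<open>B\<close> form an arbitrary tubing that respects
  the blocks. So the face number polynomial is \<open>\<Sum>\<^sub>k s\<^sub>k V\<^sub>k(B)\<close> with \<open>s\<^sub>k\<close> independent of \<open>B\<close>.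

  For an antichain with \<open>i\<close> elements, \<open>V\<^sub>k\<close> counts surjections. For a chain with \<open>n\<close> elements, it is
  the coefficient of \<open>x\<^sup>n\<close> in \<open>W\<^sup>k\<close>, where \<open>G = 1 + W\<close> enumerates laminar families of intervals and is
  quadratic over the rational functions. The central coefficients satisfy
  \<open>\<Sum>\<^sub>n B\<^sub>n\<^sub>+\<^sub>1(z) x\<^sup>n = ((1 - (1 + z) x)\<^sup>2 - 4 z x\<^sup>2)\<^sup>-\<^sup>1\<^sup>/\<^sup>2\<close>, and with \<open>z = 1 + t\<close> this gives
  \<open>G' = t (\<Sum>\<^sub>n B\<^sub>n\<^sub>+\<^sub>1(z) x\<^sup>n) G\<close>. The resulting recurrence for the coefficients of \<open>W\<^sup>k\<close> is the one obtained
  for the sum over permutations by removing the cycle through a chosen point.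
\<close>

section \<open>Generating functions\<close>

text \<open>The numbers \<open>s_k\<close> are never computed. They are common to P and all P_i, and
  the claim is linear in them, so both sides are compared for each k separately; P then drops out,
  and what remains relates a sum over permutations, with \<open>fact k * Stirling l k\<close>
  surjections for l cycles, to \<open>chain_sum\<close>. A face with m tubes has dimension |P| - 2 -
  m, so at a real t > 0 the f-polynomial is t^(|P| - 2) times the sum of (1/t)^m over all tubings: a
  tube has weight y = 1/t and each substituted element has weight t, which puts the extra factor t
  on every cycle. The shift z = 1 + t is the passage from f to h. The obstacle on the combinatorial
  side is that the covering relations around B change with B. For convex sets, however,
  connectedness can be tested on comparabilities, and those between B and its complement are the
  same for every element of B. So an outer tube may be collapsed along B, and apart from size the
  order of B only decides whether its trace on B is a down-set or an up-set.\<close>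

definition central_poly :: "nat \<Rightarrow> real poly" where
  "central_poly n = (\<Sum>k\<le>n. monom (real ((n choose k)\<^sup>2)) k)"

lemma coeff_central_poly: "coeff (central_poly n) k = (real (n choose k))\<^sup>2"
  by (simp add: central_poly_def coeff_sum if_distrib[of "\<lambda>x. _ x"] binomial_eq_0
      sum.delta cong: if_cong)

lemma narayana_B_Suc: "narayana_B (Suc n) = central_poly n"
  by (simp add: narayana_B_def central_poly_def lessThan_Suc_atMost)

text \<open>With P_n the Legendre polynomial, \<open>central_poly n\<close> at z is (1 - z)^n P_n((1
  + z) / (1 - z)), and this is the three-term recurrence of the P_n. It is verified coefficientwise,
  with small indices apart because the shifts by 1 and 2 leave the range there.\<close>

lemma central_poly_recurrence:
  "smult (real n + 2) (central_poly (n + 2)) =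
     smult (2 * real n + 3) ([:1, 1:] * central_poly (n + 1)) -
     smult (real n + 1) ([:1, -2, 1:] * central_poly n)"
proof (rule poly_eqI)
  fix k
  consider "k = 0" | "k = 1" | j where "k = Suc (Suc j)"
    by (metis One_nat_def not0_implies_Suc)
  then show "coeff (smult (real n + 2) (central_poly (n + 2))) k =
    coeff (smult (2 * real n + 3) ([:1, 1:] * central_poly (n + 1)) -
     smult (real n + 1) ([:1, -2, 1:] * central_poly n)) k"
  proof cases
    case 1
    then show ?thesis by (simp add: coeff_central_poly)
  next
    case 2
    then show ?thesis
      by (simp add: coeff_central_poly power2_eq_square algebra_simps)
  next
    case (3 j)
    define p q s where "p = real (n choose j)" and "q = real (n choose (j + 1))"
      and "s = real (n choose (j + 2))"
    have ratio: "(real i + 1) * real (n choose (i + 1)) = (real n - real i) * real (n choose i)" for i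
    proof (cases "i \<le> n")
      case True
      have "Suc i * (n choose Suc i) = (n - i) * (n choose i)"
        by (metis binomial_absorb_comp binomial_absorption mult.commute)
      then have "real (Suc i * (n choose Suc i)) = real ((n - i) * (n choose i))"
        by (rule arg_cong)
      then show ?thesis using True by (simp add: of_nat_diff algebra_simps)
    qed (simp add: binomial_eq_0)
    have q: "(real j + 1) * q = (real n - real j) * p"
      using ratio[of j] by (simp add: p_def q_def)
    have s: "(real j + 2) * s = (real n - real j - 1) * q"
      using ratio[of "j + 1"] by (simp add: s_def q_def algebra_simps)
    \<comment> \<open>By Pascal's rule the coefficient of \<open>central_poly (n + 2)\<close> is the
      square of p + 2 q + s. In the identity to be shown the squares of p and s cancel, leaving n
      q^2 = p q + q s + (n + 2) p s; the next two facts combine to this.\<close>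
    have "(real n + 2) * (p * s) = (real j + 1) * q * s + (real n - real j - 1) * q * p"
      using q s by algebra
    moreover have "(real n - real j) * p * q + (real j + 2) * s * q = real n * q\<^sup>2"
      using q s by algebra
    ultimately have "(real n + 2) * (p + 2 * q + s)\<^sup>2 =
        (2 * real n + 3) * ((q + s)\<^sup>2 + (p + q)\<^sup>2) - (real n + 1) * (s\<^sup>2 - 2 * q\<^sup>2 + p\<^sup>2)"
      by (simp add: power2_eq_square algebra_simps)
    then show ?thesis
      by (simp add: 3 coeff_central_poly p_def q_def s_def add_ac)
  qed
qed

definition central_fps :: "real \<Rightarrow> real fps" where
  "central_fps z = Abs_fps (\<lambda>n. poly (central_poly n) z)"

text \<open>The expansion of (1 - (1 + z) x)^2 - 4 z x^2; at z = 1 + t it is, up to the factor t^2,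
  the discriminant of the quadratic equation for \<open>weight_fps\<close>.\<close>

definition central_discrim :: "real \<Rightarrow> real fps" where
  "central_discrim z = 1 - fps_const (2 * (1 + z)) * fps_X + fps_const ((1 - z)\<^sup>2) * fps_X ^ 2"

text \<open>Coefficientwise this is \<open>central_poly_recurrence\<close>, whose factors linear in
  n become a derivative.\<close>

lemma central_fps_ode:
  "central_discrim z * fps_deriv (central_fps z) =
     (fps_const (1 + z) - fps_const ((1 - z)\<^sup>2) * fps_X) * central_fps z"
proof (rule fps_ext)
  fix n
  have nth: "fps_nth (central_discrim z * f) n = fps_nth f n
     - 2 * (1 + z) * (if n = 0 then 0 else fps_nth f (n - 1))
     + (1 - z)\<^sup>2 * (if n < 2 then 0 else fps_nth f (n - 2))" for f n
    by (simp add: central_discrim_def distrib_right left_diff_distrib mult.assoc)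
      (auto simp: fps_X_power_mult_nth)
  have rec: "(real n + 2) * poly (central_poly (n + 2)) z =
     (2 * real n + 3) * ((1 + z) * poly (central_poly (n + 1)) z) -
     (real n + 1) * ((1 - z)\<^sup>2 * poly (central_poly n) z)" for n
    using arg_cong[OF central_poly_recurrence[of n], of "\<lambda>p. poly p z"]
    by (simp add: power2_eq_square algebra_simps)
  consider "n = 0" | "n = 1" | j where "n = Suc (Suc j)"
    by (metis One_nat_def not0_implies_Suc)
  then show "fps_nth (central_discrim z * fps_deriv (central_fps z)) n =
     fps_nth ((fps_const (1 + z) - fps_const ((1 - z)\<^sup>2) * fps_X) * central_fps z) n"
  proof cases
    case 1
    then show ?thesis
      unfolding nth by (simp add: central_fps_def central_poly_def left_diff_distrib mult.assoc poly_monom)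
  next
    case 2
    then show ?thesis
      unfolding nth using rec[of 0]
      by (simp add: central_fps_def left_diff_distrib mult.assoc numeral_2_eq_2 algebra_simps)
  next
    case (3 j)
    then show ?thesis
      unfolding nth using rec[of "j + 1"]
      by (simp add: central_fps_def left_diff_distrib mult.assoc) (simp add: algebra_simps)
  qed
qed

text \<open>The differential equation says d B' = -(d' / 2) B for the discriminant d, so B^2 d has
  derivative zero and equals its constant coefficient. Squaring sidesteps square roots of power
  series; the question of sign returns once, in \<open>weight_fps_deriv\<close>.\<close>

lemma central_fps_square: "(central_fps z)\<^sup>2 * central_discrim z = 1"
proof -
  let ?B = "central_fps z" and ?d = "central_discrim z"
  let ?c = "fps_const (1 + z) - fps_const ((1 - z)\<^sup>2) * fps_X :: real fps"
  have d: "fps_deriv ?d = - 2 * ?c"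
    by (simp add: central_discrim_def power2_eq_square fps_const_mult[symmetric]
       numeral_fps_const algebra_simps del: fps_const_mult fps_const_add fps_const_sub)
  have "fps_deriv (?B\<^sup>2 * ?d) = ?B * (2 * (?d * fps_deriv ?B) + ?B * fps_deriv ?d)"
    by (simp add: power2_eq_square algebra_simps)
  also have "\<dots> = 0"
    unfolding central_fps_ode d by (simp add: algebra_simps)
  finally have "?B\<^sup>2 * ?d = fps_const (fps_nth (?B\<^sup>2 * ?d) 0)"
    by (simp only: fps_deriv_eq_0_iff)
  also have "fps_nth (?B\<^sup>2 * ?d) 0 = 1"
    by (simp add: central_fps_def central_discrim_def central_poly_def poly_monom power2_eq_square)
  finally show ?thesis by simp
qed

text \<open>The factor t^n is the contribution of n chain elements to t^(|P| - 2), so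
  \<open>l n\<close> need only carry (1/t)^m for m tubes.\<close>

definition weight_fps :: "real \<Rightarrow> (nat \<Rightarrow> real) \<Rightarrow> real fps" where
  "weight_fps t l = Abs_fps (\<lambda>n. t ^ n * l n)"

text \<open>
  Below, \<open>l n\<close> is the generating polynomial, evaluated at \<open>1 / t\<close>, of the laminar families of
  intervals in a chain of \<open>n\<close> elements; the recursion splits off the first maximal block.
\<close>

lemma weight_fps_quadratic:
  assumes "t > 0" and l0: "l 0 = 1" and
    rec: "\<And>n. n \<ge> 1 \<Longrightarrow> l n = l (n - 1) + (\<Sum>m=2..n. l m * l (n - m)) / (1 + t)"
  defines "G \<equiv> weight_fps t l"
  shows "G\<^sup>2 = (fps_const (2 + t) - fps_const (t\<^sup>2) * fps_X) * G - fps_const (1 + t)"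
proof -
  have l1: "l 1 = 1" using rec[of 1] l0 by simp
  \<comment> \<open>The recursion, summed: on the left G - 1 - t x G collects l n - l (n - 1) for n
    \<ge> 1; on the right G - 1 - t x strips the coefficients of G at 0 and 1, since a block starts
    at length 2.\<close>
  have eq: "fps_const (1 + t) * (G - 1 - fps_const t * fps_X * G) =
     (G - 1 - fps_const t * fps_X) * G"
  proof (rule fps_ext)
    fix n
    show "fps_nth (fps_const (1 + t) * (G - 1 - fps_const t * fps_X * G)) n =
       fps_nth ((G - 1 - fps_const t * fps_X) * G) n"
    proof (cases n)
      case 0
      then show ?thesis by (simp add: G_def weight_fps_def l0 mult.assoc)
    next
      case (Suc j)
      have "fps_nth ((G - 1 - fps_const t * fps_X) * G) n =
         (\<Sum>m=0..n. (t ^ m * l m - (if m = 0 then 1 else 0) - (if m = 1 then t else 0))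
            * (t ^ (n - m) * l (n - m)))"
        by (auto simp: fps_mult_nth[of "_ - _"] G_def weight_fps_def fps_mult_left_const_nth fps_X_nth intro!: sum.cong)
      also have "\<dots> = (\<Sum>m=2..n. (t ^ m * l m) * (t ^ (n - m) * l (n - m)))"
        using l0 l1 by (intro sum.mono_neutral_cong_right) (auto simp: not_le less_Suc_eq numeral_2_eq_2)
      also have "\<dots> = (\<Sum>m=2..n. t ^ n * (l m * l (n - m)))"
        by (intro sum.cong refl) (auto simp: power_add[symmetric] mult.left_commute mult.assoc
           simp flip: mult.assoc[of "t ^ _" "t ^ _"])
      also have "\<dots> = t ^ n * (\<Sum>m=2..n. l m * l (n - m))"
        by (simp add: sum_distrib_left)
      finally have 1: "fps_nth ((G - 1 - fps_const t * fps_X) * G) n =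
          t ^ n * (\<Sum>m=2..n. l m * l (n - m))" .
      have "(\<Sum>m=2..n. l m * l (n - m)) = (1 + t) * (l n - l j)"
        using rec[of n] Suc \<open>t > 0\<close> by (simp add: field_simps)
      then show ?thesis unfolding 1
        by (simp add: Suc mult.assoc) (simp add: G_def weight_fps_def algebra_simps)
    qed
  qed
  have c: "fps_const (2 + t) = 2 + fps_const t" "fps_const (t\<^sup>2) = fps_const t * fps_const t"
    "fps_const (1 + t) = 1 + fps_const t"
    by (simp_all add: numeral_fps_const power2_eq_square flip: fps_const_add fps_const_1_eq_1)
  show ?thesis using eq unfolding c
    by (simp add: power2_eq_square algebra_simps del: fps_const_mult fps_const_add fps_const_neg)
qed

text \<open>Let G^2 = c G - (1 + t) be the quadratic and B the series
  \<open>central_fps (1 + t)\<close>. The discriminant is t^2 / B^2, so 2 G - c = -t / B.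
  Differentiating the quadratic gives G' (2 G - c) = -t^2 G, and multiplying by B clears the
  root.\<close>

lemma weight_fps_deriv:
  assumes "t > 0" "l 0 = 1"
    "\<And>n. n \<ge> 1 \<Longrightarrow> l n = l (n - 1) + (\<Sum>m=2..n. l m * l (n - m)) / (1 + t)"
  defines "G \<equiv> weight_fps t l"
  shows "fps_deriv G = fps_const t * central_fps (1 + t) * G"
proof -
  let ?B = "central_fps (1 + t)"
  define c where "c = fps_const (2 + t) - fps_const (t\<^sup>2) * fps_X"
  have q: "G\<^sup>2 = c * G - fps_const (1 + t)"
    unfolding G_def c_def by (rule weight_fps_quadratic) (use assms in auto)
  have c2: "c\<^sup>2 - 4 * fps_const (1 + t) = fps_const (t\<^sup>2) * central_discrim (1 + t)"
  proof -
    have k: "fps_const (2 + t) = 2 + fps_const t" "fps_const (t\<^sup>2) = fps_const t * fps_const t"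
      "fps_const (1 + t) = 1 + fps_const t" "fps_const (2 * (1 + (1 + t))) = 2 * (2 + fps_const t)"
      "fps_const ((1 - (1 + t))\<^sup>2) = fps_const t * fps_const t"
      by (simp_all add: numeral_fps_const power2_eq_square flip: fps_const_add fps_const_1_eq_1)
    show ?thesis unfolding c_def central_discrim_def k
      by (simp add: power2_eq_square algebra_simps)
  qed
  have "(2 * G - c)\<^sup>2 = fps_const (t\<^sup>2) * central_discrim (1 + t)"
  proof -
    have "(2 * G - c)\<^sup>2 = 4 * (G\<^sup>2 - c * G) + c\<^sup>2" by (simp add: power2_eq_square algebra_simps)
    also have "\<dots> = c\<^sup>2 - 4 * fps_const (1 + t)" unfolding q by (simp add: algebra_simps)
    finally show ?thesis by (simp only: c2)
  qed
  then have "((2 * G - c) * ?B)\<^sup>2 = fps_const (t\<^sup>2) * (?B\<^sup>2 * central_discrim (1 + t))"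
    by (simp add: power_mult_distrib mult_ac)
  then have "((2 * G - c) * ?B)\<^sup>2 = (fps_const t)\<^sup>2"
    by (simp only: central_fps_square) (simp add: power2_eq_square)
  \<comment> \<open>The constant coefficient decides the sign of the square root.\<close>
  then have "(2 * G - c) * ?B = fps_const t \<or> (2 * G - c) * ?B = - fps_const t"
    by (simp only: power2_eq_iff)
  moreover have "fps_nth ((2 * G - c) * ?B) 0 = - t"
    by (simp add: G_def c_def weight_fps_def assms(2) central_fps_def central_poly_def poly_monom)
  moreover have "fps_nth (fps_const t) 0 \<noteq> - t" using \<open>t > 0\<close> by simp
  ultimately have B: "(2 * G - c) * ?B = - fps_const t"
    by metis
  have "fps_deriv (G\<^sup>2) = fps_deriv (c * G - fps_const (1 + t))" by (simp only: q)
  moreover have "fps_deriv c = - fps_const (t\<^sup>2)" by (simp add: c_def)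
  ultimately have "fps_deriv G * (2 * G - c) = - (fps_const (t\<^sup>2) * G)"
    by (simp add: power2_eq_square algebra_simps del: fps_const_neg)
  then have "fps_deriv G * (2 * G - c) * ?B = - (fps_const (t\<^sup>2) * G) * ?B"
    by (rule arg_cong)
  then have "fps_deriv G * (- fps_const t) = - (fps_const (t\<^sup>2) * G) * ?B"
    by (simp only: mult.assoc B)
  moreover have "fps_const (t\<^sup>2) = fps_const t * fps_const t"
    by (simp add: power2_eq_square)
  ultimately have "fps_const t * fps_deriv G = fps_const t * (fps_const t * ?B * G)"
    by (simp only: mult_minus_left mult_minus_right neg_equal_iff_equal mult_ac)
  moreover have "fps_const t \<noteq> 0" using \<open>t > 0\<close> by simp
  ultimately show ?thesis using mult_left_cancel by blast
qed

text \<open>From W' = t B (W + 1), with B the central series, follows (W^(k+1))' = (k + 1) t B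
  (W^(k+1) + W^k). The two powers match the two terms in the recursion for numbers of surjections,
  which is what \<open>cycle_sum_eqI\<close> asks for.\<close>

lemma weight_fps_power_recurrence:
  assumes "t > 0" "l 0 = 1"
    "\<And>n. n \<ge> 1 \<Longrightarrow> l n = l (n - 1) + (\<Sum>m=2..n. l m * l (n - m)) / (1 + t)"
  defines "W \<equiv> weight_fps t l - 1"
  shows "real (Suc n) * fps_nth (W ^ Suc k) (Suc n) =
    (\<Sum>m=0..n. t * poly (narayana_B (Suc m)) (1 + t) *
       (real (Suc k) * (fps_nth (W ^ Suc k) (n - m) + fps_nth (W ^ k) (n - m))))"
proof -
  have "fps_deriv W = fps_const t * central_fps (1 + t) * (W + 1)"
    unfolding W_def using weight_fps_deriv[OF assms(1-3)] by simp
  then have "fps_deriv (W ^ Suc k) =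
     (fps_const t * central_fps (1 + t)) * (fps_const (real (Suc k)) * (W ^ Suc k + W ^ k))"
    by (simp only: fps_deriv_power diff_Suc_1) (simp add: algebra_simps)
  then have "fps_nth (fps_deriv (W ^ Suc k)) n =
     fps_nth ((fps_const t * central_fps (1 + t)) * (fps_const (real (Suc k)) * (W ^ Suc k + W ^ k))) n"
    by simp
  then show ?thesis
    by (simp only: fps_deriv_nth fps_mult_nth[of "fps_const t * _"] fps_mult_left_const_nth
        fps_add_nth Suc_eq_plus1[symmetric])
       (simp add: central_fps_def narayana_B_Suc)
qed

section \<open>Sums over permutations\<close>

lemma sum_Pow_card:
  fixes \<phi> :: "nat \<Rightarrow> 'b::comm_semiring_1"
  assumes "finite T"
  shows "(\<Sum>C\<in>Pow T. \<phi> (card C)) = (\<Sum>m\<le>card T. of_nat (card T choose m) * \<phi> m)"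
proof -
  have "(\<Sum>C\<in>Pow T. \<phi> (card C)) = (\<Sum>m\<le>card T. \<Sum>C\<in>{C\<in>Pow T. card C = m}. \<phi> (card C))"
    by (rule sum.group[symmetric]) (use assms in \<open>auto intro: card_mono\<close>)
  also have "\<dots> = (\<Sum>m\<le>card T. of_nat (card T choose m) * \<phi> m)"
    using n_subsets[OF assms] by (intro sum.cong refl) (simp add: Pow_def)
  finally show ?thesis .
qed

lemma sum_subsets_containing:
  fixes \<phi> :: "nat \<Rightarrow> 'b::comm_semiring_1"
  assumes "finite S" "x \<in> S" "card S = Suc n"
  shows "(\<Sum>C | x \<in> C \<and> C \<subseteq> S. \<phi> (card C)) = (\<Sum>m\<le>n. of_nat (n choose m) * \<phi> (Suc m))"
proof -
  have "(\<Sum>C | x \<in> C \<and> C \<subseteq> S. \<phi> (card C)) = (\<Sum>C\<in>Pow (S - {x}). \<phi> (Suc (card C)))"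
  proof (rule sum.reindex_bij_witness[where i = "insert x" and j = "\<lambda>C. C - {x}"])
    fix C assume C: "C \<in> {C. x \<in> C \<and> C \<subseteq> S}"
    then have "finite C" using assms(1) finite_subset by blast
    with C show "\<phi> (Suc (card (C - {x}))) = \<phi> (card C)"
      by (metis (mono_tags) card_Suc_Diff1 mem_Collect_eq)
  qed (use assms in auto)
  also have "\<dots> = (\<Sum>m\<le>n. of_nat (n choose m) * \<phi> (Suc m))"
    using sum_Pow_card[of "S - {x}" "\<lambda>m. \<phi> (Suc m)"] assms by simp
  finally show ?thesis .
qed

section \<open>Splitting a permutation at the cycle through a point\<close>

definition cyclic_perms :: "'a set \<Rightarrow> ('a \<Rightarrow> 'a) set" where
  "cyclic_perms C = {\<sigma>. \<sigma> permutes C \<and> cyclic_on \<sigma> C}"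

text \<open>\<open>\<sigma>\<close> and \<open>u\<close> move disjoint sets, so each acts alone on
  its own set. The two restrictions recover them from the product, which makes the splitting in
  \<open>sum_permutes_split_orbit\<close> a bijection.\<close>

lemma orbit_split:
  assumes "finite S" "x \<in> C" "C \<subseteq> S" "\<sigma> permutes C" "cyclic_on \<sigma> C" "u permutes (S - C)"
  shows "(\<sigma> \<circ> u) permutes S" "orbit (\<sigma> \<circ> u) x = C"
    "perm_restrict (\<sigma> \<circ> u) C = \<sigma>" "perm_restrict (\<sigma> \<circ> u) (S - C) = u"
    "y \<in> S - C \<Longrightarrow> orbit (\<sigma> \<circ> u) y = orbit u y"
proof -
  show "(\<sigma> \<circ> u) permutes S"
    using assms by (intro permutes_compose) (auto intro: permutes_subset)
  have "cyclic_on (\<sigma> \<circ> u) C"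
    using assms by (intro permutes_comp_preserves_cyclic1[where A = C and B = "S - C"]) auto
  then show "orbit (\<sigma> \<circ> u) x = C" using assms(2) by (rule orbit_cyclic_eq3)
  show "perm_restrict (\<sigma> \<circ> u) C = \<sigma>"
    using assms by (auto simp: fun_eq_iff perm_restrict_def permutes_def)
  show "perm_restrict (\<sigma> \<circ> u) (S - C) = u"
  proof
    fix y
    show "perm_restrict (\<sigma> \<circ> u) (S - C) y = u y"
    proof (cases "y \<in> S - C")
      case True
      then have "u y \<notin> C" using assms(6) by (metis DiffD2 permutes_in_image)
      then show ?thesis using True assms(4) by (simp add: perm_restrict_def permutes_not_in)
    next
      case False
      then show ?thesis using assms(6) by (metis perm_restrict_simps(2) permutes_not_in)
    qed
  qed
  assume y: "y \<in> S - C"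
  have u: "permutation u" using assms(1,6) by (auto simp: permutation_permutes)
  have "cyclic_on (\<sigma> \<circ> u) (orbit u y)"
    using assms y u cyclic_on_orbit'[OF u] permutes_orbit_subset[OF assms(6) y]
    by (intro permutes_comp_preserves_cyclic2[where A = C and B = "S - C"]) auto
  then show "orbit (\<sigma> \<circ> u) y = orbit u y"
    using permutation_self_in_orbit[OF u] by (rule orbit_cyclic_eq3)
qed

lemma sum_permutes_split_orbit:
  fixes F :: "('a \<Rightarrow> 'a) \<Rightarrow> 'b::comm_monoid_add"
  assumes S: "finite S" "x \<in> S"
  shows "(\<Sum>w | w permutes S. F w) =
    (\<Sum>C | x \<in> C \<and> C \<subseteq> S. \<Sum>\<sigma>\<in>cyclic_perms C. \<Sum>u | u permutes (S - C). F (\<sigma> \<circ> u))"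
proof -
  have fin: "finite {u. u permutes (S - C)}" "C \<subseteq> S \<Longrightarrow> finite (cyclic_perms C)" for C
    using S(1) finite_permutations[of "S - C"]
    by (auto simp: cyclic_perms_def intro: finite_subset[OF _ finite_permutations[of C]] finite_subset)
  have "(\<Sum>C | x \<in> C \<and> C \<subseteq> S. \<Sum>\<sigma>\<in>cyclic_perms C. \<Sum>u | u permutes (S - C). F (\<sigma> \<circ> u)) =
     (\<Sum>(C, \<sigma>, u)\<in>(SIGMA C:{C. x \<in> C \<and> C \<subseteq> S}. cyclic_perms C \<times> {u. u permutes (S - C)}). F (\<sigma> \<circ> u))"
    using S(1) fin by (simp add: sum.cartesian_product sum.Sigma)
  also have "\<dots> = (\<Sum>w | w permutes S. F w)"
  proof (rule sum.reindex_bij_witness[where j = "\<lambda>(C, \<sigma>, u). \<sigma> \<circ> u" and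
      i = "\<lambda>w. (orbit w x, perm_restrict w (orbit w x), perm_restrict w (S - orbit w x))"], goal_cases)
    case (1 a)
    then show ?case using orbit_split[OF S(1), of x] by (auto simp: cyclic_perms_def)
  next
    case (2 a)
    then show ?case using orbit_split(1)[OF S(1), of x] by (auto simp: cyclic_perms_def)
  next
    case (3 w)
    then have w: "w permutes S" by simp
    have c: "cyclic_on w (orbit w x)" by (rule cyclic_on_orbit[OF w S(1)])
    have "(perm_restrict w (orbit w x) \<circ> perm_restrict w (S - orbit w x)) y = w y" for y
    proof (cases "y \<in> S - orbit w x")
      case True
      then have "w y \<notin> orbit w x" using cyclic_on_f_in[OF w c] by blast
      then show ?thesis using True by (simp add: perm_restrict_def)
    next
      case False
      then show ?thesis using permutes_not_in[OF w] by (auto simp: perm_restrict_def)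
    qed
    then have "perm_restrict w (orbit w x) \<circ> perm_restrict w (S - orbit w x) = w" ..
    then show ?case by simp
  next
    case (4 w)
    then have w: "w permutes S" by simp
    have c: "cyclic_on w (orbit w x)" by (rule cyclic_on_orbit[OF w S(1)])
    have "x \<in> orbit w x" using w S(1) by (auto intro!: permutation_self_in_orbit simp: permutation_permutes)
    moreover have "perm_restrict w (orbit w x) permutes orbit w x"
    proof (rule bij_imp_permutes)
      have "inj_on (perm_restrict w (orbit w x)) (orbit w x)"
        using permutes_inj[OF w] by (auto simp: inj_on_def perm_restrict_def)
      moreover have "perm_restrict w (orbit w x) ` orbit w x \<subseteq> orbit w x"
        using cyclic_on_inI[OF c] by (auto simp: perm_restrict_def)
      ultimately show "bij_betw (perm_restrict w (orbit w x)) (orbit w x) (orbit w x)"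
        using finite_cyclic_on[OF c] by (simp add: bij_betw_def endo_inj_surj)
    qed (simp add: perm_restrict_def)
    moreover have "orbit w x \<subseteq> S" using permutes_orbit_subset[OF w S(2)] .
    ultimately show ?case
      using c perm_restrict_diff_cyclic[OF w c] by (auto simp: cyclic_perms_def cyclic_on_perm_restrict)
  next
    case (5 a)
    then show ?case by (auto split: prod.splits)
  qed
  finally show ?thesis by simp
qed

text \<open>All permutations of S are counted by the cycle C through x. The numbers (|C| - 1)! (|S|
  - |C|)! also add up to |S|!, because with |S| = n + 1 each of the n + 1 possible sizes of C
  contributes n!. By induction the terms with C a proper subset agree, so the term C = S agrees
  too.\<close>

lemma card_cyclic_perms:
  assumes "finite C" "C \<noteq> {}"
  shows "card (cyclic_perms C) = fact (card C - 1)"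
  using assms
proof (induction C rule: finite_psubset_induct)
  case (psubset S)
  then obtain x where x: "x \<in> S" by blast
  obtain n where n: "card S = Suc n" using psubset(1) x by (metis card_gt_0_iff empty_iff gr0_implies_Suc)
  have "(\<Sum>w | w permutes S. 1 :: nat) =
    (\<Sum>C | x \<in> C \<and> C \<subseteq> S. card (cyclic_perms C) * fact (card S - card C))"
    unfolding sum_permutes_split_orbit[OF psubset(1) x]
    using psubset(1) by (intro sum.cong refl) (auto simp: card_permutations card_Diff_subset finite_subset)
  also have "\<dots> = (\<Sum>C\<in>insert S {C. x \<in> C \<and> C \<subset> S}. card (cyclic_perms C) * fact (card S - card C))"
    using x by (intro sum.cong) auto
  also have "\<dots> = card (cyclic_perms S) + (\<Sum>C | x \<in> C \<and> C \<subset> S. card (cyclic_perms C) * fact (card S - card C))"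
    using psubset(1) by (subst sum.insert) (auto intro: finite_subset[of _ "Pow S"])
  also have "(\<Sum>C | x \<in> C \<and> C \<subset> S. card (cyclic_perms C) * fact (card S - card C)) =
     (\<Sum>C | x \<in> C \<and> C \<subset> S. fact (card C - 1) * fact (card S - card C))"
    using psubset.IH by (intro sum.cong refl) auto
  finally have 1: "fact (Suc n) = card (cyclic_perms S) +
     (\<Sum>C | x \<in> C \<and> C \<subset> S. fact (card C - 1) * fact (card S - card C))"
    using psubset(1) by (simp add: card_permutations n)
  have "(\<Sum>C | x \<in> C \<and> C \<subseteq> S. fact (card C - 1) * fact (card S - card C)) =
     (\<Sum>m\<le>n. (n choose m) * (fact m * fact (n - m) :: nat))"
    using sum_subsets_containing[OF psubset(1) x n, of "\<lambda>c. fact (c - 1) * fact (card S - c) :: nat"]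
    by (simp add: n)
  also have "\<dots> = (\<Sum>m\<le>n. fact n)"
    using binomial_fact_lemma[of _ n] by (intro sum.cong refl) (simp add: mult_ac)
  finally have 2: "(\<Sum>C | x \<in> C \<and> C \<subseteq> S. fact (card C - 1) * fact (card S - card C)) = (fact (Suc n) :: nat)"
    by simp
  have "(\<Sum>C | x \<in> C \<and> C \<subseteq> S. fact (card C - 1) * fact (card S - card C)) =
    (\<Sum>C\<in>insert S {C. x \<in> C \<and> C \<subset> S}. fact (card C - 1) * (fact (card S - card C) :: nat))"
    using x by (intro sum.cong) auto
  also have "\<dots> = fact n + (\<Sum>C | x \<in> C \<and> C \<subset> S. fact (card C - 1) * fact (card S - card C))"
    using psubset(1) by (subst sum.insert) (auto simp: n intro: finite_subset[of _ "Pow S"])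
  finally show ?case using 1 2 by (simp add: n)
qed

text \<open>The set is arbitrary rather than \<open>{1..n}\<close> because the recursion deletes an
  arbitrary cycle from it; \<open>g\<close> is a parameter because the deletion shifts the number of
  cycles.\<close>

definition cycle_sum :: "'a set \<Rightarrow> (nat \<Rightarrow> real) \<Rightarrow> (nat \<Rightarrow> real) \<Rightarrow> real" where
  "cycle_sum S a g = (\<Sum>w | w permutes S. (\<Prod>C\<in>orbit w ` S. a (card C)) * g (card (orbit w ` S)))"

lemma cycle_sum_empty: "cycle_sum {} a g = g 0"
  by (simp add: cycle_sum_def)

text \<open>For each C the (|C| - 1)! cyclic permutations contribute equally, and
  \<open>g (Suc k)\<close> accounts for the deleted cycle.\<close>

lemma cycle_sum_split:
  assumes S: "finite S" "x \<in> S"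
  shows "cycle_sum S a g = (\<Sum>C | x \<in> C \<and> C \<subseteq> S.
    fact (card C - 1) * a (card C) * cycle_sum (S - C) a (\<lambda>k. g (Suc k)))"
  unfolding cycle_sum_def[of S] sum_permutes_split_orbit[OF S]
proof (intro sum.cong refl)
  fix C assume C: "C \<in> {C. x \<in> C \<and> C \<subseteq> S}"
  have "(\<Sum>u | u permutes (S - C). (\<Prod>D\<in>orbit (\<sigma> \<circ> u) ` S. a (card D)) * g (card (orbit (\<sigma> \<circ> u) ` S))) =
     a (card C) * cycle_sum (S - C) a (\<lambda>k. g (Suc k))" if \<sigma>: "\<sigma> \<in> cyclic_perms C" for \<sigma>
    unfolding cycle_sum_def sum_distrib_left
  proof (intro sum.cong refl)
    fix u assume u: "u \<in> {u. u permutes (S - C)}"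
    have sp: "orbit (\<sigma> \<circ> u) y = C" if "y \<in> C" for y
      using orbit_split(2)[OF S(1) that, of \<sigma> u] C \<sigma> u by (auto simp: cyclic_perms_def)
    have sp2: "orbit (\<sigma> \<circ> u) y = orbit u y" if "y \<in> S - C" for y
      using orbit_split(5)[OF S(1), of x C \<sigma> u y] that C \<sigma> u by (auto simp: cyclic_perms_def)
    have "orbit (\<sigma> \<circ> u) ` S = orbit (\<sigma> \<circ> u) ` C \<union> orbit (\<sigma> \<circ> u) ` (S - C)" using C by auto
    also have "orbit (\<sigma> \<circ> u) ` C = {C}" using sp C by auto
    also have "orbit (\<sigma> \<circ> u) ` (S - C) = orbit u ` (S - C)" using sp2 by auto
    finally have eq: "orbit (\<sigma> \<circ> u) ` S = insert C (orbit u ` (S - C))"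
      by (simp only: insert_is_Un[symmetric])
    have "finite (orbit u ` (S - C))" "C \<notin> orbit u ` (S - C)"
      using permutes_orbit_subset[of u "S - C"] u C S(1) by auto
    note ins = prod.insert[OF this] card_insert_disjoint[OF this]
    show "(\<Prod>D\<in>orbit (\<sigma> \<circ> u) ` S. a (card D)) * g (card (orbit (\<sigma> \<circ> u) ` S)) =
      a (card C) * ((\<Prod>D\<in>orbit u ` (S - C). a (card D)) * g (Suc (card (orbit u ` (S - C)))))"
      by (simp only: eq ins mult.assoc)
  qed
  then have "(\<Sum>\<sigma>\<in>cyclic_perms C. \<Sum>u | u permutes (S - C).
      (\<Prod>D\<in>orbit (\<sigma> \<circ> u) ` S. a (card D)) * g (card (orbit (\<sigma> \<circ> u) ` S))) =
      (\<Sum>\<sigma>\<in>cyclic_perms C. a (card C) * cycle_sum (S - C) a (\<lambda>k. g (Suc k)))"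
    by (intro sum.cong refl)
  also have "\<dots> = real (card (cyclic_perms C)) * (a (card C) * cycle_sum (S - C) a (\<lambda>k. g (Suc k)))"
    by (rule sum_constant)
  also have "card (cyclic_perms C) = fact (card C - 1)"
    using C S(1) by (intro card_cyclic_perms) (auto intro: finite_subset)
  finally show "(\<Sum>\<sigma>\<in>cyclic_perms C. \<Sum>u | u permutes (S - C).
      (\<Prod>D\<in>orbit (\<sigma> \<circ> u) ` S. a (card D)) * g (card (orbit (\<sigma> \<circ> u) ` S))) =
     fact (card C - 1) * a (card C) * cycle_sum (S - C) a (\<lambda>k. g (Suc k))"
    by (simp only: of_nat_fact mult.assoc)
qed

text \<open>The exponential formula as a recurrence: remove the cycle through a chosen point.\<close>

lemma cycle_sum_eqI:
  fixes g v :: "nat \<Rightarrow> nat \<Rightarrow> real" and S :: "'a set"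
  assumes g: "\<And>k l. g 0 (Suc l) = 0" "\<And>k l. g (Suc k) (Suc l) = real (Suc k) * (g (Suc k) l + g k l)"
    and v: "\<And>k n. real (Suc n) * v (Suc k) (Suc n) =
      (\<Sum>m\<le>n. a (Suc m) * (real (Suc k) * (v (Suc k) (n - m) + v k (n - m))))"
    and v0: "\<And>n. v 0 (Suc n) = 0" "\<And>k. v k 0 = g k 0"
    and S: "finite S"
  shows "cycle_sum S a (g k) = fact (card S) * v k (card S)"
  using S
proof (induction S arbitrary: k rule: finite_psubset_induct)
  case (psubset S)
  show ?case
  proof (cases "S = {}")
    case True
    then show ?thesis by (simp add: cycle_sum_empty v0)
  next
    case False
    then obtain x where x: "x \<in> S" by blast
    obtain n where n: "card S = Suc n" using psubset(1) x by (metis card_gt_0_iff empty_iff gr0_implies_Suc)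
    \<comment> \<open>The recursion of \<open>g\<close> in its second argument splits the shifted
      sum into the cases k and k - 1, to which the induction hypothesis applies.\<close>
    have lin: "cycle_sum T a (\<lambda>l. c * (g1 l + g2 l)) = c * (cycle_sum T a g1 + cycle_sum T a g2)" for T :: "'a set" and c g1 g2
      unfolding cycle_sum_def sum.distrib[symmetric] sum_distrib_left
      by (intro sum.cong refl) (simp add: algebra_simps)
    show ?thesis
    proof (cases k)
      case 0
      have "cycle_sum T a (\<lambda>l. g 0 (Suc l)) = 0" for T :: "'a set"
        by (simp add: cycle_sum_def g)
      then show ?thesis by (simp add: cycle_sum_split[OF psubset(1) x] 0 n v0)
    next
      case (Suc j)
      have "cycle_sum S a (g k) = (\<Sum>C | x \<in> C \<and> C \<subseteq> S. fact (card C - 1) * a (card C) *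
         (fact (card S - card C) * (real k * (v k (card S - card C) + v j (card S - card C)))))"
        unfolding cycle_sum_split[OF psubset(1) x]
      proof (intro sum.cong refl)
        fix C assume C: "C \<in> {C. x \<in> C \<and> C \<subseteq> S}"
        then have "S - C \<subset> S" by auto
        moreover have "card (S - C) = card S - card C"
          using C psubset(1) by (auto intro: card_Diff_subset finite_subset)
        ultimately show "fact (card C - 1) * a (card C) * cycle_sum (S - C) a (\<lambda>l. g k (Suc l)) =
          fact (card C - 1) * a (card C) *
         (fact (card S - card C) * (real k * (v k (card S - card C) + v j (card S - card C))))"
          using psubset.IH[of "S - C" k] psubset.IH[of "S - C" j]
          by (simp only: Suc g lin) (simp add: algebra_simps)
      qed
      also have "\<dots> = (\<Sum>m\<le>n. real (n choose m) * (fact m * a (Suc m) *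
         (fact (n - m) * (real k * (v k (n - m) + v j (n - m))))))"
        using sum_subsets_containing[OF psubset(1) x n, of "\<lambda>c. fact (c - 1) * a c *
         (fact (card S - c) * (real k * (v k (card S - c) + v j (card S - c))))"] by (simp add: n)
      also have "\<dots> = (\<Sum>m\<le>n. fact n * (a (Suc m) * (real k * (v k (n - m) + v j (n - m)))))"
      proof (intro sum.cong refl)
        fix m assume "m \<in> {..n}"
        then have f: "real (n choose m) * (fact m * fact (n - m)) = fact n"
          by (simp add: binomial_fact)
        have "real (n choose m) * (fact m * a (Suc m) *
            (fact (n - m) * (real k * (v k (n - m) + v j (n - m))))) =
          (real (n choose m) * (fact m * fact (n - m))) *
            (a (Suc m) * (real k * (v k (n - m) + v j (n - m))))"
          by (simp only: mult_ac)
        then show "real (n choose m) * (fact m * a (Suc m) *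
            (fact (n - m) * (real k * (v k (n - m) + v j (n - m))))) =
          fact n * (a (Suc m) * (real k * (v k (n - m) + v j (n - m))))"
          by (simp only: f)
      qed
      also have "\<dots> = fact n * (real (Suc n) * v k (Suc n))"
        unfolding Suc v by (simp add: sum_distrib_left)
      finally show ?thesis by (simp add: n)
    qed
  qed
qed

section \<open>Laminar families of intervals\<close>

definition laminar :: "'a set set \<Rightarrow> bool" where
  "laminar N \<longleftrightarrow> (\<forall>U\<in>N. \<forall>V\<in>N. U \<subseteq> V \<or> V \<subseteq> U \<or> U \<inter> V = {})"

text \<open>\<open>i + 1 < j\<close> asks for at least two elements, as tubes do. The full range is
  allowed: S is proper in P, so the whole chain is itself a candidate tube.\<close>

definition long_intervals :: "nat \<Rightarrow> nat \<Rightarrow> nat set set" where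
  "long_intervals a c = {{i..<j} | i j. a \<le> i \<and> i + 1 < j \<and> j \<le> c}"

definition interval_families :: "nat \<Rightarrow> nat \<Rightarrow> nat set set set" where
  "interval_families a c = {N. N \<subseteq> long_intervals a c \<and> laminar N}"

lemma long_intervalsI: "a \<le> i \<Longrightarrow> i + 1 < j \<Longrightarrow> j \<le> c \<Longrightarrow> {i..<j} \<in> long_intervals a c"
  unfolding long_intervals_def by blast

lemma long_intervals_subset: "I \<in> long_intervals a c \<Longrightarrow> I \<subseteq> {a..<c}"
  by (auto simp: long_intervals_def)

lemma long_intervals_nonempty: "I \<in> long_intervals a c \<Longrightarrow> I \<noteq> {}"
  by (auto simp: long_intervals_def)

lemma atLeastLessThan_in_long_intervals: "n \<ge> 2 \<Longrightarrow> {0..<n} \<in> long_intervals 0 n"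
  by (rule long_intervalsI) auto

lemma long_intervals_mono: "a \<le> a' \<Longrightarrow> c' \<le> c \<Longrightarrow> long_intervals a' c' \<subseteq> long_intervals a c"
  unfolding long_intervals_def using le_trans by blast

lemma long_intervals_restrict:
  assumes "I \<in> long_intervals a c" "I \<subseteq> {a'..<c'}"
  shows "I \<in> long_intervals a' c'"
proof -
  obtain i j where "I = {i..<j}" "i + 1 < j" using assms(1) by (auto simp: long_intervals_def)
  moreover from this have "a' \<le> i" "j \<le> c'" using assms(2) by (auto simp: atLeastLessThan_subset_iff)
  ultimately show ?thesis by (auto simp: long_intervals_def)
qed

lemma finite_long_intervals: "finite (long_intervals a c)"
  by (rule finite_subset[of _ "Pow {a..<c}"]) (auto dest: long_intervals_subset)

lemma finite_interval_families: "finite (interval_families a c)"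
  by (rule finite_subset[of _ "Pow (long_intervals a c)"])
    (auto simp: interval_families_def finite_long_intervals)

lemma finite_interval_family: "N \<in> interval_families a c \<Longrightarrow> finite N"
  using finite_long_intervals finite_subset by (auto simp: interval_families_def)

lemma interval_families_subset:
  "N \<in> interval_families a c \<Longrightarrow> M \<subseteq> N \<Longrightarrow> M \<in> interval_families a c"
  unfolding interval_families_def laminar_def by (simp add: subset_iff)

definition family_sum :: "real \<Rightarrow> nat set set set \<Rightarrow> real" where
  "family_sum y \<F> = (\<Sum>N\<in>\<F>. y ^ card N)"

lemma long_intervals_translate: "(`) ((+) d) ` long_intervals a c = long_intervals (a + d) (c + d)"
proof (intro equalityI subsetI)
  fix I assume "I \<in> (`) ((+) d) ` long_intervals a c"
  then obtain i j where "I = (+) d ` {i..<j}" "a \<le> i" "i + 1 < j" "j \<le> c"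
    by (auto simp: long_intervals_def)
  then have "I = {i + d..<j + d} \<and> a + d \<le> i + d \<and> i + d + 1 < j + d \<and> j + d \<le> c + d"
    by (simp add: add.commute)
  then show "I \<in> long_intervals (a + d) (c + d)" unfolding long_intervals_def by blast
next
  fix I assume "I \<in> long_intervals (a + d) (c + d)"
  then obtain i j where I: "I = {i..<j}" "a + d \<le> i" "i + 1 < j" "j \<le> c + d"
    by (auto simp: long_intervals_def)
  then have "I = (+) d ` {i - d..<j - d}" by auto
  moreover have "{i - d..<j - d} \<in> long_intervals a c"
    unfolding long_intervals_def using I by (intro CollectI exI[of _ "i - d"] exI[of _ "j - d"]) auto
  ultimately show "I \<in> (`) ((+) d) ` long_intervals a c" by blast
qed

lemma laminar_image: "inj f \<Longrightarrow> laminar ((`) f ` N) \<longleftrightarrow> laminar N"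
  by (simp add: laminar_def inj_image_subset_iff flip: image_Int)

lemma family_sum_translate:
  "family_sum y (interval_families (a + d) (c + d)) = family_sum y (interval_families a c)"
proof -
  have inj: "inj ((`) ((+) d))" by (simp add: inj_image_eq_iff inj_on_def)
  have "interval_families (a + d) (c + d) = (`) ((`) ((+) d)) ` interval_families a c"
  proof (intro equalityI subsetI)
    fix N assume N: "N \<in> interval_families (a + d) (c + d)"
    then have "N \<subseteq> (`) ((+) d) ` long_intervals a c"
      by (simp add: interval_families_def long_intervals_translate)
    then obtain M where M: "M \<subseteq> long_intervals a c" "N = (`) ((+) d) ` M" by (metis subset_imageE)
    then have "M \<in> interval_families a c"
      using N by (simp add: interval_families_def laminar_image)
    with M show "N \<in> (`) ((`) ((+) d)) ` interval_families a c" by blast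
  next
    fix N assume "N \<in> (`) ((`) ((+) d)) ` interval_families a c"
    then obtain M where M: "M \<in> interval_families a c" "N = (`) ((+) d) ` M" by blast
    then show "N \<in> interval_families (a + d) (c + d)"
      using long_intervals_translate[of d a c] by (auto simp: interval_families_def laminar_image)
  qed
  moreover have "inj_on ((`) ((`) ((+) d))) (interval_families a c)"
    using inj by (metis inj_image_eq_iff inj_onI)
  moreover have "card ((`) ((+) d) ` N) = card N" for N
    using inj by (intro card_image) (auto intro: inj_on_subset)
  ultimately show ?thesis by (simp add: family_sum_def sum.reindex)
qed

definition family_weight :: "real \<Rightarrow> nat \<Rightarrow> real" where
  "family_weight y n = family_sum y (interval_families 0 n)"

lemma family_sum_interval_families:
  "a \<le> c \<Longrightarrow> family_sum y (interval_families a c) = family_weight y (c - a)"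
  using family_sum_translate[of y 0 a "c - a"] by (simp add: family_weight_def)

lemma interval_families_Un:
  assumes "N \<in> interval_families a b" "M \<in> interval_families b c" "a \<le> b" "b \<le> c"
  shows "N \<union> M \<in> interval_families a c" "card (N \<union> M) = card N + card M"
    "(N \<union> M) \<inter> long_intervals a b = N" "(N \<union> M) \<inter> long_intervals b c = M"
proof -
  have NM: "N \<subseteq> long_intervals a b" "M \<subseteq> long_intervals b c"
    using assms by (auto simp: interval_families_def)
  have dj: "U \<inter> V = {}" if "U \<in> long_intervals a b" "V \<in> long_intervals b c" for U V
    using long_intervals_subset[OF that(1)] long_intervals_subset[OF that(2)] by fastforce
  have d: "long_intervals a b \<inter> long_intervals b c = {}"
    using dj long_intervals_nonempty by (metis disjoint_iff inf.idem)
  have lam: "laminar N" "laminar M" using assms by (auto simp: interval_families_def)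
  have "laminar (N \<union> M)"
    unfolding laminar_def
  proof (intro ballI)
    fix U V assume "U \<in> N \<union> M" "V \<in> N \<union> M"
    then consider "U \<in> N" "V \<in> N" | "U \<in> M" "V \<in> M" | "U \<inter> V = {}"
      using dj NM by blast
    then show "U \<subseteq> V \<or> V \<subseteq> U \<or> U \<inter> V = {}"
      using lam unfolding laminar_def by cases blast+
  qed
  then show "N \<union> M \<in> interval_families a c"
    using NM long_intervals_mono[of a a b c] long_intervals_mono[of a b c c] assms(3,4)
    by (auto simp: interval_families_def)
  have "N \<inter> M = {}" using d NM by blast
  then show "card (N \<union> M) = card N + card M"
    using finite_interval_family assms(1,2) by (blast intro: card_Un_disjoint)
  show "(N \<union> M) \<inter> long_intervals a b = N" "(N \<union> M) \<inter> long_intervals b c = M"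
    using d NM by blast+
qed

lemma interval_families_split:
  assumes "N \<in> interval_families a c" "\<And>I. I \<in> N \<Longrightarrow> I \<subseteq> {a..<b} \<or> I \<subseteq> {b..<c}"
  shows "N \<inter> long_intervals a b \<in> interval_families a b"
    "N \<inter> long_intervals b c \<in> interval_families b c"
    "N \<inter> long_intervals a b \<union> N \<inter> long_intervals b c = N"
proof -
  have "I \<in> long_intervals a b \<or> I \<in> long_intervals b c" if "I \<in> N" for I
  proof -
    have "I \<in> long_intervals a c" using assms(1) that by (auto simp: interval_families_def)
    then show ?thesis
      using assms(2)[OF that] long_intervals_restrict[of I a c a b] long_intervals_restrict[of I a c b c]
      by blast
  qed
  then show "N \<inter> long_intervals a b \<union> N \<inter> long_intervals b c = N" by blast
  show "N \<inter> long_intervals a b \<in> interval_families a b"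
    "N \<inter> long_intervals b c \<in> interval_families b c"
    using assms(1) by (auto simp: interval_families_def laminar_def)
qed

lemma family_sum_Un:
  assumes "\<F> \<subseteq> interval_families a b" "\<G> \<subseteq> interval_families b c" "a \<le> b" "b \<le> c"
  shows "family_sum y ((\<lambda>(N, M). N \<union> M) ` (\<F> \<times> \<G>)) = family_sum y \<F> * family_sum y \<G>"
proof -
  have un: "N \<union> M \<in> interval_families a c" "card (N \<union> M) = card N + card M"
    "(N \<union> M) \<inter> long_intervals a b = N" "(N \<union> M) \<inter> long_intervals b c = M"
    if "N \<in> \<F>" "M \<in> \<G>" for N M
    using interval_families_Un[of N a b M c] that assms by blast+
  have "inj_on (\<lambda>(N, M). N \<union> M) (\<F> \<times> \<G>)"
    by (rule inj_on_inverseI[where g = "\<lambda>K. (K \<inter> long_intervals a b, K \<inter> long_intervals b c)"])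
      (clarsimp simp: un)
  then have "family_sum y ((\<lambda>(N, M). N \<union> M) ` (\<F> \<times> \<G>)) = (\<Sum>(N, M)\<in>\<F> \<times> \<G>. y ^ card N * y ^ card M)"
    unfolding family_sum_def using un
    by (subst sum.reindex) (auto intro!: sum.cong simp: power_add)
  then show ?thesis
    by (simp add: family_sum_def sum_product sum.cartesian_product)
qed

text \<open>The full interval is compatible with every family, so inserting it pairs the families
  without it with those containing it, and each pair has weights in the ratio 1 : y. Hence the share
  y / (1 + y).\<close>

lemma family_sum_top:
  assumes "n \<ge> 2" "y > 0"
  shows "family_sum y {N \<in> interval_families 0 n. {0..<n} \<in> N} = y / (1 + y) * family_weight y n"
proof -
  let ?A = "{N \<in> interval_families 0 n. {0..<n} \<in> N}"
  let ?B = "{N \<in> interval_families 0 n. {0..<n} \<notin> N}"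
  note top = atLeastLessThan_in_long_intervals[OF assms(1)]
  have A: "?A = insert {0..<n} ` ?B"
  proof (intro equalityI subsetI)
    fix N assume N: "N \<in> ?A"
    then have mem: "N - {{0..<n}} \<in> ?B" by (auto intro: interval_families_subset)
    have eq: "N = insert {0..<n} (N - {{0..<n}})" using N by blast
    show "N \<in> insert {0..<n} ` ?B" by (rule image_eqI[where f = "insert {0..<n}", OF eq mem])
  next
    fix N assume "N \<in> insert {0..<n} ` ?B"
    then obtain M where M: "M \<in> interval_families 0 n" "N = insert {0..<n} M" by blast
    have "\<forall>U\<in>M. U \<subseteq> {0..<n}"
      using M(1) long_intervals_subset unfolding interval_families_def by blast
    then have "laminar N"
      using M(1) by (simp add: M(2) interval_families_def laminar_def)
    then have "N \<in> interval_families 0 n"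
      using top M by (simp add: interval_families_def)
    then show "N \<in> ?A" using M by blast
  qed
  have "inj_on (insert {0..<n}) ?B"
    by (rule inj_on_inverseI[where g = "\<lambda>N. N - {{0..<n}}"]) simp
  then have "family_sum y ?A = (\<Sum>N\<in>?B. y ^ card (insert {0..<n} N))"
    unfolding A family_sum_def by (simp add: sum.reindex)
  also have "\<dots> = y * family_sum y ?B"
    unfolding family_sum_def sum_distrib_left
    by (intro sum.cong refl) (auto simp: finite_interval_family)
  finally have 1: "family_sum y ?A = y * family_sum y ?B" .
  have "family_weight y n = family_sum y (?A \<union> ?B)"
    unfolding family_weight_def by (rule arg_cong[of _ _ "family_sum y"]) blast
  also have "\<dots> = family_sum y ?A + family_sum y ?B"
    unfolding family_sum_def by (rule sum.union_disjoint) (auto simp: finite_interval_families)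
  finally show ?thesis using 1 assms(2) by (simp add: field_simps)
qed

lemma family_weight_0: "family_weight y 0 = 1"
proof -
  have "long_intervals 0 0 = {}" by (auto simp: long_intervals_def)
  then have "interval_families 0 0 = {{}}" by (auto simp: interval_families_def laminar_def)
  then show ?thesis by (simp add: family_weight_def family_sum_def)
qed

text \<open>The families on \<open>{0..<n}\<close> are sorted by the largest interval containing \<open>0\<close>.\<close>

lemma family_weight_rec:
  assumes "n \<ge> 1" "y > 0"
  shows "family_weight y n = family_weight y (n - 1) +
    (\<Sum>m=2..n. y / (1 + y) * family_weight y m * family_weight y (n - m))"
proof -
  \<comment> \<open>This expresses that \<open>{0..<m}\<close> is the largest member starting at 0
    without mentioning maximality: a longer one would cross m, and laminarity keeps all other
    members on one side of m.\<close>
  define A where "A m = {N \<in> interval_families 0 n. {0..<m} \<in> N \<and> (\<forall>I\<in>N. I \<subseteq> {0..<m} \<or> I \<subseteq> {m..<n})}" for m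
  have A: "A m = (\<lambda>(N, M). N \<union> M) ` ({N \<in> interval_families 0 m. {0..<m} \<in> N} \<times> interval_families m n)"
    if m: "m \<in> {2..n}" for m
  proof (intro equalityI subsetI)
    fix N assume N: "N \<in> A m"
    have "{0..<m} \<in> long_intervals 0 m" using m by (simp add: atLeastLessThan_in_long_intervals)
    then have "(N \<inter> long_intervals 0 m, N \<inter> long_intervals m n) \<in>
       {N \<in> interval_families 0 m. {0..<m} \<in> N} \<times> interval_families m n"
      using interval_families_split[of N 0 n m] N by (auto simp: A_def)
    moreover have "N = N \<inter> long_intervals 0 m \<union> N \<inter> long_intervals m n"
      using interval_families_split(3)[of N 0 n m] N by (auto simp: A_def)
    ultimately show "N \<in> (\<lambda>(N, M). N \<union> M) ` ({N \<in> interval_families 0 m. {0..<m} \<in> N} \<times> interval_families m n)"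
      by (metis (no_types, lifting) case_prod_conv image_eqI)
  next
    fix N assume "N \<in> (\<lambda>(N, M). N \<union> M) ` ({N \<in> interval_families 0 m. {0..<m} \<in> N} \<times> interval_families m n)"
    then obtain N1 N2 where N: "N = N1 \<union> N2" "N1 \<in> interval_families 0 m" "{0..<m} \<in> N1"
      "N2 \<in> interval_families m n" by auto
    have "\<forall>I\<in>N1. I \<subseteq> {0..<m}" "\<forall>I\<in>N2. I \<subseteq> {m..<n}"
      using N(2,4) long_intervals_subset unfolding interval_families_def by blast+
    moreover have "N \<in> interval_families 0 n"
      using interval_families_Un(1)[OF N(2,4)] m N(1) by simp
    ultimately show "N \<in> A m" using N(1,3) by (simp add: A_def ball_Un)
  qed
  have wA: "family_sum y (A m) = y / (1 + y) * family_weight y m * family_weight y (n - m)"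
    if m: "m \<in> {2..n}" for m
  proof -
    have "family_sum y (A m) = family_sum y {N \<in> interval_families 0 m. {0..<m} \<in> N} *
       family_sum y (interval_families m n)"
      unfolding A[OF m] using m by (intro family_sum_Un[of _ 0 m _ n]) auto
    then show ?thesis
      using m by (simp add: family_sum_top assms(2) family_sum_interval_families)
  qed
  have sub: "interval_families 1 n \<subseteq> interval_families 0 n"
    using long_intervals_mono[of 0 1 n n] by (auto simp: interval_families_def)
  have dj0: "interval_families 1 n \<inter> A m = {}" if "m \<in> {2..n}" for m
  proof -
    have "\<not> {0..<m} \<subseteq> {1..<n}" using that by (auto simp: atLeastLessThan_subset_iff)
    then have "{0..<m} \<notin> long_intervals 1 n" using long_intervals_subset by blast
    moreover have "N \<subseteq> long_intervals 1 n" if "N \<in> interval_families 1 n" for N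
      using that by (simp add: interval_families_def)
    moreover have "{0..<m} \<in> N" if "N \<in> A m" for N using that by (simp add: A_def)
    ultimately show ?thesis by blast
  qed
  have djA: "A m \<inter> A m' = {}" if "m \<in> {2..n}" "m' \<in> {2..n}" "m < m'" for m m'
  proof -
    have "\<not> ({0..<m'} \<subseteq> {0..<m} \<or> {0..<m'} \<subseteq> {m..<n})" using that by auto
    then show ?thesis by (auto simp: A_def)
  qed
  \<comment> \<open>In \<open>interval_families 1 n\<close> no interval contains 0, so these
    families stand for a first block of length 1.\<close>
  have "interval_families 0 n = interval_families 1 n \<union> (\<Union>m\<in>{2..n}. A m)"
  proof (intro equalityI subsetI)
    fix N assume N: "N \<in> interval_families 0 n"
    show "N \<in> interval_families 1 n \<union> (\<Union>m\<in>{2..n}. A m)"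
    proof (cases "\<exists>j. {0..<j} \<in> N")
      case False
      have "I \<in> long_intervals 1 n" if "I \<in> N" for I
      proof -
        have "I \<in> long_intervals 0 n" using N that by (auto simp: interval_families_def)
        then obtain i j where "I = {i..<j}" "i + 1 < j" "j \<le> n" by (auto simp: long_intervals_def)
        moreover from this have "i \<noteq> 0" using False that by metis
        ultimately show ?thesis by (simp add: long_intervalsI)
      qed
      then show ?thesis using N by (auto simp: interval_families_def)
    next
      case True
      have jn: "2 \<le> j \<and> j \<le> n" if "{0..<j} \<in> N" for j
      proof -
        have "{0..<j} \<in> long_intervals 0 n" using N that by (auto simp: interval_families_def)
        then obtain i k where "{0..<j} = {i..<k}" "i + 1 < k" "k \<le> n" by (auto simp: long_intervals_def)
        moreover from this have "j = k - i" by (metis card_atLeastLessThan diff_zero)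
        ultimately show ?thesis by linarith
      qed
      define m where "m = Max {j. {0..<j} \<in> N}"
      have fin: "finite {j. {0..<j} \<in> N}" by (rule finite_subset[of _ "{..n}"]) (use jn in auto)
      have m: "{0..<m} \<in> N" using Max_in[OF fin] True by (auto simp: m_def)
      have mx: "j \<le> m" if "{0..<j} \<in> N" for j using Max_ge[OF fin] that by (simp add: m_def)
      have "I \<subseteq> {0..<m} \<or> I \<subseteq> {m..<n}" if "I \<in> N" for I
      proof -
        have "I \<in> long_intervals 0 n" using N that by (auto simp: interval_families_def)
        then obtain i j where I: "I = {i..<j}" "i + 1 < j" "j \<le> n" by (auto simp: long_intervals_def)
        have "I \<subseteq> {0..<m} \<or> {0..<m} \<subseteq> I \<or> I \<inter> {0..<m} = {}"
          using N m that by (simp add: interval_families_def laminar_def)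
        then consider "I \<subseteq> {0..<m}" | "{0..<m} \<subseteq> I" | "I \<inter> {0..<m} = {}"
          by blast
        then show ?thesis
        proof cases
          case 2
          have "0 \<in> {0..<m}" using jn[OF m] by simp
          then have "0 \<in> I" using 2 by blast
          then have "i = 0" using I by simp
          then show ?thesis using mx[of j] that I by auto
        next
          case 3
          have "i \<in> I" using I by simp
          then have "m \<le> i" using 3 by (auto simp: disjoint_iff not_less)
          then show ?thesis using I by auto
        qed auto
      qed
      then have "N \<in> A m" using N m by (auto simp: A_def)
      then show ?thesis using jn[OF m] by auto
    qed
  qed (use sub in \<open>auto simp: A_def\<close>)
  then have "family_weight y n = family_sum y (interval_families 1 n \<union> (\<Union>m\<in>{2..n}. A m))"
    by (simp add: family_weight_def)
  also have "\<dots> = family_sum y (interval_families 1 n) + family_sum y (\<Union>m\<in>{2..n}. A m)"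
    unfolding family_sum_def
  proof (rule sum.union_disjoint)
    show "interval_families 1 n \<inter> (\<Union>m\<in>{2..n}. A m) = {}" using dj0 by blast
  qed (auto simp: finite_interval_families A_def)
  also have "family_sum y (\<Union>m\<in>{2..n}. A m) = (\<Sum>m=2..n. family_sum y (A m))"
    unfolding family_sum_def
  proof (rule sum.UNION_disjoint)
    show "\<forall>m\<in>{2..n}. \<forall>m'\<in>{2..n}. m \<noteq> m' \<longrightarrow> A m \<inter> A m' = {}"
      using djA by (metis Int_commute nat_neq_iff)
  qed (auto simp: finite_interval_families A_def)
  also have "\<dots> = (\<Sum>m=2..n. y / (1 + y) * family_weight y m * family_weight y (n - m))"
    using wA by (intro sum.cong) auto
  finally show ?thesis using assms(1) by (simp add: family_sum_interval_families)
qed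

section \<open>Order-preserving surjections onto chains, and interval families inside their
  fibers\<close>

definition order_surjs :: "'a set \<Rightarrow> 'a rel \<Rightarrow> nat \<Rightarrow> ('a \<Rightarrow> nat) set" where
  "order_surjs B s k = {\<pi> \<in> B \<rightarrow>\<^sub>E {..<k}. \<pi> ` B = {..<k} \<and> (\<forall>(x, y)\<in>s. \<pi> x \<le> \<pi> y)}"

definition chain_rel :: "nat \<Rightarrow> nat rel" where
  "chain_rel n = {(x, y). x \<le> y \<and> y < n}"

definition fiber_families :: "nat \<Rightarrow> (nat \<Rightarrow> nat) \<Rightarrow> nat set set set" where
  "fiber_families n \<pi> = {N \<in> interval_families 0 n. \<forall>I\<in>N. \<exists>j. \<pi> ` I \<subseteq> {j}}"

text \<open>Induction by the value v at the last point: the remaining points cover V or exactly V -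
  {v}. The second case is the reason for letting V vary. The resulting recursion is that of k! times
  the Stirling number.\<close>

lemma card_surjs:
  assumes "finite V"
  shows "card {f \<in> {..<i::nat} \<rightarrow>\<^sub>E V. f ` {..<i} = V} = fact (card V) * Stirling i (card V)"
  using assms
proof (induction i arbitrary: V)
  case 0
  show ?case
  proof (cases "V = {}")
    case False
    then have "{f \<in> {..<0::nat} \<rightarrow>\<^sub>E V. f ` {..<0} = V} = {}" by auto
    then show ?thesis using False 0 by (metis card.empty card_eq_0_iff mult_0_right Stirling.simps(2) not0_implies_Suc)
  qed simp
next
  case (Suc i)
  let ?F = "\<lambda>i V. {f \<in> {..<i::nat} \<rightarrow>\<^sub>E V. f ` {..<i} = V}"
  have fin: "finite (?F i V)" if "finite V" for i V
    by (rule finite_subset[OF _ finite_PiE[of "{..<i}" "\<lambda>_. V"]]) (use that in auto)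
  have "bij_betw (\<lambda>(v, f). f(i := v)) (SIGMA v:V. ?F i V \<union> ?F i (V - {v})) (?F (Suc i) V)"
  proof (rule bij_betw_byWitness[where f' = "\<lambda>f. (f i, restrict f {..<i})"])
    show "\<forall>a\<in>(SIGMA v:V. ?F i V \<union> ?F i (V - {v})).
       (\<lambda>f. (f i, restrict f {..<i})) ((\<lambda>(v, f). f(i := v)) a) = a"
      by (auto simp: fun_eq_iff restrict_def PiE_def extensional_def)
    show "\<forall>a'\<in>?F (Suc i) V. (\<lambda>(v, f). f(i := v)) (a' i, restrict a' {..<i}) = a'"
      by (auto simp: fun_eq_iff restrict_def PiE_def extensional_def less_Suc_eq)
    show "(\<lambda>(v, f). f(i := v)) ` (SIGMA v:V. ?F i V \<union> ?F i (V - {v})) \<subseteq> ?F (Suc i) V"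
    proof clarify
      fix v f assume v: "v \<in> V" and f: "f \<in> ?F i V \<union> ?F i (V - {v})"
      have "f(i := v) \<in> {..<Suc i} \<rightarrow>\<^sub>E V"
        using v f by (auto simp: PiE_def extensional_def less_Suc_eq)
      moreover have "f(i := v) ` {..<Suc i} = insert v (f ` {..<i})"
        by (auto simp: lessThan_Suc)
      ultimately show "f(i := v) \<in> {..<Suc i} \<rightarrow>\<^sub>E V \<and> f(i := v) ` {..<Suc i} = V"
        using v f by auto
    qed
    show "(\<lambda>f. (f i, restrict f {..<i})) ` ?F (Suc i) V \<subseteq> (SIGMA v:V. ?F i V \<union> ?F i (V - {v}))"
    proof (rule image_subsetI)
      fix f assume "f \<in> ?F (Suc i) V"
      then have f: "f \<in> {..<Suc i} \<rightarrow>\<^sub>E V" "f ` {..<Suc i} = V" by auto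
      then have "insert (f i) (f ` {..<i}) = V" by (simp add: lessThan_Suc)
      then have im: "f ` {..<i} = V \<or> f ` {..<i} = V - {f i}" by blast
      have "restrict f {..<i} ` {..<i} = f ` {..<i}" by auto
      moreover have "restrict f {..<i} \<in> {..<i} \<rightarrow>\<^sub>E (f ` {..<i})" by auto
      ultimately show "(f i, restrict f {..<i}) \<in> (SIGMA v:V. ?F i V \<union> ?F i (V - {v}))"
        using im f by auto
    qed
  qed
  then have "card (?F (Suc i) V) = card (SIGMA v:V. ?F i V \<union> ?F i (V - {v}))"
    by (rule bij_betw_same_card[symmetric])
  also have "\<dots> = (\<Sum>v\<in>V. card (?F i V \<union> ?F i (V - {v})))"
    using Suc.prems fin by (intro card_SigmaI) auto
  also have "\<dots> = (\<Sum>v\<in>V. fact (card V) * Stirling i (card V) + fact (card V - 1) * Stirling i (card V - 1))"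
  proof (intro sum.cong refl)
    fix v assume v: "v \<in> V"
    have "card (?F i V \<union> ?F i (V - {v})) = card (?F i V) + card (?F i (V - {v}))"
      using Suc.prems v by (intro card_Un_disjoint fin) auto
    then show "card (?F i V \<union> ?F i (V - {v})) = fact (card V) * Stirling i (card V) + fact (card V - 1) * Stirling i (card V - 1)"
      using Suc.IH[of V] Suc.IH[of "V - {v}"] Suc.prems v by simp
  qed
  also have "\<dots> = fact (card V) * Stirling (Suc i) (card V)"
    by (cases "card V") (simp_all add: algebra_simps)
  finally show ?case .
qed

lemma card_order_surjs_Id:
  "card (order_surjs {..<i} (Id_on {..<i}) k) = fact k * Stirling i k"
proof -
  have "order_surjs {..<i} (Id_on {..<i}) k = {f \<in> {..<i} \<rightarrow>\<^sub>E {..<k}. f ` {..<i} = {..<k}}"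
    by (auto simp: order_surjs_def Id_on_def)
  then show ?thesis using card_surjs[of "{..<k}" i] by simp
qed

definition chain_sum :: "real \<Rightarrow> nat \<Rightarrow> nat \<Rightarrow> real" where
  "chain_sum y n k = (\<Sum>\<pi>\<in>order_surjs {..<n} (chain_rel n) k. family_sum y (fiber_families n \<pi>))"

lemma chain_sum_0: "chain_sum y n 0 = (if n = 0 then 1 else 0)"
proof -
  have "order_surjs {..<n} (chain_rel n) 0 = (if n = 0 then {\<lambda>_. undefined} else {})"
    by (auto simp: order_surjs_def chain_rel_def PiE_def extensional_def fun_eq_iff)
  moreover have "fiber_families 0 \<pi> = {{}}" for \<pi>
    by (auto simp: fiber_families_def interval_families_def long_intervals_def laminar_def)
  ultimately show ?thesis by (simp add: chain_sum_def family_sum_def)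
qed

lemma finite_order_surjs: "finite B \<Longrightarrow> finite (order_surjs B s k)"
  by (rule finite_subset[OF _ finite_PiE[of B "\<lambda>_. {..<k}"]]) (auto simp: order_surjs_def)

text \<open>Splitting off the last fiber.\<close>

lemma chain_sum_Suc:
  "chain_sum y n (Suc k) = (\<Sum>m<n. chain_sum y m k * family_weight y (n - m))"
proof -
  \<comment> \<open>\<open>ext m \<pi>\<close> adds a last fiber \<open>{m..<n}\<close> with value
    k, and \<open>cut\<close> recovers m as the number of points with a smaller value. Since the
    last fiber is nonempty, m < n.\<close>
  define ext where "ext m \<pi> = (\<lambda>x. if x < m then \<pi> x else if x < n then k else undefined)" for m and \<pi> :: "nat \<Rightarrow> nat"
  define cut where "cut \<pi> = card {x. x < n \<and> \<pi> x < k}" for \<pi> :: "nat \<Rightarrow> nat"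
  let ?O = "\<lambda>n k. order_surjs {..<n} (chain_rel n) k"
  have O: "\<pi> \<in> ?O n k \<longleftrightarrow> (\<forall>x<n. \<pi> x < k) \<and> (\<forall>x\<ge>n. \<pi> x = undefined) \<and>
     (\<forall>j<k. \<exists>x<n. \<pi> x = j) \<and> (\<forall>x y. x \<le> y \<longrightarrow> y < n \<longrightarrow> \<pi> x \<le> \<pi> y)" for \<pi> n k
  proof -
    have 1: "\<pi> \<in> {..<n} \<rightarrow>\<^sub>E {..<k} \<longleftrightarrow> (\<forall>x<n. \<pi> x < k) \<and> (\<forall>x\<ge>n. \<pi> x = undefined)"
      by (auto simp: PiE_iff extensional_def not_less)
    have 2: "\<pi> ` {..<n} = {..<k} \<longleftrightarrow> (\<forall>j<k. \<exists>x<n. \<pi> x = j)" if "\<forall>x<n. \<pi> x < k"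
    proof -
      have "\<pi> ` {..<n} \<subseteq> {..<k}" using that by auto
      then have "\<pi> ` {..<n} = {..<k} \<longleftrightarrow> {..<k} \<subseteq> \<pi> ` {..<n}" by blast
      also have "\<dots> \<longleftrightarrow> (\<forall>j<k. \<exists>x<n. \<pi> x = j)"
        by (simp add: subset_iff image_iff) (metis lessThan_iff)
      finally show ?thesis .
    qed
    have 3: "(\<forall>(x, y)\<in>chain_rel n. \<pi> x \<le> \<pi> y) \<longleftrightarrow> (\<forall>x y. x \<le> y \<longrightarrow> y < n \<longrightarrow> \<pi> x \<le> \<pi> y)"
      by (auto simp: chain_rel_def)
    show ?thesis
      unfolding order_surjs_def mem_Collect_eq 1 3 using 2 by blast
  qed
  have cut: "x < n \<and> \<pi> x < k \<longleftrightarrow> x < cut \<pi>" if "\<pi> \<in> ?O n (Suc k)" for \<pi> x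
  proof -
    let ?L = "{x. x < n \<and> \<pi> x < k}"
    have down: "z \<in> ?L" if "x \<in> ?L" "z \<le> x" for x z
      using that \<open>\<pi> \<in> ?O n (Suc k)\<close> unfolding O by (metis (mono_tags, lifting) dual_order.strict_trans2 mem_Collect_eq)
    have "?L = {..<card ?L}"
    proof (cases "?L = {}")
      case False
      have fin: "finite ?L" by auto
      have "?L = {..Max ?L}"
        using down[OF Max_in[OF fin False]] Max_ge[OF fin] by blast
      then show ?thesis by (metis card_atMost lessThan_Suc_atMost)
    qed (metis card.empty lessThan_0)
    then show ?thesis unfolding cut_def by blast
  qed
  have cutn: "cut \<pi> < n" if pi: "\<pi> \<in> ?O n (Suc k)" for \<pi>
  proof -
    obtain x where "x < n" "\<pi> x = k" using pi unfolding O by blast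
    then show ?thesis using cut[OF pi, of x] by simp
  qed
  have extcut: "ext (cut \<pi>) (restrict \<pi> {..<cut \<pi>}) = \<pi>" if pi: "\<pi> \<in> ?O n (Suc k)" for \<pi>
  proof
    fix x
    have "k \<le> \<pi> x \<longrightarrow> x < n \<longrightarrow> \<pi> x = k" using pi unfolding O by (simp add: le_antisym less_Suc_eq_le)
    then show "ext (cut \<pi>) (restrict \<pi> {..<cut \<pi>}) x = \<pi> x"
      using cut[OF pi, of x] cutn[OF pi] pi unfolding ext_def O by (auto simp: not_less)
  qed
  have "chain_sum y n (Suc k) =
     (\<Sum>(m, \<pi>)\<in>(SIGMA m:{..<n}. ?O m k). family_sum y (fiber_families n (ext m \<pi>)))"
    unfolding chain_sum_def
  proof (rule sum.reindex_bij_witness[where i = "\<lambda>(m, \<pi>). ext m \<pi>" and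
     j = "\<lambda>\<pi>. (cut \<pi>, restrict \<pi> {..<cut \<pi>})"], goal_cases)
    case (1 \<pi>)
    then show ?case by (simp add: extcut)
  next
    case (2 \<pi>)
    have "\<forall>j<k. \<exists>x<cut \<pi>. \<pi> x = j"
      using 2 cut[OF 2] unfolding O by (metis less_Suc_eq)
    moreover have "\<forall>x<cut \<pi>. \<pi> x < k" using cut[OF 2] by blast
    moreover have "\<forall>x y. x \<le> y \<longrightarrow> y < cut \<pi> \<longrightarrow> \<pi> x \<le> \<pi> y"
      using 2 cutn[OF 2] unfolding O by (meson less_trans)
    ultimately have "restrict \<pi> {..<cut \<pi>} \<in> ?O (cut \<pi>) k"
      unfolding O by auto
    then show ?case using cutn[OF 2] by simp
  next
    case (3 p)
    then obtain m \<pi> where p: "p = (m, \<pi>)" "m < n" "\<pi> \<in> ?O m k" by auto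
    have "{x. x < n \<and> ext m \<pi> x < k} = {..<m}"
      using p unfolding O ext_def by auto
    then have "cut (ext m \<pi>) = m" unfolding cut_def by simp
    then show ?case using p unfolding O by (auto simp: ext_def fun_eq_iff)
  next
    case (4 p)
    then obtain m \<pi> where p: "p = (m, \<pi>)" "m < n" "\<pi> \<in> ?O m k" by auto
    have "\<exists>x<n. ext m \<pi> x = j" if j: "j < Suc k" for j
    proof (cases "j = k")
      case True
      then show ?thesis using p by (auto simp: ext_def intro!: exI[of _ m])
    next
      case False
      then obtain x where "x < m" "\<pi> x = j" using p j unfolding O by (metis less_SucE)
      then show ?thesis using p by (auto simp: ext_def intro!: exI[of _ x])
    qed
    moreover have "ext m \<pi> x \<le> ext m \<pi> z" if "x \<le> z" "z < n" for x z
      using p that unfolding O by (auto simp: ext_def less_imp_le)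
    ultimately have "ext m \<pi> \<in> ?O n (Suc k)"
      using p unfolding O by (auto simp: ext_def less_Suc_eq)
    then show ?case using p by simp
  next
    case (5 \<pi>)
    then show ?case by (simp add: extcut)
  qed
  also have "\<dots> = (\<Sum>m<n. \<Sum>\<pi>\<in>?O m k. family_sum y (fiber_families n (ext m \<pi>)))"
    by (simp add: sum.Sigma finite_order_surjs)
  also have "\<dots> = (\<Sum>m<n. \<Sum>\<pi>\<in>?O m k. family_sum y (fiber_families m \<pi>) * family_weight y (n - m))"
  proof (intro sum.cong refl)
    fix m \<pi> assume m: "m \<in> {..<n}" and pi: "\<pi> \<in> ?O m k"
    have "fiber_families n (ext m \<pi>) = (\<lambda>(N, M). N \<union> M) ` (fiber_families m \<pi> \<times> interval_families m n)"
    proof (intro equalityI subsetI)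
      fix N assume N: "N \<in> fiber_families n (ext m \<pi>)"
      \<comment> \<open>\<open>ext m \<pi>\<close> is below k before m and equal to k from m on, so
        an interval inside one fiber cannot cross m.\<close>
      have "I \<subseteq> {0..<m} \<or> I \<subseteq> {m..<n}" if "I \<in> N" for I
      proof -
        obtain j where j: "ext m \<pi> ` I \<subseteq> {j}" using N \<open>I \<in> N\<close> by (auto simp: fiber_families_def)
        have In: "I \<subseteq> {..<n}" using N \<open>I \<in> N\<close> long_intervals_subset by (fastforce simp: fiber_families_def interval_families_def)
        have "x < m \<longleftrightarrow> j < k" if "x \<in> I" for x
          using j that pi In unfolding O ext_def by (auto simp: image_subset_iff split: if_splits)
        then show ?thesis using In
          by (cases "j < k") (auto simp: subset_iff not_less)
      qed
      note sp = interval_families_split[of N 0 n m, OF _ this]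
      have N': "N \<in> interval_families 0 n" using N by (simp add: fiber_families_def)
      have "\<exists>j. \<pi> ` I \<subseteq> {j}" if "I \<in> N \<inter> long_intervals 0 m" for I
      proof -
        have "ext m \<pi> ` I = \<pi> ` I"
          using that long_intervals_subset[of I 0 m] by (intro image_cong) (auto simp: ext_def)
        moreover have "\<exists>j. ext m \<pi> ` I \<subseteq> {j}" using that N by (simp add: fiber_families_def)
        ultimately show ?thesis by (simp only:)
      qed
      then have "(N \<inter> long_intervals 0 m, N \<inter> long_intervals m n) \<in> fiber_families m \<pi> \<times> interval_families m n"
        using sp(1,2)[OF N'] by (simp add: fiber_families_def)
      then show "N \<in> (\<lambda>(N, M). N \<union> M) ` (fiber_families m \<pi> \<times> interval_families m n)"
        using sp(3)[OF N'] by (metis (no_types, lifting) case_prod_conv image_eqI)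
    next
      fix N assume "N \<in> (\<lambda>(N, M). N \<union> M) ` (fiber_families m \<pi> \<times> interval_families m n)"
      then obtain N1 N2 where N: "N = N1 \<union> N2" "N1 \<in> fiber_families m \<pi>" "N2 \<in> interval_families m n" by auto
      have un: "N1 \<union> N2 \<in> interval_families 0 n"
        using interval_families_Un(1)[of N1 0 m N2 n] N m by (auto simp: fiber_families_def)
      have f1: "\<exists>j. ext m \<pi> ` I \<subseteq> {j}" if "I \<in> N1" for I
      proof -
        have "I \<in> long_intervals 0 m" using that N by (auto simp: fiber_families_def interval_families_def)
        then have "ext m \<pi> ` I = \<pi> ` I"
          using long_intervals_subset[of I 0 m] by (intro image_cong) (auto simp: ext_def)
        moreover have "\<exists>j. \<pi> ` I \<subseteq> {j}" using that N by (simp add: fiber_families_def)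
        ultimately show ?thesis by (simp only:)
      qed
      have f2: "\<exists>j. ext m \<pi> ` I \<subseteq> {j}" if "I \<in> N2" for I
      proof -
        have "I \<in> long_intervals m n" using that N by (auto simp: interval_families_def)
        then show ?thesis using long_intervals_subset[of I m n]
          by (intro exI[of _ k]) (auto simp: ext_def)
      qed
      show "N \<in> fiber_families n (ext m \<pi>)"
        unfolding fiber_families_def N(1) mem_Collect_eq ball_Un by (intro conjI ballI un f1 f2)
    qed
    then show "family_sum y (fiber_families n (ext m \<pi>)) = family_sum y (fiber_families m \<pi>) * family_weight y (n - m)"
      using family_sum_Un[of "fiber_families m \<pi>" 0 m "interval_families m n" n y] m
      by (simp add: fiber_families_def family_sum_interval_families)
  qed
  finally show ?thesis by (simp add: chain_sum_def sum_distrib_right)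
qed

text \<open>Splitting off the last block multiplies the generating function by W, the series of a
  nonempty block, so \<open>t ^ n * chain_sum (1 / t) n k\<close> is the coefficient of x^n in W^k;
  both sides then obey the recurrence of \<open>cycle_sum_eqI\<close>. The weight y = 1/t turns y /
  (1 + y) into 1 / (1 + t). This is the formula of the theorem for a single k, with the skeletons
  removed.\<close>

lemma cycle_sum_narayana:
  assumes t: "t > 0"
  shows "cycle_sum {1..n} (\<lambda>m. t * poly (narayana_B m) (1 + t)) (\<lambda>l. fact k * real (Stirling l k)) =
    fact n * (t ^ n * chain_sum (1 / t) n k)"
proof -
  define l where "l = family_weight (1 / t)"
  define W where "W = weight_fps t l - 1"
  have l0: "l 0 = 1" by (simp add: l_def family_weight_0)
  have rec: "l n = l (n - 1) + (\<Sum>m=2..n. l m * l (n - m)) / (1 + t)" if "n \<ge> 1" for n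
  proof -
    have "(1 / t) / (1 + 1 / t) = 1 / (1 + t)" using t by (simp add: field_simps)
    then show ?thesis
      using family_weight_rec[OF that, of "1 / t"] t
      by (simp add: l_def sum_divide_distrib)
  qed
  have W0: "fps_nth W 0 = 0" by (simp add: W_def weight_fps_def l0)
  have chain: "fps_nth (W ^ k) n = t ^ n * chain_sum (1 / t) n k" for n k
  proof (induction k arbitrary: n)
    case 0
    then show ?case by (simp add: chain_sum_0)
  next
    case (Suc k)
    have "fps_nth (W ^ Suc k) n = (\<Sum>m=0..n. fps_nth (W ^ k) m * fps_nth W (n - m))"
      by (simp only: power_Suc2 fps_mult_nth)
    also have "\<dots> = (\<Sum>m<n. fps_nth (W ^ k) m * fps_nth W (n - m))"
      by (intro sum.mono_neutral_right) (auto simp: W0 not_less)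
    also have "\<dots> = (\<Sum>m<n. t ^ n * (chain_sum (1 / t) m k * l (n - m)))"
    proof (intro sum.cong refl)
      fix m assume m: "m \<in> {..<n}"
      then have "t ^ n = t ^ m * t ^ (n - m)" by (simp flip: power_add)
      moreover have "fps_nth W (n - m) = t ^ (n - m) * l (n - m)"
        using m by (simp add: W_def weight_fps_def)
      ultimately show "fps_nth (W ^ k) m * fps_nth W (n - m) = t ^ n * (chain_sum (1 / t) m k * l (n - m))"
        by (simp add: Suc.IH)
    qed
    also have "\<dots> = t ^ n * chain_sum (1 / t) n (Suc k)"
      by (simp add: chain_sum_Suc l_def sum_distrib_left)
    finally show ?case .
  qed
  have "cycle_sum {1..n} (\<lambda>m. t * poly (narayana_B m) (1 + t)) ((\<lambda>k l. fact k * real (Stirling l k)) k) =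
    fact (card {1..n}) * (\<lambda>k n. fps_nth (W ^ k) n) k (card {1..n})"
  proof (rule cycle_sum_eqI)
    show "fact 0 * real (Stirling (Suc l) 0) = (0 :: real)" for l by simp
    show "fact (Suc k) * real (Stirling (Suc l) (Suc k)) =
      real (Suc k) * (fact (Suc k) * real (Stirling l (Suc k)) + fact k * real (Stirling l k))" for k l
      by (simp add: algebra_simps)
    show "real (Suc n) * fps_nth (W ^ Suc k) (Suc n) =
      (\<Sum>m\<le>n. t * poly (narayana_B (Suc m)) (1 + t) *
       (real (Suc k) * (fps_nth (W ^ Suc k) (n - m) + fps_nth (W ^ k) (n - m))))" for k n
      using weight_fps_power_recurrence[OF t l0 rec, where n = n and k = k]
      unfolding W_def atLeast0AtMost .
    show "fps_nth (W ^ 0) (Suc n) = 0" for n by simp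
    show "fps_nth (W ^ k) 0 = fact k * real (Stirling 0 k)" for k
      by (cases k) (simp_all add: W0)
  qed simp
  then show ?thesis by (simp add: chain)
qed

section \<open>Face numbers and tubings\<close>

lemma finite_tubings: "finite A \<Longrightarrow> finite (tubings A r)"
  by (rule finite_subset[of _ "Pow (Pow A)"]) (auto simp: tubings_def proper_tube_def)

lemma finite_tubing: "finite A \<Longrightarrow> T \<in> tubings A r \<Longrightarrow> finite T"
  by (rule finite_subset[of _ "Pow A"]) (auto simp: tubings_def proper_tube_def)

lemma tubings_subset:
  assumes "T \<in> tubings A r" "T' \<subseteq> T"
  shows "T' \<in> tubings A r"
proof -
  have "acyclic {(U, V). U \<in> T' \<and> V \<in> T' \<and> tube_prec r U V}"
  proof (rule acyclic_subset)
    show "acyclic {(U, V). U \<in> T \<and> V \<in> T \<and> tube_prec r U V}"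
      using assms(1) by (simp add: tubings_def)
  qed (use assms(2) in auto)
  then show ?thesis using assms unfolding tubings_def by (simp add: subset_iff)
qed

lemma empty_in_tubings: "{} \<in> tubings A r"
  by (simp add: tubings_def acyclic_def)

text \<open>The predicate gives the dimension of Q and the inclusion order of the faces, but not the
  dimension of a single face. That follows by induction on the number of tubes: removing a tube
  leads to a face in which the original one is a facet. Dividing by t^2 avoids the truncated
  subtraction \<open>card A - 2\<close>.\<close>

lemma poly_f_poly_poset_associahedron:
  fixes Q :: "'e::euclidean_space set"
  assumes Q: "poset_associahedron A r Q" and A: "finite A" and t: "t > 0"
  shows "poly (f_poly Q) t = t ^ card A / t\<^sup>2 * (\<Sum>T\<in>tubings A r. (1 / t) ^ card T)"
proof -
  let ?F = "{F. F face_of Q \<and> F \<noteq> {}}"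
  obtain \<phi> where bij: "bij_betw \<phi> ?F (tubings A r)" and
    mono: "\<And>F G. F \<in> ?F \<Longrightarrow> G \<in> ?F \<Longrightarrow> F \<subseteq> G \<longleftrightarrow> \<phi> G \<subseteq> \<phi> F"
    using Q unfolding poset_associahedron_def by (smt (verit) mem_Collect_eq)
  have poly: "polytope Q" and dim: "aff_dim Q = int (card A) - 2"
    using Q by (auto simp: poset_associahedron_def simple_polytope_def)
  have inj: "\<phi> F = \<phi> G \<Longrightarrow> F = G" if "F \<in> ?F" "G \<in> ?F" for F G
    using bij that by (auto simp: bij_betw_def dest: inj_onD)
  have tub: "\<phi> F \<in> tubings A r" if "F \<in> ?F" for F using bij that by (auto simp: bij_betw_def)
  have surj: "\<exists>F\<in>?F. \<phi> F = T" if "T \<in> tubings A r" for T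
    using bij that unfolding bij_betw_def by (metis (no_types, lifting) imageE)
  \<comment> \<open>The empty tubing belongs to some nonempty face, so Q itself is nonempty.\<close>
  have QF: "Q \<in> ?F"
    using surj[OF empty_in_tubings] polytope_imp_convex[OF poly]
    by (auto intro: face_of_refl dest: face_of_imp_subset)
  have phiQ: "\<phi> Q = {}"
  proof -
    obtain F where F: "F \<in> ?F" "\<phi> F = {}" using surj[OF empty_in_tubings] by blast
    then have "F \<subseteq> Q" by (auto dest: face_of_imp_subset)
    then show ?thesis using mono[OF F(1) QF] F(2) by simp
  qed
  have aff: "aff_dim F = aff_dim Q - int (card (\<phi> F))" if "F \<in> ?F" for F
    using that
  proof (induction "card (\<phi> F)" arbitrary: F)
    case 0
    then have "\<phi> F = {}" using finite_tubing[OF A tub] by (metis card_0_eq)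
    then have "F = Q" using inj[OF 0(2) QF] phiQ by simp
    then show ?case by (simp add: phiQ)
  next
    case (Suc m F)
    then have fin: "finite (\<phi> F)" using card_gt_0_iff by (metis zero_less_Suc)
    obtain \<tau> where \<tau>: "\<tau> \<in> \<phi> F" using Suc(2) by fastforce
    have "\<phi> F - {\<tau>} \<in> tubings A r" using tubings_subset[OF tub[OF Suc(3)]] by blast
    then obtain F' where F': "F' \<in> ?F" "\<phi> F' = \<phi> F - {\<tau>}" using surj by blast
    have sub: "F \<subseteq> F'" using mono[OF Suc(3) F'(1)] F'(2) by blast
    have ne: "F \<noteq> F'" using F'(2) \<tau> by blast
    have face: "F face_of F'"
      using Suc(3) F'(1) sub by (auto intro: face_of_subset dest: face_of_imp_subset)
    have "polyhedron F'"
      using F'(1) poly face_of_polytope_polytope polytope_imp_polyhedron by blast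
    \<comment> \<open>The tubing of a facet G of F' that contains F lies between those of F' and F,
      which differ by one tube; so G = F.\<close>
    then obtain G where G: "G facet_of F'" "F \<subseteq> G"
      using face_of_polyhedron_subset_facet[OF _ face] Suc(3) ne by blast
    have GF: "G \<in> ?F"
      using G F'(1) Suc(3) by (auto simp: facet_of_def intro: face_of_trans)
    have "G \<subseteq> F'" using G(1) by (simp add: facet_of_imp_subset)
    then have "\<phi> F' \<subseteq> \<phi> G" "\<phi> G \<subseteq> \<phi> F"
      using mono[OF GF F'(1)] mono[OF Suc(3) GF] G(2) by auto
    moreover have "\<phi> G \<noteq> \<phi> F'" using inj[OF GF F'(1)] G(1) by (auto simp: facet_of_def)
    ultimately have "\<phi> G = \<phi> F" using F'(2) by blast
    then have "G = F" using inj[OF GF Suc(3)] by simp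
    then have "aff_dim F = aff_dim F' - 1" using G(1) by (simp add: facet_of_def)
    moreover have "aff_dim F' = aff_dim Q - int (card (\<phi> F'))"
      using Suc(1)[OF _ F'(1)] Suc(2) F'(2) \<tau> fin by simp
    moreover have "card (\<phi> F') = m" using Suc(2) F'(2) \<tau> fin by simp
    ultimately show ?case using Suc(2) by simp
  qed
  have nn: "aff_dim F \<ge> 0" if "F \<in> ?F" for F
    using that aff_dim_negative_iff[of F] by (simp add: not_less[symmetric])
  have fin: "finite ?F"
    using finite_polytope_faces[OF poly] by (rule rev_finite_subset) auto
  have "poly (f_poly Q) t = (\<Sum>i\<le>nat (aff_dim Q). real (card {F. F face_of Q \<and> aff_dim F = int i}) * t ^ i)"
    by (simp add: f_poly_def poly_sum poly_monom)
  also have "\<dots> = (\<Sum>i\<le>nat (aff_dim Q). \<Sum>F\<in>{F \<in> ?F. nat (aff_dim F) = i}. t ^ nat (aff_dim F))"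
  proof (intro sum.cong refl)
    fix i
    have "{F. F face_of Q \<and> aff_dim F = int i} = {F \<in> ?F. nat (aff_dim F) = i}"
      (is "?L = ?R")
    proof (intro equalityI subsetI)
      fix F assume "F \<in> ?L"
      then show "F \<in> ?R" by auto
    next
      fix F assume F: "F \<in> ?R"
      then have "aff_dim F \<ge> 0" by (intro nn) blast
      then show "F \<in> ?L" using F by auto
    qed
    then show "real (card {F. F face_of Q \<and> aff_dim F = int i}) * t ^ i =
       (\<Sum>F\<in>{F \<in> ?F. nat (aff_dim F) = i}. t ^ nat (aff_dim F))" by simp
  qed
  also have "\<dots> = (\<Sum>F\<in>?F. t ^ nat (aff_dim F))"
  proof (rule sum.group[OF fin])
    show "(\<lambda>F. nat (aff_dim F)) ` ?F \<subseteq> {..nat (aff_dim Q)}"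
      using aff by (fastforce intro: nat_mono)
  qed simp
  also have "\<dots> = (\<Sum>F\<in>?F. t ^ card A / t\<^sup>2 * (1 / t) ^ card (\<phi> F))"
  proof (intro sum.cong refl)
    fix F assume F: "F \<in> ?F"
    have "card A = nat (aff_dim F) + 2 + card (\<phi> F)" using aff[OF F] nn[OF F] dim by linarith
    then show "t ^ nat (aff_dim F) = t ^ card A / t\<^sup>2 * (1 / t) ^ card (\<phi> F)"
      using t by (simp add: power_add power2_eq_square field_simps)
  qed
  also have "\<dots> = (\<Sum>T\<in>tubings A r. t ^ card A / t\<^sup>2 * (1 / t) ^ card T)"
    using sum.reindex_bij_betw[OF bij, of "\<lambda>T. t ^ card A / t\<^sup>2 * (1 / t) ^ card T"] .
  finally show ?thesis by (simp add: sum_distrib_left)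
qed

section \<open>Outer tubes\<close>

text \<open>Connectedness of the comparability graph on T, phrased with closed subsets instead of
  paths: closed subsets have images and preimages under a collapse. Comparabilities between B and
  its complement, unlike covers, do not depend on the order of B.\<close>

definition comparably_connected :: "'a rel \<Rightarrow> 'a set \<Rightarrow> bool" where
  "comparably_connected r T \<longleftrightarrow> (\<forall>P\<subseteq>T. P \<noteq> {} \<longrightarrow>
     (\<forall>x\<in>P. \<forall>y\<in>T. (x, y) \<in> r \<or> (y, x) \<in> r \<longrightarrow> y \<in> P) \<longrightarrow> P = T)"

lemma comparably_connectedI:
  assumes "\<And>P. P \<subseteq> T \<Longrightarrow> P \<noteq> {} \<Longrightarrow>
    (\<And>x y. x \<in> P \<Longrightarrow> y \<in> T \<Longrightarrow> (x, y) \<in> r \<or> (y, x) \<in> r \<Longrightarrow> y \<in> P) \<Longrightarrow> T \<subseteq> P"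
  shows "comparably_connected r T"
  unfolding comparably_connected_def using assms by (metis subset_antisym)

lemma comparably_connectedD:
  assumes "comparably_connected r T" "P \<subseteq> T" "P \<noteq> {}"
    "\<And>x y. x \<in> P \<Longrightarrow> y \<in> T \<Longrightarrow> (x, y) \<in> r \<or> (y, x) \<in> r \<Longrightarrow> y \<in> P"
  shows "P = T"
  using assms unfolding comparably_connected_def by metis

text \<open>A comparability that is not a cover has an element strictly between; convexity keeps it
  in T, and both halves of the interval are smaller. So comparability steps refine to Hasse paths
  inside T, the essential half of \<open>hasse_connected_iff\<close>.\<close>

lemma hasse_path:
  assumes fin: "finite A" and po: "partial_order_on A r" and conv: "order_convex A r T"
    and "x \<in> T" "y \<in> T" "(x, y) \<in> r"
  shows "(x, y) \<in> ((hasse r \<union> (hasse r)\<inverse>) \<inter> T \<times> T)\<^sup>*"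
  using assms(4-)
proof (induction "card {z. (x, z) \<in> r \<and> (z, y) \<in> r}" arbitrary: x y rule: less_induct)
  case less
  have r: "r \<subseteq> A \<times> A" "trans r" "antisym r"
    using po by (auto simp: partial_order_on_def preorder_on_def)
  have finI: "finite {z. (a, z) \<in> r \<and> (z, b) \<in> r}" for a b
    using fin by (rule rev_finite_subset) (use r(1) in auto)
  show ?case
  proof (cases "x = y \<or> (x, y) \<in> hasse r")
    case True
    then show ?thesis using less.prems by auto
  next
    case False
    then obtain z where z: "z \<noteq> x" "z \<noteq> y" "(x, z) \<in> r" "(z, y) \<in> r"
      using less.prems by (auto simp: hasse_def)
    then have zT: "z \<in> T"
      using conv less.prems r(1) unfolding order_convex_def by blast
    have refl: "(x, x) \<in> r" "(y, y) \<in> r"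
      using po less.prems(3) r(1) by (auto simp: partial_order_on_def preorder_on_def refl_on_def)
    have "{w. (x, w) \<in> r \<and> (w, z) \<in> r} \<subset> {w. (x, w) \<in> r \<and> (w, y) \<in> r}"
    proof
      show "{w. (x, w) \<in> r \<and> (w, z) \<in> r} \<subseteq> {w. (x, w) \<in> r \<and> (w, y) \<in> r}"
        using z(4) transD[OF r(2)] by blast
      have "(y, z) \<notin> r" using z(2,4) antisymD[OF r(3)] by blast
      then show "{w. (x, w) \<in> r \<and> (w, z) \<in> r} \<noteq> {w. (x, w) \<in> r \<and> (w, y) \<in> r}"
        using less.prems(3) refl by blast
    qed
    then have 1: "(x, z) \<in> ((hasse r \<union> (hasse r)\<inverse>) \<inter> T \<times> T)\<^sup>*"
      using less.hyps[of x z] psubset_card_mono[OF finI] less.prems(1) zT z(3) by blast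
    have "{w. (z, w) \<in> r \<and> (w, y) \<in> r} \<subset> {w. (x, w) \<in> r \<and> (w, y) \<in> r}"
    proof
      show "{w. (z, w) \<in> r \<and> (w, y) \<in> r} \<subseteq> {w. (x, w) \<in> r \<and> (w, y) \<in> r}"
        using z(3) transD[OF r(2)] by blast
      have "(z, x) \<notin> r" using z(1,3) antisymD[OF r(3)] by blast
      then show "{w. (z, w) \<in> r \<and> (w, y) \<in> r} \<noteq> {w. (x, w) \<in> r \<and> (w, y) \<in> r}"
        using less.prems(3) refl by blast
    qed
    then have "(z, y) \<in> ((hasse r \<union> (hasse r)\<inverse>) \<inter> T \<times> T)\<^sup>*"
      using less.hyps[of z y] psubset_card_mono[OF finI] less.prems(2) zT z(4) by blast
    with 1 show ?thesis by (rule rtrancl_trans)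
  qed
qed

lemma hasse_connected_iff:
  assumes "finite A" "partial_order_on A r" "order_convex A r T"
  shows "hasse_connected r T \<longleftrightarrow> comparably_connected r T"
proof
  let ?H = "(hasse r \<union> (hasse r)\<inverse>) \<inter> T \<times> T"
  assume L: "hasse_connected r T"
  show "comparably_connected r T"
  proof (rule comparably_connectedI)
    fix P assume P: "P \<subseteq> T" "P \<noteq> {}" and
      cl: "\<And>x y. x \<in> P \<Longrightarrow> y \<in> T \<Longrightarrow> (x, y) \<in> r \<or> (y, x) \<in> r \<Longrightarrow> y \<in> P"
    obtain x where x: "x \<in> P" using P by blast
    show "T \<subseteq> P"
    proof
      fix y assume "y \<in> T"
      then have "(x, y) \<in> ?H\<^sup>*" using L x P by (auto simp: hasse_connected_def)
      then show "y \<in> P"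
        by (induction rule: rtrancl_induct) (use x cl in \<open>auto simp: hasse_def\<close>)
    qed
  qed
next
  let ?H = "(hasse r \<union> (hasse r)\<inverse>) \<inter> T \<times> T"
  assume R: "comparably_connected r T"
  have "sym ?H" by (auto simp: sym_def)
  then have sym: "(b, a) \<in> ?H\<^sup>*" if "(a, b) \<in> ?H\<^sup>*" for a b
    using that sym_rtrancl symD by metis
  show "hasse_connected r T"
    unfolding hasse_connected_def
  proof (intro ballI)
    fix x y assume x: "x \<in> T" and y: "y \<in> T"
    have "{z \<in> T. (x, z) \<in> ?H\<^sup>*} = T"
    proof (rule comparably_connectedD[OF R])
      fix a b assume a: "a \<in> {z \<in> T. (x, z) \<in> ?H\<^sup>*}" and b: "b \<in> T" and ab: "(a, b) \<in> r \<or> (b, a) \<in> r"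
      then have "(a, b) \<in> ?H\<^sup>*"
        using hasse_path[OF assms, of a b] hasse_path[OF assms, of b a] sym[of b a] by blast
      then show "b \<in> {z \<in> T. (x, z) \<in> ?H\<^sup>*}" using a b rtrancl_trans[of x a ?H b] by blast
    qed (use x in auto)
    then show "(x, y) \<in> ?H\<^sup>*" using y by blast
  qed
qed

lemma proper_tube_iff:
  assumes "finite A" "partial_order_on A r"
  shows "proper_tube A r T \<longleftrightarrow>
    T \<subseteq> A \<and> 1 < card T \<and> card T < card A \<and> comparably_connected r T \<and> order_convex A r T"
  using hasse_connected_iff[OF assms] unfolding proper_tube_def by blast

section \<open>Tubes after a substitution for an autonomous subposet\<close>

locale autonomous_subposet =
  fixes A :: "'a set" and r :: "'a rel" and S :: "'a set"
  assumes finite_A: "finite A" and po: "partial_order_on A r"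
    and aut: "autonomous A r S" and S_nonempty: "S \<noteq> {}" and S_proper: "S \<noteq> A"
begin

text \<open>\<open>D\<close> and \<open>U\<close> are the parts of the complement below and above S.
  By \<open>R_mem\<close> they are all that a substituted poset sees of the order around it.\<close>

definition E where "E = A - S"
definition D where "D = {z \<in> A - S. \<exists>x\<in>S. (z, x) \<in> r}"
definition U where "U = {z \<in> A - S. \<exists>x\<in>S. (x, z) \<in> r}"

abbreviation X :: "'b set \<Rightarrow> ('a + 'b) set" where "X B \<equiv> replace_carrier A S B"
abbreviation R :: "'b set \<Rightarrow> 'b rel \<Rightarrow> ('a + 'b) rel" where "R B s \<equiv> replace_order A r S B s"

lemma S_subset: "S \<subseteq> A" using aut by (simp add: autonomous_def)

lemma E_nonempty: "E \<noteq> {}" using S_subset S_proper by (auto simp: E_def)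

lemma finite_E: "finite E" using finite_A by (simp add: E_def)

lemma D_subset: "D \<subseteq> E" and U_subset: "U \<subseteq> E" by (auto simp: D_def U_def E_def)

lemma X_eq: "X B = E <+> B" by (simp add: replace_carrier_def E_def)

lemma R_mem:
  "(Inl x, Inl y) \<in> R B s \<longleftrightarrow> x \<in> E \<and> y \<in> E \<and> (x, y) \<in> r"
  "(Inr p, Inr q) \<in> R B s \<longleftrightarrow> p \<in> B \<and> q \<in> B \<and> (p, q) \<in> s"
  "(Inl x, Inr q) \<in> R B s \<longleftrightarrow> x \<in> D \<and> q \<in> B"
  "(Inr q, Inl x) \<in> R B s \<longleftrightarrow> x \<in> U \<and> q \<in> B"
  by (auto simp: replace_order_def D_def U_def E_def)

lemma r_trans: "(x, y) \<in> r \<Longrightarrow> (y, z) \<in> r \<Longrightarrow> (x, z) \<in> r"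
  using po by (auto simp: partial_order_on_def preorder_on_def dest: transD)

text \<open>Autonomy lets one element of S serve both comparisons. This relation provides the
  shortcut in \<open>tubings_combine\<close>.\<close>

lemma D_below_U: "x \<in> D \<Longrightarrow> y \<in> U \<Longrightarrow> (x, y) \<in> r"
proof -
  assume x: "x \<in> D" and y: "y \<in> U"
  obtain a b where ab: "a \<in> S" "(x, a) \<in> r" "b \<in> S" "(b, y) \<in> r" using x y by (auto simp: D_def U_def)
  have "(b, y) \<in> r \<longleftrightarrow> (a, y) \<in> r"
    using aut ab y unfolding autonomous_def U_def by blast
  then show "(x, y) \<in> r" using ab r_trans by blast
qed

definition poset :: "'b set \<Rightarrow> 'b rel \<Rightarrow> bool" where
  "poset B s \<longleftrightarrow> finite B \<and> B \<noteq> {} \<and> partial_order_on B s"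

lemma poset_X:
  assumes "poset B s"
  shows "finite (X B)" "partial_order_on (X B) (R B s)"
  using assms finite_E partial_order_on_replace_order[OF po aut S_nonempty]
  by (auto simp: poset_def X_eq)

lemma poset_subset: "poset B s \<Longrightarrow> s \<subseteq> B \<times> B"
  by (simp add: poset_def partial_order_on_def preorder_on_def)

abbreviation tube :: "'b set \<Rightarrow> 'b rel \<Rightarrow> ('a + 'b) set \<Rightarrow> bool" where
  "tube B s \<equiv> proper_tube (X B) (R B s)"

text \<open>A tube not contained in the substituted poset is studied through its collapse to a point.\<close>

abbreviation point_R :: "('a + unit) rel" where "point_R \<equiv> R {()} {((), ())}"

definition collapsed :: "'a set \<Rightarrow> bool \<Rightarrow> ('a + unit) set" where
  "collapsed G b = G <+> (if b then {()} else {})"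

lemma Inl_collapsed: "Inl x \<in> collapsed G b \<longleftrightarrow> x \<in> G"
  and Inr_collapsed: "Inr u \<in> collapsed G b \<longleftrightarrow> b"
  by (auto simp: collapsed_def)

definition below_closed :: "'b rel \<Rightarrow> 'b set \<Rightarrow> bool" where
  "below_closed s I \<longleftrightarrow> (\<forall>(x, y)\<in>s. y \<in> I \<longrightarrow> x \<in> I)"

definition above_closed :: "'b rel \<Rightarrow> 'b set \<Rightarrow> bool" where
  "above_closed s I \<longleftrightarrow> (\<forall>(x, y)\<in>s. x \<in> I \<longrightarrow> y \<in> I)"

text \<open>The possible traces I on B of a convex connected tube with outer part G. An element of D
  in G forces everything in B below a member of I into the tube, an element of U everything above;
  with both, only the extreme traces remain.\<close>

definition admissible :: "'b set \<Rightarrow> 'b rel \<Rightarrow> 'a set \<Rightarrow> 'b set \<Rightarrow> bool" where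
  "admissible B s G I \<longleftrightarrow> I = {} \<or> I = B \<or>
     G \<inter> D \<noteq> {} \<and> G \<inter> U = {} \<and> below_closed s I \<or>
     G \<inter> U \<noteq> {} \<and> G \<inter> D = {} \<and> above_closed s I"

definition collapsed_tube :: "'a set \<Rightarrow> bool \<Rightarrow> bool" where
  "collapsed_tube G b \<longleftrightarrow> comparably_connected (point_R) (collapsed G b) \<and>
     order_convex (X {()}) (point_R) (collapsed G b)"

text \<open>All elements of I are comparable with the same elements of G, so closed subsets pass
  through the collapse in both directions. As G is nonempty, I need not be connected by itself: its
  elements are joined through G.\<close>

lemma connected_collapsed:
  assumes G: "G \<subseteq> E" "G \<noteq> {}" and I: "I \<subseteq> B" and s: "s \<subseteq> B \<times> B"
  shows "comparably_connected (R B s) (G <+> I) \<longleftrightarrow>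
    comparably_connected (point_R) (collapsed G (I \<noteq> {}))"
proof
  let ?T1 = "collapsed G (I \<noteq> {})"
  let ?c = "map_sum id (\<lambda>_. ()) :: 'a + 'b \<Rightarrow> 'a + unit"
  assume L: "comparably_connected (R B s) (G <+> I)"
  show "comparably_connected (point_R) ?T1"
  proof (rule comparably_connectedI)
    fix P assume P: "P \<subseteq> ?T1" "P \<noteq> {}" and
      cl: "\<And>x y. x \<in> P \<Longrightarrow> y \<in> ?T1 \<Longrightarrow> (x, y) \<in> point_R \<or> (y, x) \<in> point_R \<Longrightarrow> y \<in> P"
    have "{x \<in> G <+> I. ?c x \<in> P} = G <+> I"
    proof (rule comparably_connectedD[OF L])
      obtain p where "p \<in> P" using P by blast
      moreover have "p \<in> ?T1" using \<open>p \<in> P\<close> P by blast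
      ultimately show "{x \<in> G <+> I. ?c x \<in> P} \<noteq> {}"
        by (cases p) (auto simp: collapsed_def split: if_splits)
    next
      fix x y
      assume x: "x \<in> {x \<in> G <+> I. ?c x \<in> P}" and y: "y \<in> G <+> I" and xy: "(x, y) \<in> R B s \<or> (y, x) \<in> R B s"
      have "?c y \<in> ?T1" using y by (auto simp: collapsed_def)
      moreover have "(?c x, ?c y) \<in> point_R \<or> (?c y, ?c x) \<in> point_R"
        using xy by (cases x; cases y) (auto simp: R_mem)
      ultimately show "y \<in> {x \<in> G <+> I. ?c x \<in> P}" using cl[of "?c x" "?c y"] x y by blast
    qed auto
    then have *: "?c x \<in> P" if "x \<in> G <+> I" for x using that by blast
    show "?T1 \<subseteq> P"
    proof
      fix p assume p: "p \<in> ?T1"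
      show "p \<in> P"
      proof (cases p)
        case (Inl g)
        then have "g \<in> G" using p by (simp add: Inl_collapsed)
        then show ?thesis using *[of "Inl g"] Inl by auto
      next
        case (Inr u)
        then obtain i where "i \<in> I" using p by (auto simp: Inr_collapsed)
        then show ?thesis using *[of "Inr i"] Inr by auto
      qed
    qed
  qed
next
  let ?T1 = "collapsed G (I \<noteq> {})"
  let ?c = "map_sum id (\<lambda>_. ()) :: 'a + 'b \<Rightarrow> 'a + unit"
  assume L: "comparably_connected (point_R) ?T1"
  show "comparably_connected (R B s) (G <+> I)"
  proof (rule comparably_connectedI)
    fix P assume P: "P \<subseteq> G <+> I" "P \<noteq> {}" and
      cl: "\<And>x y. x \<in> P \<Longrightarrow> y \<in> G <+> I \<Longrightarrow> (x, y) \<in> R B s \<or> (y, x) \<in> R B s \<Longrightarrow> y \<in> P"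
    have cP: "?c ` P = ?T1"
    proof (rule comparably_connectedD[OF L])
      show "?c ` P \<subseteq> ?T1" using P by (auto simp: collapsed_def)
      show "?c ` P \<noteq> {}" using P by blast
    next
      fix x y assume x: "x \<in> ?c ` P" and y: "y \<in> ?T1"
        and xy: "(x, y) \<in> point_R \<or> (y, x) \<in> point_R"
      obtain p where p: "p \<in> P" "x = ?c p" using x by blast
      have pT: "p \<in> G <+> I" using p P by blast
      show "y \<in> ?c ` P"
      proof (cases y)
        case (Inl g)
        then have "g \<in> G" using y by (simp add: Inl_collapsed)
        then have "Inl g \<in> P"
          using cl[OF p(1), of "Inl g"] xy p(2) pT Inl I by (cases p) (auto simp: R_mem)
        then show ?thesis using Inl by force
      next
        case (Inr u)
        then obtain i where i: "i \<in> I" using y by (auto simp: Inr_collapsed)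
        show ?thesis
        proof (cases p)
          case (Inl g)
          then have "Inr i \<in> P"
            using cl[OF p(1), of "Inr i"] xy p(2) pT i I \<open>y = Inr u\<close> by (auto simp: R_mem)
          then show ?thesis using \<open>y = Inr u\<close> by force
        next
          case (Inr i')
          then show ?thesis using p \<open>y = Inr u\<close> by force
        qed
      qed
    qed
    have GP: "Inl g \<in> P" if "g \<in> G" for g
    proof -
      have "Inl g \<in> ?c ` P" unfolding cP using that by (simp add: Inl_collapsed)
      then obtain p where "p \<in> P" "?c p = Inl g" by auto
      then show ?thesis by (cases p) auto
    qed
    show "G <+> I \<subseteq> P"
    proof
      fix x assume x: "x \<in> G <+> I"
      show "x \<in> P"
      proof (cases x)
        case (Inl g)
        then show ?thesis using x GP by auto
      next
        case (Inr i)
        then have i: "i \<in> I" using x by auto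
        \<comment> \<open>Otherwise the collapsed point would be a component on its own, although G
          is nonempty.\<close>
        have "\<exists>g\<in>G. g \<in> D \<or> g \<in> U"
        proof (rule ccontr)
          assume n: "\<not> ?thesis"
          have "{Inr ()} = ?T1"
          proof (rule comparably_connectedD[OF L])
            show "{Inr ()} \<subseteq> ?T1" using i by (auto simp: Inr_collapsed)
            fix x y assume "x \<in> {Inr () :: 'a + unit}" "y \<in> ?T1"
              "(x, y) \<in> point_R \<or> (y, x) \<in> point_R"
            then show "y \<in> {Inr ()}"
              using n by (cases y) (auto simp: R_mem Inl_collapsed)
          qed simp
          moreover obtain g where "g \<in> G" using G by blast
          ultimately show False using Inl_collapsed by blast
        qed
        then obtain g where "g \<in> G" "g \<in> D \<or> g \<in> U" by blast
        then show ?thesis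
          using cl[OF GP, of g "Inr i"] i I Inr by (auto simp: R_mem)
      qed
    qed
  qed
qed

lemma collapsed_tube_neighbour:
  assumes "collapsed_tube G True" "G \<noteq> {}"
  shows "G \<inter> D \<noteq> {} \<or> G \<inter> U \<noteq> {}"
proof (rule ccontr)
  assume n: "\<not> ?thesis"
  have "{Inr ()} = collapsed G True"
  proof (rule comparably_connectedD)
    show "comparably_connected (point_R) (collapsed G True)"
      using assms(1) by (simp add: collapsed_tube_def)
    show "{Inr ()} \<subseteq> collapsed G True" by (simp add: Inr_collapsed)
    fix x y assume "x \<in> {Inr () :: 'a + unit}" "y \<in> collapsed G True"
      "(x, y) \<in> point_R \<or> (y, x) \<in> point_R"
    then show "y \<in> {Inr ()}"
      using n by (cases y) (auto simp: R_mem Inl_collapsed)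
  qed simp
  then show False using Inl_collapsed assms(2) by blast
qed

text \<open>Collapsing loses only which elements of B are caught between members of the tube, and
  this is what \<open>admissible\<close> records. Connectedness enters to provide an element of D or
  U in G when I is nonempty.\<close>

lemma convex_collapsed:
  assumes G: "G \<subseteq> E" "G \<noteq> {}" and I: "I \<subseteq> B" and B: "poset B s"
    and conn: "comparably_connected (point_R) (collapsed G (I \<noteq> {}))"
  shows "order_convex (X B) (R B s) (G <+> I) \<longleftrightarrow>
    order_convex (X {()}) (point_R) (collapsed G (I \<noteq> {})) \<and> admissible B s G I"
proof
  let ?T1 = "collapsed G (I \<noteq> {})"
  assume L: "order_convex (X B) (R B s) (G <+> I)"
  have LD: "y \<in> G <+> I" if "x \<in> G <+> I" "z \<in> G <+> I" "y \<in> X B" "(x, y) \<in> R B s" "(y, z) \<in> R B s" for x y z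
    using L that unfolding order_convex_def by blast
  have c1: "order_convex (X {()}) (point_R) ?T1"
    unfolding order_convex_def
  proof (intro ballI impI, elim conjE)
    fix x z y assume x: "x \<in> ?T1" and z: "z \<in> ?T1" and y: "y \<in> X {()}"
      and xy: "(x, y) \<in> point_R" and yz: "(y, z) \<in> point_R"
    show "y \<in> ?T1"
    proof (cases y)
      case (Inl e)
      \<comment> \<open>A representative of I. If I is empty its value is arbitrary, but then the
        collapsed tube has no point for \<open>l\<close> to lift.\<close>
      obtain i0 where i0: "I \<noteq> {} \<Longrightarrow> i0 \<in> I" by blast
      define l where "l u = (case u of Inl g \<Rightarrow> Inl g | Inr _ \<Rightarrow> Inr i0)" for u :: "'a + unit"
      have l: "l u \<in> G <+> I" if "u \<in> ?T1" for u
        using that i0 by (cases u) (auto simp: l_def Inl_collapsed Inr_collapsed)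
      have e: "e \<in> E" using y Inl by (auto simp: X_eq)
      have "(l x, Inl e) \<in> R B s"
        using xy l[OF x] I Inl by (cases x) (auto simp: R_mem l_def)
      moreover have "(Inl e, l z) \<in> R B s"
        using yz l[OF z] I Inl by (cases z) (auto simp: R_mem l_def)
      ultimately have "Inl e \<in> G <+> I" using LD[OF l[OF x] l[OF z]] e by (auto simp: X_eq)
      then show ?thesis using Inl by (auto simp: Inl_collapsed)
    next
      case (Inr u)
      show ?thesis
      proof (cases "\<exists>d v. x = Inl d \<and> z = Inl v")
        case True
        then obtain d v where dv: "x = Inl d" "z = Inl v" by blast
        obtain b where b: "b \<in> B" using B by (auto simp: poset_def)
        have "Inr b \<in> G <+> I"
          by (rule LD[of "Inl d" "Inl v"]) (use x z xy yz dv Inr b in \<open>auto simp: R_mem X_eq Inl_collapsed\<close>)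
        then show ?thesis using Inr by (auto simp: Inr_collapsed)
      next
        case False
        then show ?thesis using x z Inr by (cases x; cases z) (auto simp: Inr_collapsed)
      qed
    qed
  qed
  have "admissible B s G I"
  proof (cases "I = {}")
    case False
    then have nb: "G \<inter> D \<noteq> {} \<or> G \<inter> U \<noteq> {}"
      using c1 conn G(2) by (intro collapsed_tube_neighbour) (auto simp: collapsed_tube_def)
    obtain i where i: "i \<in> I" using False by blast
    show ?thesis
    proof (cases "G \<inter> D \<noteq> {} \<and> G \<inter> U \<noteq> {}")
      case True
      then obtain d v where dv: "d \<in> G" "d \<in> D" "v \<in> G" "v \<in> U" by blast
      have "b \<in> I" if "b \<in> B" for b
      proof -
        have "Inr b \<in> G <+> I"
          by (rule LD[of "Inl d" "Inl v"]) (use dv that in \<open>auto simp: R_mem X_eq\<close>)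
        then show ?thesis by auto
      qed
      then show ?thesis using I by (auto simp: admissible_def)
    next
      case both: False
      show ?thesis
      proof (cases "G \<inter> D = {}")
        case True
        then obtain v where v: "v \<in> G" "v \<in> U" using nb by blast
        have "above_closed s I"
          unfolding above_closed_def
        proof (clarify)
          fix x y assume xy: "(x, y) \<in> s" "x \<in> I"
          have "Inr y \<in> G <+> I"
            by (rule LD[of "Inr x" "Inl v"]) (use v xy poset_subset[OF B] in \<open>auto simp: R_mem X_eq\<close>)
          then show "y \<in> I" by auto
        qed
        then show ?thesis using True nb by (auto simp: admissible_def)
      next
        case F: False
        then obtain v where v: "v \<in> G" "v \<in> D" using nb by blast
        have "below_closed s I"
          unfolding below_closed_def
        proof (clarify)
          fix x y assume xy: "(x, y) \<in> s" "y \<in> I"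
          have "Inr x \<in> G <+> I"
            by (rule LD[of "Inl v" "Inr y"]) (use v xy poset_subset[OF B] in \<open>auto simp: R_mem X_eq\<close>)
          then show "x \<in> I" by auto
        qed
        then show ?thesis using F both by (auto simp: admissible_def)
      qed
    qed
  qed (simp add: admissible_def)
  with c1 show "order_convex (X {()}) (point_R) ?T1 \<and> admissible B s G I" ..
next
  let ?T1 = "collapsed G (I \<noteq> {})"
  let ?c = "map_sum id (\<lambda>_. ()) :: 'a + 'b \<Rightarrow> 'a + unit"
  assume R: "order_convex (X {()}) (point_R) ?T1 \<and> admissible B s G I"
  then have adm: "admissible B s G I" by blast
  have RD: "y \<in> ?T1" if "x \<in> ?T1" "z \<in> ?T1" "y \<in> X {()}" "(x, y) \<in> point_R" "(y, z) \<in> point_R" for x y z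
    using R that unfolding order_convex_def by blast
  show "order_convex (X B) (R B s) (G <+> I)"
    unfolding order_convex_def
  proof (intro ballI impI, elim conjE)
    fix x z y assume x: "x \<in> G <+> I" and z: "z \<in> G <+> I" and y: "y \<in> X B"
      and xy: "(x, y) \<in> R B s" and yz: "(y, z) \<in> R B s"
    have "?c y \<in> ?T1"
    proof (rule RD[of "?c x" "?c z"])
      show "?c x \<in> ?T1" "?c z \<in> ?T1" using x z by (auto simp: Inl_collapsed Inr_collapsed)
      show "?c y \<in> X {()}" using y by (auto simp: X_eq)
      show "(?c x, ?c y) \<in> point_R" using xy by (cases x; cases y) (auto simp: R_mem)
      show "(?c y, ?c z) \<in> point_R" using yz by (cases y; cases z) (auto simp: R_mem)
    qed
    show "y \<in> G <+> I"
    proof (cases y)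
      case (Inl e)
      then show ?thesis using \<open>?c y \<in> ?T1\<close> by (auto simp: Inl_collapsed)
    next
      case (Inr b)
      then have ne: "I \<noteq> {}" and b: "b \<in> B" using \<open>?c y \<in> ?T1\<close> y by (auto simp: Inr_collapsed X_eq)
      have xc: "(\<exists>g\<in>G \<inter> D. x = Inl g) \<or> (\<exists>i\<in>I. x = Inr i \<and> (i, b) \<in> s)"
        using x xy Inr by (cases x) (auto simp: R_mem)
      have zc: "(\<exists>g\<in>G \<inter> U. z = Inl g) \<or> (\<exists>i\<in>I. z = Inr i \<and> (b, i) \<in> s)"
        using z yz Inr by (cases z) (auto simp: R_mem)
      have "b \<in> I"
        using adm ne xc zc b unfolding admissible_def below_closed_def above_closed_def by blast
      then show ?thesis using Inr by auto
    qed
  qed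
qed

text \<open>On the right, B enters only through \<open>admissible\<close> and through whether I is
  empty or all of B. Preimages under an order-preserving surjection onto a chain respect all of
  this, hence outer tubes can be pulled back.\<close>

lemma proper_tube_collapsed:
  assumes G: "G \<subseteq> E" "G \<noteq> {}" and I: "I \<subseteq> B" and B: "poset B s"
  shows "tube B s (G <+> I) \<longleftrightarrow>
    collapsed_tube G (I \<noteq> {}) \<and> admissible B s G I \<and> (I \<noteq> {} \<or> 1 < card G) \<and> \<not> (G = E \<and> I = B)"
proof -
  have fin: "finite G" "finite I" "finite B"
    using finite_subset[OF G(1) finite_E] finite_subset[OF I] B by (auto simp: poset_def)
  have "card G > 0" using G(2) fin by (simp add: card_gt_0_iff)
  moreover have "card I > 0 \<longleftrightarrow> I \<noteq> {}" using fin by (simp add: card_gt_0_iff)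
  ultimately have 1: "1 < card (G <+> I) \<longleftrightarrow> I \<noteq> {} \<or> 1 < card G"
    using fin by (auto simp: card_Plus)
  have le: "card G \<le> card E" "card I \<le> card B"
    using G(1) I fin finite_E by (auto intro: card_mono)
  have eq: "card G = card E \<longleftrightarrow> G = E" "card I = card B \<longleftrightarrow> I = B"
    using card_subset_eq[OF finite_E G(1)] card_subset_eq[OF fin(3) I] by auto
  have 2: "card (G <+> I) < card (X B) \<longleftrightarrow> \<not> (G = E \<and> I = B)"
    using fin finite_E le eq by (auto simp: card_Plus X_eq)
  have 3: "G <+> I \<subseteq> X B" using G(1) I by (auto simp: X_eq)
  show ?thesis
    unfolding proper_tube_iff[OF poset_X[OF B]] 1 2 connected_collapsed[OF G I poset_subset[OF B]]
    using convex_collapsed[OF G I B] 3 unfolding collapsed_tube_def by blast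
qed

lemma set_eq_Plus: "\<tau> = Inl -` \<tau> <+> Inr -` \<tau>"
proof -
  have "x \<in> \<tau> \<longleftrightarrow> x \<in> Inl -` \<tau> <+> Inr -` \<tau>" for x by (cases x) auto
  then show ?thesis by blast
qed

lemma vimage_Plus: "Inl -` (G <+> I) = G" "Inr -` (G <+> I) = I"
  by auto

lemma Plus_subset_iff: "G <+> I \<subseteq> G' <+> I' \<longleftrightarrow> G \<subseteq> G' \<and> I \<subseteq> I'"
  by auto

lemma Plus_disjoint_iff: "(G <+> I) \<inter> (G' <+> I') = {} \<longleftrightarrow> G \<inter> G' = {} \<and> I \<inter> I' = {}"
  by auto

lemma Plus_eq_iff: "G <+> I = G' <+> I' \<longleftrightarrow> G = G' \<and> I = I'"
  by (metis vimage_Plus)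

lemma proper_tube_vimage:
  assumes B: "poset B s" and \<tau>: "tube B s \<tau>"
  shows "Inl -` \<tau> \<subseteq> E" "Inr -` \<tau> \<subseteq> B"
  using \<tau> by (auto simp: proper_tube_def X_eq)

lemma outer_tube:
  assumes B: "poset B s" and \<tau>: "tube B s \<tau>" and ne: "Inl -` \<tau> \<noteq> {}"
  shows "collapsed_tube (Inl -` \<tau>) (Inr -` \<tau> \<noteq> {})" "admissible B s (Inl -` \<tau>) (Inr -` \<tau>)"
  using proper_tube_collapsed[OF proper_tube_vimage(1)[OF B \<tau>] ne proper_tube_vimage(2)[OF B \<tau>] B] \<tau>
  by (simp_all flip: set_eq_Plus)

lemma outer_tube_full:
  assumes B: "poset B s" and \<tau>: "tube B s \<tau>"
    and D: "Inl -` \<tau> \<inter> D \<noteq> {}" and U: "Inl -` \<tau> \<inter> U \<noteq> {}"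
  shows "Inr -` \<tau> = B"
proof -
  have ne: "Inl -` \<tau> \<noteq> {}" using D by blast
  obtain d v where dv: "Inl d \<in> \<tau>" "d \<in> D" "Inl v \<in> \<tau>" "v \<in> U" using D U by blast
  obtain b where b: "b \<in> B" using B by (auto simp: poset_def)
  have "Inr b \<in> \<tau>"
    using \<tau> dv b unfolding proper_tube_def order_convex_def
    by (metis InrI R_mem(3,4) X_eq)
  then show ?thesis using outer_tube(2)[OF B \<tau> ne] D U by (auto simp: admissible_def)
qed

lemma tube_prec_Plus:
  assumes "G \<subseteq> E" "G' \<subseteq> E" "I \<subseteq> B" "I' \<subseteq> B"
  shows "tube_prec (R B s) (G <+> I) (G' <+> I') \<longleftrightarrow> G \<inter> G' = {} \<and> I \<inter> I' = {} \<and>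
    ((\<exists>x\<in>G. \<exists>y\<in>G'. (x, y) \<in> r) \<or> (\<exists>x\<in>I. \<exists>y\<in>I'. (x, y) \<in> s) \<or>
     G \<inter> D \<noteq> {} \<and> I' \<noteq> {} \<or> I \<noteq> {} \<and> G' \<inter> U \<noteq> {})"
proof -
  have "(\<exists>x\<in>G <+> I. \<exists>y\<in>G' <+> I'. (x, y) \<in> R B s) \<longleftrightarrow>
    (\<exists>x\<in>G. \<exists>y\<in>G'. (Inl x, Inl y) \<in> R B s) \<or> (\<exists>x\<in>I. \<exists>y\<in>I'. (Inr x, Inr y) \<in> R B s) \<or>
    (\<exists>x\<in>G. \<exists>y\<in>I'. (Inl x, Inr y) \<in> R B s) \<or> (\<exists>x\<in>I. \<exists>y\<in>G'. (Inr x, Inl y) \<in> R B s)"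
    by (auto simp: Plus_def)
  also have "\<dots> \<longleftrightarrow> ((\<exists>x\<in>G. \<exists>y\<in>G'. (x, y) \<in> r) \<or> (\<exists>x\<in>I. \<exists>y\<in>I'. (x, y) \<in> s) \<or>
     G \<inter> D \<noteq> {} \<and> I' \<noteq> {} \<or> I \<noteq> {} \<and> G' \<inter> U \<noteq> {})"
    unfolding R_mem using assms by blast
  finally show ?thesis by (simp add: tube_prec_def Plus_disjoint_iff)
qed

text \<open>The order inside B drops out. If an element of the trace I is below some y in the trace
  I', and I and I' are disjoint, then I is neither B nor an up-set, so admissibility gives the first
  tube an element of D, and this is below y anyway.\<close>

lemma tube_prec_outer:
  assumes B: "poset B s" and \<tau>: "tube B s \<tau>" "Inl -` \<tau> \<noteq> {}"
    and \<tau>': "tube B s \<tau>'" "Inl -` \<tau>' \<noteq> {}"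
  shows "tube_prec (R B s) \<tau> \<tau>' \<longleftrightarrow> \<tau> \<inter> \<tau>' = {} \<and>
    ((\<exists>x\<in>Inl -` \<tau>. \<exists>y\<in>Inl -` \<tau>'. (x, y) \<in> r) \<or>
     Inl -` \<tau> \<inter> D \<noteq> {} \<and> Inr -` \<tau>' \<noteq> {} \<or> Inr -` \<tau> \<noteq> {} \<and> Inl -` \<tau>' \<inter> U \<noteq> {})"
proof -
  define G I G' I' where d: "G = Inl -` \<tau>" "I = Inr -` \<tau>" "G' = Inl -` \<tau>'" "I' = Inr -` \<tau>'"
  have eq: "\<tau> = G <+> I" "\<tau>' = G' <+> I'" unfolding d by (rule set_eq_Plus)+
  have sub: "G \<subseteq> E" "G' \<subseteq> E" "I \<subseteq> B" "I' \<subseteq> B"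
    using proper_tube_vimage[OF B] \<tau> \<tau>' unfolding d by blast+
  have adm: "admissible B s G I" "admissible B s G' I'"
    using outer_tube(2)[OF B] \<tau> \<tau>' unfolding d by blast+
  have "G \<inter> D \<noteq> {} \<and> I' \<noteq> {} \<or> I \<noteq> {} \<and> G' \<inter> U \<noteq> {}"
    if "I \<inter> I' = {}" "x \<in> I" "y \<in> I'" "(x, y) \<in> s" for x y
    using that adm sub unfolding admissible_def below_closed_def above_closed_def by blast
  then show ?thesis
    unfolding eq tube_prec_Plus[OF sub] vimage_Plus Plus_disjoint_iff by blast
qed

text \<open>A trace that is disjoint from M but has an element below M is neither B nor an up-set,
  so the tube meets D; dually for U. Hence a relation to an inner tube is always witnessed in D or
  U.\<close>

lemma outer_prec_inner:
  assumes B: "poset B s" and \<tau>: "tube B s \<tau>" "Inl -` \<tau> \<noteq> {}"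
    and M: "M \<subseteq> B" "M \<noteq> {}"
  shows "tube_prec (R B s) \<tau> ({} <+> M) \<Longrightarrow> Inl -` \<tau> \<inter> D \<noteq> {} \<and> Inr -` \<tau> \<noteq> B"
    "tube_prec (R B s) ({} <+> M) \<tau> \<Longrightarrow> Inl -` \<tau> \<inter> U \<noteq> {} \<and> Inr -` \<tau> \<noteq> B"
proof -
  define G I where d: "G = Inl -` \<tau>" "I = Inr -` \<tau>"
  have eq: "\<tau> = G <+> I" unfolding d by (rule set_eq_Plus)
  have sub: "G \<subseteq> E" "I \<subseteq> B" using proper_tube_vimage[OF B \<tau>(1)] unfolding d by blast+
  have adm: "admissible B s G I" using outer_tube(2)[OF B \<tau>] unfolding d by blast
  note tp = tube_prec_Plus[OF sub(1) empty_subsetI sub(2) M(1)]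
    tube_prec_Plus[OF empty_subsetI sub(1) M(1) sub(2)]
  show "Inl -` \<tau> \<inter> D \<noteq> {} \<and> Inr -` \<tau> \<noteq> B" if "tube_prec (R B s) \<tau> ({} <+> M)"
    using that adm M unfolding eq vimage_Plus tp admissible_def below_closed_def above_closed_def by blast
  show "Inl -` \<tau> \<inter> U \<noteq> {} \<and> Inr -` \<tau> \<noteq> B" if "tube_prec (R B s) ({} <+> M) \<tau>"
    using that adm M unfolding eq vimage_Plus tp admissible_def below_closed_def above_closed_def by blast
qed

end

section \<open>Decomposition of tubings\<close>

lemma acyclic_map:
  assumes "acyclic R" "\<And>a b. (a, b) \<in> R' \<Longrightarrow> (f a, f b) \<in> R"
  shows "acyclic R'"
proof -
  have "(f a, f b) \<in> R\<^sup>+" if "(a, b) \<in> R'\<^sup>+" for a b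
    using that by (induction rule: trancl_induct) (use assms(2) in \<open>auto intro: trancl_into_trancl\<close>)
  then show ?thesis using assms(1) unfolding acyclic_def by blast
qed

text \<open>An excursion from a in K through N back to a' in K can be replaced by the direct step
  from a to a', so a cycle that meets K contracts to a cycle inside K.\<close>

lemma acyclic_Un_shortcut:
  assumes K: "acyclic {(a, b). a \<in> K \<and> b \<in> K \<and> p a b}"
    and N: "acyclic {(a, b). a \<in> N \<and> b \<in> N \<and> p a b}"
    and short: "\<And>a a' m m'. a \<in> K \<Longrightarrow> a' \<in> K \<Longrightarrow> m \<in> N \<Longrightarrow> m' \<in> N \<Longrightarrow> p a m \<Longrightarrow> p m' a' \<Longrightarrow> p a a'"
  shows "acyclic {(a, b). a \<in> K \<union> N \<and> b \<in> K \<union> N \<and> p a b}"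
proof -
  let ?R = "{(a, b). a \<in> K \<union> N \<and> b \<in> K \<union> N \<and> p a b}"
  let ?K = "{(a, b). a \<in> K \<and> b \<in> K \<and> p a b}"
  let ?N = "{(a, b). a \<in> N \<and> b \<in> N \<and> p a b}"
  \<comment> \<open>Invariant along a walk from a: while in K, v is reached inside K; while in N, an
    exit point a' from K is remembered.\<close>
  have 1: "if v \<in> K then (a, v) \<in> ?K\<^sup>+ else v \<in> N \<and> (\<exists>a'\<in>K. (a, a') \<in> ?K\<^sup>* \<and> (\<exists>m\<in>N. p a' m))"
    if a: "a \<in> K" and av: "(a, v) \<in> ?R\<^sup>+" for a v
    using av
  proof (induction rule: trancl_induct)
    case (base v)
    then show ?case using a by auto
  next
    case (step v w)
    show ?case
    proof (cases "v \<in> K")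
      case True
      then have av: "(a, v) \<in> ?K\<^sup>+" using step.IH by simp
      show ?thesis
      proof (cases "w \<in> K")
        case True
        then have "(v, w) \<in> ?K" using \<open>v \<in> K\<close> step.hyps by auto
        then show ?thesis using av True by (simp add: trancl_into_trancl)
      next
        case False
        then have "w \<in> N" "p v w" using step.hyps by auto
        then show ?thesis using False \<open>v \<in> K\<close> trancl_into_rtrancl[OF av] by auto
      qed
    next
      case False
      then obtain a' m where a': "v \<in> N" "a' \<in> K" "(a, a') \<in> ?K\<^sup>*" "m \<in> N" "p a' m"
        using step.IH by auto
      show ?thesis
      proof (cases "w \<in> K")
        case True
        then have "p a' w" using short[of a' w m v] a' step.hyps by auto
        then have "(a', w) \<in> ?K" using True a' by auto
        with a'(3) have "(a, w) \<in> ?K\<^sup>+" by (rule rtrancl_into_trancl1)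
        then show ?thesis using True by simp
      next
        case False
        then show ?thesis using a' step.hyps by auto
      qed
    qed
  qed
  have noO: "(a, a) \<notin> ?R\<^sup>+" if "a \<in> K" for a
    using 1[OF that, of a] that K unfolding acyclic_def by (metis (no_types, lifting))
  \<comment> \<open>A walk from N stays in N or passes some b in K; in the second case a closed walk
    can be restarted at b.\<close>
  have 2: "(a, v) \<in> ?N\<^sup>+ \<and> v \<in> N \<or> (\<exists>b\<in>K. (a, b) \<in> ?R\<^sup>+ \<and> (b, v) \<in> ?R\<^sup>*)"
    if a: "a \<in> N" and av: "(a, v) \<in> ?R\<^sup>+" for a v
    using av
  proof (induction rule: trancl_induct)
    case (base v)
    then show ?case using a by auto
  next
    case (step v w)
    from step.IH show ?case
    proof
      assume v: "(a, v) \<in> ?N\<^sup>+ \<and> v \<in> N"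
      show ?thesis
      proof (cases "w \<in> K")
        case True
        have "(a, w) \<in> ?R\<^sup>+" using step.hyps by (rule trancl_into_trancl)
        then show ?thesis using True by blast
      next
        case False
        then have "(v, w) \<in> ?N" "w \<in> N" using v step.hyps by auto
        then show ?thesis using v by (meson trancl_into_trancl)
      qed
    next
      assume "\<exists>b\<in>K. (a, b) \<in> ?R\<^sup>+ \<and> (b, v) \<in> ?R\<^sup>*"
      then show ?thesis using step.hyps(2) by (meson rtrancl_into_rtrancl)
    qed
  qed
  have noN: "(a, a) \<notin> ?R\<^sup>+" if "a \<in> N" for a
  proof
    assume "(a, a) \<in> ?R\<^sup>+"
    from 2[OF that this] show False
    proof
      assume "(a, a) \<in> ?N\<^sup>+ \<and> a \<in> N"
      then show False using N unfolding acyclic_def by blast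
    next
      assume "\<exists>b\<in>K. (a, b) \<in> ?R\<^sup>+ \<and> (b, a) \<in> ?R\<^sup>*"
      then obtain b where b: "b \<in> K" "(a, b) \<in> ?R\<^sup>+" "(b, a) \<in> ?R\<^sup>*" by blast
      from rtrancl_trancl_trancl[OF b(3,2)] noO[OF b(1)] show False by (rule notE[rotated])
    qed
  qed
  have "(a, a) \<notin> ?R\<^sup>+" for a
  proof
    assume "(a, a) \<in> ?R\<^sup>+"
    moreover from this obtain b where "(a, b) \<in> ?R" by (meson tranclD)
    ultimately show False using noO noN by blast
  qed
  then show ?thesis unfolding acyclic_def by blast
qed

text \<open>Counting predecessors numbers a finite strict total order from 0. It is applied to the
  cuts under inclusion and to the elements of the chain S.\<close>

lemma rank_bij:
  fixes lt :: "'c \<Rightarrow> 'c \<Rightarrow> bool"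
  assumes fin: "finite C" and irr: "\<And>x. \<not> lt x x" and trans: "\<And>x y z. lt x y \<Longrightarrow> lt y z \<Longrightarrow> lt x z"
    and tot: "\<And>x y. x \<in> C \<Longrightarrow> y \<in> C \<Longrightarrow> x \<noteq> y \<Longrightarrow> lt x y \<or> lt y x"
  shows "bij_betw (\<lambda>c. card {x \<in> C. lt x c}) C {..<card C}"
    and "x \<in> C \<Longrightarrow> y \<in> C \<Longrightarrow> lt x y \<Longrightarrow> card {z \<in> C. lt z x} < card {z \<in> C. lt z y}"
proof -
  show mono: "card {z \<in> C. lt z x} < card {z \<in> C. lt z y}" if "x \<in> C" "y \<in> C" "lt x y" for x y
  proof (rule psubset_card_mono)
    show "{z \<in> C. lt z x} \<subset> {z \<in> C. lt z y}" using that irr trans by blast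
  qed (use fin in simp)
  have inj: "inj_on (\<lambda>c. card {x \<in> C. lt x c}) C"
    using mono tot by (metis (no_types, lifting) inj_onI less_irrefl)
  have "(\<lambda>c. card {x \<in> C. lt x c}) ` C \<subseteq> {..<card C}"
  proof (rule image_subsetI)
    fix c assume c: "c \<in> C"
    have "card {x \<in> C. lt x c} < card C"
      using fin c irr by (intro psubset_card_mono) auto
    then show "card {x \<in> C. lt x c} \<in> {..<card C}" by simp
  qed
  then have "(\<lambda>c. card {x \<in> C. lt x c}) ` C = {..<card C}"
    using inj fin by (intro card_subset_eq) (auto simp: card_image)
  with inj show "bij_betw (\<lambda>c. card {x \<in> C. lt x c}) C {..<card C}"
    by (simp add: bij_betw_def)
qed

context autonomous_subposet
begin

abbreviation chain_R :: "nat \<Rightarrow> ('a + nat) rel" where "chain_R k \<equiv> R {..<k} (chain_rel k)"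
abbreviation chain_tube :: "nat \<Rightarrow> ('a + nat) set \<Rightarrow> bool" where
  "chain_tube k \<equiv> proper_tube (X {..<k}) (chain_R k)"

lemma poset_chain: "k > 0 \<Longrightarrow> poset {..<k} (chain_rel k)"
  by (auto simp: poset_def chain_rel_def partial_order_on_def preorder_on_def refl_on_def
      trans_def antisym_def)

lemma tubingsD:
  assumes "T \<in> tubings A' r'"
  shows "\<tau> \<in> T \<Longrightarrow> proper_tube A' r' \<tau>"
    "\<tau> \<in> T \<Longrightarrow> \<tau>' \<in> T \<Longrightarrow> \<tau> \<subseteq> \<tau>' \<or> \<tau>' \<subseteq> \<tau> \<or> \<tau> \<inter> \<tau>' = {}"
    "acyclic {(U, V). U \<in> T \<and> V \<in> T \<and> tube_prec r' U V}"
  using assms by (auto simp: tubings_def)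

text \<open>If an outer a precedes an inner tube and an inner tube precedes an outer a', then a
  meets D, a' meets U, and neither contains all of B. If one contained the other, it would meet both
  D and U and so contain B; hence they are disjoint, and \<open>D_below_U\<close> gives the direct
  relation needed in \<open>acyclic_Un_shortcut\<close>.\<close>

lemma tubings_combine:
  assumes B: "poset B s"
    and K: "K \<in> tubings (X B) (R B s)" "\<And>\<tau>. \<tau> \<in> K \<Longrightarrow> Inl -` \<tau> \<noteq> {}"
    and N: "N \<in> tubings (X B) (R B s)" "\<And>\<sigma>. \<sigma> \<in> N \<Longrightarrow> Inl -` \<sigma> = {}"
    and compat: "\<And>\<tau> \<sigma>. \<tau> \<in> K \<Longrightarrow> \<sigma> \<in> N \<Longrightarrow> \<sigma> \<subseteq> \<tau> \<or> \<tau> \<inter> \<sigma> = {}"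
  shows "K \<union> N \<in> tubings (X B) (R B s)"
proof -
  have inner: "\<sigma> = {} <+> Inr -` \<sigma> \<and> Inr -` \<sigma> \<subseteq> B \<and> Inr -` \<sigma> \<noteq> {}" if "\<sigma> \<in> N" for \<sigma>
  proof -
    have pt: "tube B s \<sigma>" by (rule tubingsD(1)[OF N(1) that])
    have eq: "\<sigma> = {} <+> Inr -` \<sigma>" using set_eq_Plus[of \<sigma>] N(2)[OF that] by simp
    moreover have "\<sigma> \<noteq> {}" using pt by (auto simp: proper_tube_def)
    ultimately have "Inr -` \<sigma> \<noteq> {}" by auto
    then show ?thesis using eq proper_tube_vimage(2)[OF B pt] by blast
  qed
  have "acyclic {(U, V). U \<in> K \<union> N \<and> V \<in> K \<union> N \<and> tube_prec (R B s) U V}"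
  proof (rule acyclic_Un_shortcut)
    fix a a' m m' assume a: "a \<in> K" "a' \<in> K" and m: "m \<in> N" "m' \<in> N"
      and p: "tube_prec (R B s) a m" "tube_prec (R B s) m' a'"
    note pt = tubingsD(1)[OF K(1) a(1)] tubingsD(1)[OF K(1) a(2)]
    have D: "Inl -` a \<inter> D \<noteq> {}" "Inr -` a \<noteq> B"
      using outer_prec_inner(1)[OF B pt(1) K(2)[OF a(1)], of "Inr -` m"] inner[OF m(1)] p(1) by metis+
    have U: "Inl -` a' \<inter> U \<noteq> {}" "Inr -` a' \<noteq> B"
      using outer_prec_inner(2)[OF B pt(2) K(2)[OF a(2)], of "Inr -` m'"] inner[OF m(2)] p(2) by metis+
    have "\<not> a \<subseteq> a'" using outer_tube_full[OF B pt(2)] D U by blast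
    moreover have "\<not> a' \<subseteq> a" using outer_tube_full[OF B pt(1)] D U by blast
    ultimately have dj: "a \<inter> a' = {}" using tubingsD(2)[OF K(1) a] by blast
    obtain d v where dv: "Inl d \<in> a" "d \<in> D" "Inl v \<in> a'" "v \<in> U" using D U by blast
    then have "(Inl d, Inl v) \<in> R B s"
      using D_below_U D_subset U_subset by (auto simp: R_mem)
    then show "tube_prec (R B s) a a'" using dj dv by (auto simp: tube_prec_def)
  qed (use tubingsD(3) K(1) N(1) in auto)
  moreover have "\<forall>\<tau>\<in>K \<union> N. \<forall>\<tau>'\<in>K \<union> N. \<tau> \<subseteq> \<tau>' \<or> \<tau>' \<subseteq> \<tau> \<or> \<tau> \<inter> \<tau>' = {}"
  proof (intro ballI)
    fix \<tau> \<tau>' assume "\<tau> \<in> K \<union> N" "\<tau>' \<in> K \<union> N"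
    then consider "\<tau> \<in> K" "\<tau>' \<in> K" | "\<tau> \<in> K" "\<tau>' \<in> N" | "\<tau> \<in> N" "\<tau>' \<in> K" | "\<tau> \<in> N" "\<tau>' \<in> N" by blast
    then show "\<tau> \<subseteq> \<tau>' \<or> \<tau>' \<subseteq> \<tau> \<or> \<tau> \<inter> \<tau>' = {}"
    proof cases
      case 1 then show ?thesis by (rule tubingsD(2)[OF K(1)])
    next
      case 2 then show ?thesis using compat by blast
    next
      case 3 then show ?thesis using compat by blast
    next
      case 4 then show ?thesis by (rule tubingsD(2)[OF N(1)])
    qed
  qed
  moreover have "\<forall>\<tau>\<in>K \<union> N. tube B s \<tau>"
    using tubingsD(1) K(1) N(1) by blast
  ultimately show ?thesis by (simp add: tubings_def)
qed

section \<open>Pulling tubes back along a surjection onto a chain\<close>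

definition pull :: "'b set \<Rightarrow> ('b \<Rightarrow> nat) \<Rightarrow> ('a + nat) set \<Rightarrow> ('a + 'b) set" where
  "pull B \<pi> \<tau> = Inl -` \<tau> <+> {b \<in> B. \<pi> b \<in> Inr -` \<tau>}"

lemma vimage_pull: "Inl -` pull B \<pi> \<tau> = Inl -` \<tau>" "Inr -` pull B \<pi> \<tau> = {b \<in> B. \<pi> b \<in> Inr -` \<tau>}"
  by (auto simp: pull_def)

lemma fiber_subset_iff:
  assumes "\<pi> \<in> order_surjs B s k" "J \<subseteq> {..<k}"
  shows "{b \<in> B. \<pi> b \<in> J} \<subseteq> {b \<in> B. \<pi> b \<in> J'} \<longleftrightarrow> J \<subseteq> J'"
proof
  assume L: "{b \<in> B. \<pi> b \<in> J} \<subseteq> {b \<in> B. \<pi> b \<in> J'}"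
  show "J \<subseteq> J'"
  proof
    fix j assume j: "j \<in> J"
    then have "j \<in> \<pi> ` B" using assms by (auto simp: order_surjs_def)
    then show "j \<in> J'" using L j by blast
  qed
qed blast

lemma fiber_eq_iff:
  assumes "\<pi> \<in> order_surjs B s k" "J \<subseteq> {..<k}" "J' \<subseteq> {..<k}"
  shows "{b \<in> B. \<pi> b \<in> J} = {b \<in> B. \<pi> b \<in> J'} \<longleftrightarrow> J = J'"
  using fiber_subset_iff[OF assms(1,2), of J'] fiber_subset_iff[OF assms(1,3), of J] by blast

lemma fiber_empty_iff:
  assumes "\<pi> \<in> order_surjs B s k" "J \<subseteq> {..<k}"
  shows "{b \<in> B. \<pi> b \<in> J} = {} \<longleftrightarrow> J = {}"
  using fiber_eq_iff[OF assms, of "{}"] by simp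

lemma fiber_full_iff:
  assumes "\<pi> \<in> order_surjs B s k" "J \<subseteq> {..<k}"
  shows "{b \<in> B. \<pi> b \<in> J} = B \<longleftrightarrow> J = {..<k}"
proof -
  have "{b \<in> B. \<pi> b \<in> {..<k}} = B" using assms(1) by (auto simp: order_surjs_def)
  then show ?thesis using fiber_eq_iff[OF assms, of "{..<k}"] by simp
qed

lemma fiber_disjoint_iff:
  assumes "\<pi> \<in> order_surjs B s k" "J \<subseteq> {..<k}"
  shows "{b \<in> B. \<pi> b \<in> J} \<inter> {b \<in> B. \<pi> b \<in> J'} = {} \<longleftrightarrow> J \<inter> J' = {}"
proof -
  have "J \<inter> J' \<subseteq> {..<k}" using assms(2) by blast
  from fiber_empty_iff[OF assms(1) this] show ?thesis by (simp add: Collect_conj_eq[symmetric] conj_ac disjoint_iff)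
qed

lemma pull_subset_iff:
  assumes "\<pi> \<in> order_surjs B s k" "Inr -` \<tau> \<subseteq> {..<k}"
  shows "pull B \<pi> \<tau> \<subseteq> pull B \<pi> \<tau>' \<longleftrightarrow> \<tau> \<subseteq> \<tau>'"
proof -
  have "\<tau> \<subseteq> \<tau>' \<longleftrightarrow> Inl -` \<tau> \<subseteq> Inl -` \<tau>' \<and> Inr -` \<tau> \<subseteq> Inr -` \<tau>'"
    by (metis set_eq_Plus Plus_subset_iff)
  then show ?thesis
    unfolding pull_def Plus_subset_iff fiber_subset_iff[OF assms] by blast
qed

lemma pull_disjoint_iff:
  assumes "\<pi> \<in> order_surjs B s k" "Inr -` \<tau> \<subseteq> {..<k}"
  shows "pull B \<pi> \<tau> \<inter> pull B \<pi> \<tau>' = {} \<longleftrightarrow> \<tau> \<inter> \<tau>' = {}"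
proof -
  have "\<tau> \<inter> \<tau>' = {} \<longleftrightarrow> Inl -` \<tau> \<inter> Inl -` \<tau>' = {} \<and> Inr -` \<tau> \<inter> Inr -` \<tau>' = {}"
    by (metis set_eq_Plus Plus_disjoint_iff)
  then show ?thesis
    unfolding pull_def Plus_disjoint_iff fiber_disjoint_iff[OF assms] by blast
qed

lemma pull_eq_iff:
  assumes "\<pi> \<in> order_surjs B s k" "Inr -` \<tau> \<subseteq> {..<k}" "Inr -` \<tau>' \<subseteq> {..<k}"
  shows "pull B \<pi> \<tau> = pull B \<pi> \<tau>' \<longleftrightarrow> \<tau> = \<tau>'"
  using pull_subset_iff[OF assms(1,2), of \<tau>'] pull_subset_iff[OF assms(1,3), of \<tau>] by blast

text \<open>Preimages of down-sets and up-sets under \<open>\<pi>\<close> are again such, and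
  surjectivity preserves emptiness and fullness of the trace; these are the conditions in
  \<open>proper_tube_collapsed\<close>.\<close>

lemma proper_tube_pull:
  assumes B: "poset B s" and \<pi>: "\<pi> \<in> order_surjs B s k" and k: "k > 0"
    and \<tau>: "chain_tube k \<tau>" "Inl -` \<tau> \<noteq> {}"
  shows "tube B s (pull B \<pi> \<tau>)"
proof -
  define G J where d: "G = Inl -` \<tau>" "J = Inr -` \<tau>"
  have eq: "\<tau> = G <+> J" unfolding d by (rule set_eq_Plus)
  have G: "G \<subseteq> E" "G \<noteq> {}" and J: "J \<subseteq> {..<k}"
    using proper_tube_vimage[OF poset_chain[OF k] \<tau>(1)] \<tau>(2) unfolding d by auto
  have c: "collapsed_tube G (J \<noteq> {})" "admissible {..<k} (chain_rel k) G J"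
    "J \<noteq> {} \<or> 1 < card G" "\<not> (G = E \<and> J = {..<k})"
    using \<tau>(1) unfolding eq proper_tube_collapsed[OF G J poset_chain[OF k]] by blast+
  let ?I = "{b \<in> B. \<pi> b \<in> J}"
  have m: "(\<pi> x, \<pi> y) \<in> chain_rel k" if "(x, y) \<in> s" for x y
    using that \<pi> poset_subset[OF B] by (auto simp: order_surjs_def chain_rel_def PiE_iff)
  have "below_closed (chain_rel k) J \<Longrightarrow> below_closed s ?I"
    "above_closed (chain_rel k) J \<Longrightarrow> above_closed s ?I"
    unfolding below_closed_def above_closed_def using m poset_subset[OF B] by blast+
  then have "admissible B s G ?I"
    using c(2) fiber_empty_iff[OF \<pi> J] fiber_full_iff[OF \<pi> J] unfolding admissible_def by blast
  then have "tube B s (G <+> ?I)"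
    using c fiber_empty_iff[OF \<pi> J] fiber_full_iff[OF \<pi> J]
    by (subst proper_tube_collapsed[OF G _ B]) auto
  then show ?thesis by (simp add: pull_def d)
qed

lemma tube_prec_pull:
  assumes B: "poset B s" and \<pi>: "\<pi> \<in> order_surjs B s k" and k: "k > 0"
    and \<tau>: "chain_tube k \<tau>" "Inl -` \<tau> \<noteq> {}"
    and \<tau>': "chain_tube k \<tau>'" "Inl -` \<tau>' \<noteq> {}"
  shows "tube_prec (R B s) (pull B \<pi> \<tau>) (pull B \<pi> \<tau>') \<longleftrightarrow> tube_prec (chain_R k) \<tau> \<tau>'"
proof -
  have J: "Inr -` \<tau> \<subseteq> {..<k}" "Inr -` \<tau>' \<subseteq> {..<k}"
    using proper_tube_vimage(2)[OF poset_chain[OF k]] \<tau>(1) \<tau>'(1) by blast+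
  note P = proper_tube_pull[OF B \<pi> k]
  show ?thesis
    unfolding tube_prec_outer[OF poset_chain[OF k] \<tau> \<tau>']
    by (subst tube_prec_outer[OF B P[OF \<tau>] _ P[OF \<tau>']])
      (simp_all only: vimage_pull \<tau>(2) \<tau>'(2) pull_disjoint_iff[OF \<pi> J(1)]
        fiber_empty_iff[OF \<pi> J(1)] fiber_empty_iff[OF \<pi> J(2)] not_False_eq_True)
qed

text \<open>Both directions are used: one to assemble tubings, the other to extract the skeleton of
  a given tubing.\<close>

lemma tubings_pull:
  assumes B: "poset B s" and \<pi>: "\<pi> \<in> order_surjs B s k" and k: "k > 0"
    and T: "\<And>\<tau>. \<tau> \<in> T \<Longrightarrow> chain_tube k \<tau>"
      "\<And>\<tau>. \<tau> \<in> T \<Longrightarrow> Inl -` \<tau> \<noteq> {}"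
  shows "pull B \<pi> ` T \<in> tubings (X B) (R B s) \<longleftrightarrow> T \<in> tubings (X {..<k}) (chain_R k)"
proof -
  have J: "Inr -` \<tau> \<subseteq> {..<k}" if "\<tau> \<in> T" for \<tau>
    using proper_tube_vimage(2)[OF poset_chain[OF k] T(1)[OF that]] .
  note prec = tube_prec_pull[OF B \<pi> k T T]
  let ?RB = "{(U, V). U \<in> pull B \<pi> ` T \<and> V \<in> pull B \<pi> ` T \<and> tube_prec (R B s) U V}"
  let ?Rk = "{(U, V). U \<in> T \<and> V \<in> T \<and> tube_prec (chain_R k) U V}"
  define g where "g = inv_into T (pull B \<pi>)"
  have inj: "inj_on (pull B \<pi>) T" using pull_eq_iff[OF \<pi> J J] by (auto simp: inj_on_def)
  have "acyclic ?RB \<longleftrightarrow> acyclic ?Rk"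
  proof
    assume "acyclic ?RB"
    then show "acyclic ?Rk" by (rule acyclic_map[where f = "pull B \<pi>"]) (auto simp: prec)
  next
    assume "acyclic ?Rk"
    then show "acyclic ?RB"
      by (rule acyclic_map[where f = g]) (auto simp: prec g_def inv_into_f_f[OF inj])
  qed
  moreover have "(\<forall>U\<in>pull B \<pi> ` T. \<forall>V\<in>pull B \<pi> ` T. U \<subseteq> V \<or> V \<subseteq> U \<or> U \<inter> V = {}) \<longleftrightarrow>
     (\<forall>U\<in>T. \<forall>V\<in>T. U \<subseteq> V \<or> V \<subseteq> U \<or> U \<inter> V = {})"
    unfolding ball_simps
    by (intro ball_cong refl) (simp add: pull_subset_iff[OF \<pi> J] pull_disjoint_iff[OF \<pi> J])
  moreover have "\<forall>U\<in>pull B \<pi> ` T. tube B s U"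
    using proper_tube_pull[OF B \<pi> k T] by blast
  ultimately show ?thesis using T(1) unfolding tubings_def by simp
qed

text \<open>
  A tube that meets \<open>B\<close> properly and reaches outside \<open>B\<close> meets it in a down-set if it contains an
  element below \<open>B\<close>, and in an up-set if it contains one above \<open>B\<close>. In a tubing, these down-sets and
  the complements of these up-sets form a chain, the cuts, which amounts to an order-preserving
  surjection \<open>\<pi>\<close> of \<open>B\<close> onto \<open>{..<k}\<close>.
\<close>

definition cuts :: "'b set \<Rightarrow> ('a + 'b) set set \<Rightarrow> 'b set set" where
  "cuts B T = {Inr -` \<tau> | \<tau>. \<tau> \<in> T \<and> Inl -` \<tau> \<inter> D \<noteq> {} \<and> Inr -` \<tau> \<noteq> {} \<and> Inr -` \<tau> \<noteq> B} \<union>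
    {B - Inr -` \<tau> | \<tau>. \<tau> \<in> T \<and> Inl -` \<tau> \<inter> U \<noteq> {} \<and> Inr -` \<tau> \<noteq> {} \<and> Inr -` \<tau> \<noteq> B}"

text \<open>All possible cuts of the chain must occur. This makes the chain as short as possible, so
  that k and \<open>\<pi>\<close> can be read off from the assembled tubing.\<close>

definition skeletons :: "nat \<Rightarrow> ('a + nat) set set set" where
  "skeletons k = {T \<in> tubings (X {..<k}) (chain_R k).
     (\<forall>\<tau>\<in>T. Inl -` \<tau> \<noteq> {}) \<and> cuts {..<k} T = {{..<j} | j. 0 < j \<and> j < k}}"

text \<open>Tubes are stored by their traces on B but judged in the whole poset \<open>X B\<close>,
  where even all of B is a candidate.\<close>

definition inner_tubings :: "'b set \<Rightarrow> 'b rel \<Rightarrow> ('b \<Rightarrow> nat) \<Rightarrow> 'b set set set" where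
  "inner_tubings B s \<pi> = {N. N \<subseteq> Pow B \<and> (<+>) {} ` N \<in> tubings (X B) (R B s) \<and>
     (\<forall>I\<in>N. \<exists>j. \<pi> ` I \<subseteq> {j})}"

definition assemble :: "'b set \<Rightarrow> ('b \<Rightarrow> nat) \<Rightarrow> ('a + nat) set set \<Rightarrow> 'b set set \<Rightarrow> ('a + 'b) set set" where
  "assemble B \<pi> T N = pull B \<pi> ` T \<union> (<+>) {} ` N"

lemma skeletonD:
  assumes "T \<in> skeletons k" "k > 0" "\<tau> \<in> T"
  shows "chain_tube k \<tau>" "Inl -` \<tau> \<noteq> {}" "Inr -` \<tau> \<subseteq> {..<k}"
proof -
  show "chain_tube k \<tau>"
    using assms by (intro tubingsD(1)) (auto simp: skeletons_def)
  then show "Inr -` \<tau> \<subseteq> {..<k}" using proper_tube_vimage(2)[OF poset_chain[OF assms(2)]] by blast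
  show "Inl -` \<tau> \<noteq> {}" using assms by (auto simp: skeletons_def)
qed

text \<open>An inner tube lies in a single fiber, say of j, so it is inside a pulled-back tube or
  disjoint from it according to whether j belongs to the trace of that tube.\<close>

lemma assemble_tubing:
  fixes B :: "'b set"
  assumes B: "poset B s" and \<pi>: "\<pi> \<in> order_surjs B s k" and k: "k > 0"
    and T: "T \<in> skeletons k" and N: "N \<in> inner_tubings B s \<pi>"
  shows "assemble B \<pi> T N \<in> tubings (X B) (R B s)"
  unfolding assemble_def
proof (rule tubings_combine[OF B])
  note TD = skeletonD[OF T k]
  show "pull B \<pi> ` T \<in> tubings (X B) (R B s)"
    using tubings_pull[OF B \<pi> k TD(1,2)] T by (auto simp: skeletons_def)
  show "(<+>) {} ` N \<in> tubings (X B) (R B s)" using N by (simp add: inner_tubings_def)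
  show "Inl -` \<tau> \<noteq> {}" if "\<tau> \<in> pull B \<pi> ` T" for \<tau>
    using that TD(2) by (auto simp: vimage_pull)
  show "Inl -` \<sigma> = {}" if "\<sigma> \<in> (<+>) {} ` N" for \<sigma> :: "('a + 'b) set" using that by auto
  fix \<tau> \<sigma> :: "('a + 'b) set" assume "\<tau> \<in> pull B \<pi> ` T" and "\<sigma> \<in> (<+>) {} ` N"
  then obtain \<tau>' I where *: "\<tau> = pull B \<pi> \<tau>'" "\<sigma> = {} <+> I" "I \<in> N" by blast
  have h: "N \<subseteq> Pow B" "\<forall>I\<in>N. \<exists>j. \<pi> ` I \<subseteq> {j}" using N by (simp_all add: inner_tubings_def)
  obtain j where "\<pi> ` I \<subseteq> {j}" using bspec[OF h(2) *(3)] by (rule exE)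
  then have j: "\<pi> b = j" if "b \<in> I" for b using that by (simp add: image_subset_iff)
  have I: "I \<subseteq> B" using h(1) *(3) by (simp add: subset_iff)
  have "I \<subseteq> {b \<in> B. \<pi> b \<in> Inr -` \<tau>'}" if "j \<in> Inr -` \<tau>'" using j I that by auto
  moreover have "{b \<in> B. \<pi> b \<in> Inr -` \<tau>'} \<inter> I = {}" if "j \<notin> Inr -` \<tau>'" using j that by auto
  ultimately show "\<sigma> \<subseteq> \<tau> \<or> \<tau> \<inter> \<sigma> = {}"
    unfolding * pull_def Plus_subset_iff Plus_disjoint_iff by (cases "j \<in> Inr -` \<tau>'") simp_all
qed

lemma cuts_pull:
  assumes \<pi>: "\<pi> \<in> order_surjs B s k" and T: "\<And>\<tau>. \<tau> \<in> T \<Longrightarrow> Inr -` \<tau> \<subseteq> {..<k}"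
  shows "cuts B (pull B \<pi> ` T) = (\<lambda>J. {b \<in> B. \<pi> b \<in> J}) ` cuts {..<k} T"
proof -
  have e: "{b \<in> B. \<pi> b \<in> Inr -` \<tau>} = {} \<longleftrightarrow> Inr -` \<tau> = {}"
    "{b \<in> B. \<pi> b \<in> Inr -` \<tau>} = B \<longleftrightarrow> Inr -` \<tau> = {..<k}"
    "B - {b \<in> B. \<pi> b \<in> Inr -` \<tau>} = {b \<in> B. \<pi> b \<in> {..<k} - Inr -` \<tau>}" if "\<tau> \<in> T" for \<tau>
    using fiber_empty_iff[OF \<pi> T[OF that]] fiber_full_iff[OF \<pi> T[OF that]] \<pi>
    by (auto simp: order_surjs_def)
  let ?f = "\<lambda>J. {b \<in> B. \<pi> b \<in> J}"
  let ?L = "\<lambda>T B. {\<tau> \<in> T. Inl -` \<tau> \<inter> D \<noteq> {} \<and> Inr -` \<tau> \<noteq> {} \<and> Inr -` \<tau> \<noteq> B}"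
  let ?H = "\<lambda>T B. {\<tau> \<in> T. Inl -` \<tau> \<inter> U \<noteq> {} \<and> Inr -` \<tau> \<noteq> {} \<and> Inr -` \<tau> \<noteq> B}"
  have im: "{\<tau> \<in> pull B \<pi> ` T. P \<tau>} = pull B \<pi> ` {\<tau> \<in> T. P (pull B \<pi> \<tau>)}" for P by blast
  have LH: "?L (pull B \<pi> ` T) B = pull B \<pi> ` ?L T {..<k}" "?H (pull B \<pi> ` T) B = pull B \<pi> ` ?H T {..<k}"
    unfolding im vimage_pull
    by (rule arg_cong[where f = "(`) (pull B \<pi>)"], rule Collect_cong, rule conj_cong[OF refl],
        simp only: e(1,2))+
  note c = cuts_def[unfolded setcompr_eq_image]
  have "(\<lambda>\<tau>. Inr -` \<tau>) ` pull B \<pi> ` ?L T {..<k} = ?f ` (\<lambda>\<tau>. Inr -` \<tau>) ` ?L T {..<k}"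
    by (simp only: image_image vimage_pull)
  moreover have "(\<lambda>\<tau>. B - Inr -` \<tau>) ` pull B \<pi> ` ?H T {..<k} = ?f ` (\<lambda>\<tau>. {..<k} - Inr -` \<tau>) ` ?H T {..<k}"
    unfolding image_image vimage_pull
  proof (rule image_cong[OF refl])
    fix \<tau> assume "\<tau> \<in> ?H T {..<k}"
    then have "\<tau> \<in> T" by simp
    then show "B - {b \<in> B. \<pi> b \<in> Inr -` \<tau>} = {b \<in> B. \<pi> b \<in> {..<k} - Inr -` \<tau>}" by (rule e(3))
  qed
  ultimately show ?thesis unfolding c LH image_Un by simp
qed

lemma image_fiber:
  assumes "\<pi> \<in> order_surjs B s k" "J \<subseteq> {..<k}"
  shows "\<pi> ` {b \<in> B. \<pi> b \<in> J} = J"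
proof (intro equalityI subsetI)
  fix j assume j: "j \<in> J"
  then have "j \<in> \<pi> ` B" using assms by (auto simp: order_surjs_def)
  then obtain b where "b \<in> B" "j = \<pi> b" by (elim imageE)
  then show "j \<in> \<pi> ` {b \<in> B. \<pi> b \<in> J}" using j by simp
qed auto

lemma cuts_iff: "c \<in> cuts B T \<longleftrightarrow>
    (\<exists>\<tau>. c = Inr -` \<tau> \<and> \<tau> \<in> T \<and> Inl -` \<tau> \<inter> D \<noteq> {} \<and> Inr -` \<tau> \<noteq> {} \<and> Inr -` \<tau> \<noteq> B) \<or>
    (\<exists>\<tau>. c = B - Inr -` \<tau> \<and> \<tau> \<in> T \<and> Inl -` \<tau> \<inter> U \<noteq> {} \<and> Inr -` \<tau> \<noteq> {} \<and> Inr -` \<tau> \<noteq> B)"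
  by (simp only: cuts_def Un_iff mem_Collect_eq)

lemma cuts_outer: "cuts B T = cuts B {\<tau> \<in> T. Inl -` \<tau> \<noteq> {}}"
proof -
  have "\<tau> \<in> T \<and> Inl -` \<tau> \<inter> Z \<noteq> {} \<and> P \<longleftrightarrow> \<tau> \<in> {\<tau> \<in> T. Inl -` \<tau> \<noteq> {}} \<and> Inl -` \<tau> \<inter> Z \<noteq> {} \<and> P" for \<tau> Z P
    by auto
  then show ?thesis unfolding cuts_def by (simp only:)
qed

lemma assemble_parts:
  assumes T: "\<And>\<tau>. \<tau> \<in> T \<Longrightarrow> Inl -` \<tau> \<noteq> {}"
  shows "{I. {} <+> I \<in> assemble B \<pi> T N} = N"
    "{\<tau> \<in> assemble B \<pi> T N. Inl -` \<tau> \<noteq> {}} = pull B \<pi> ` T"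
    "cuts B (assemble B \<pi> T N) = cuts B (pull B \<pi> ` T)"
proof -
  have "{} <+> I \<notin> pull B \<pi> ` T" for I using T vimage_pull(1)[of B \<pi>] by (metis imageE vimage_Plus(1))
  then show "{I. {} <+> I \<in> assemble B \<pi> T N} = N"
    by (auto simp: assemble_def Plus_eq_iff)
  show outer: "{\<tau> \<in> assemble B \<pi> T N. Inl -` \<tau> \<noteq> {}} = pull B \<pi> ` T"
    using T by (auto simp: assemble_def vimage_pull)
  show "cuts B (assemble B \<pi> T N) = cuts B (pull B \<pi> ` T)"
    using cuts_outer[of B "assemble B \<pi> T N"] by (simp only: outer)
qed

text \<open>The cuts are nested, so the number of cuts that miss b is the index of its block,
  counted from the bottom. Restriction to B makes the function extensional, as in
  \<open>order_surjs\<close>.\<close>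

definition cut_map :: "'b set \<Rightarrow> 'b set set \<Rightarrow> 'b \<Rightarrow> nat" where
  "cut_map B C = (\<lambda>b\<in>B. card {c \<in> C. b \<notin> c})"

text \<open>The k blocks have k - 1 boundaries, hence \<open>Suc\<close>. Recovering
  \<open>\<pi>\<close> and k from the cuts is what injectivity in \<open>sum_tubings\<close>
  requires.\<close>

lemma cut_map_eq:
  assumes \<pi>: "\<pi> \<in> order_surjs B s k" and k: "k > 0" and C: "C = {{b \<in> B. \<pi> b < j} | j. 0 < j \<and> j < k}"
  shows "cut_map B C = \<pi>" "Suc (card C) = k"
proof -
  let ?f = "\<lambda>j. {b \<in> B. \<pi> b \<in> {..<j}}"
  have C': "C = ?f ` {1..<k}" unfolding C by force
  have inj: "inj_on ?f {1..<k}"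
  proof (rule inj_onI)
    fix i j assume "i \<in> {1..<k}" "j \<in> {1..<k}" "?f i = ?f j"
    then have "{..<i} = {..<j}" using fiber_eq_iff[OF \<pi>, of "{..<i}" "{..<j}"] by auto
    then show "i = j" by simp
  qed
  have "card C = card {1..<k}" unfolding C' by (rule card_image[OF inj])
  then show "Suc (card C) = k" using k by simp
  show "cut_map B C = \<pi>"
  proof
    fix b
    show "cut_map B C b = \<pi> b"
    proof (cases "b \<in> B")
      case True
      then have lt: "\<pi> b < k" using \<pi> by (auto simp: order_surjs_def)
      have "{c \<in> C. b \<notin> c} = ?f ` {1..\<pi> b}"
        unfolding C' using True lt by (auto simp: not_less)
      moreover have "card (?f ` {1..\<pi> b}) = card {1..\<pi> b}"
        by (rule card_image, rule inj_on_subset[OF inj]) (use lt in auto)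
      ultimately have "card {c \<in> C. b \<notin> c} = \<pi> b" by simp
      then show ?thesis using True by (simp add: cut_map_def)
    next
      case False
      then show ?thesis using \<pi> by (auto simp: cut_map_def order_surjs_def PiE_iff extensional_def)
    qed
  qed
qed

lemma cuts_assemble:
  assumes \<pi>: "\<pi> \<in> order_surjs B s k" and k: "k > 0" and T: "T \<in> skeletons k"
  shows "cuts B (assemble B \<pi> T N) = {{b \<in> B. \<pi> b < j} | j. 0 < j \<and> j < k}"
proof -
  have 1: "cuts B (assemble B \<pi> T N) = cuts B (pull B \<pi> ` T)"
    by (rule assemble_parts(3)) (rule skeletonD(2)[OF T k])
  have 2: "cuts B (pull B \<pi> ` T) = (\<lambda>J. {b \<in> B. \<pi> b \<in> J}) ` cuts {..<k} T"
    by (rule cuts_pull[OF \<pi>]) (rule skeletonD(3)[OF T k])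
  have 3: "cuts {..<k} T = (\<lambda>j. {..<j}) ` {j. 0 < j \<and> j < k}"
    using T unfolding skeletons_def setcompr_eq_image by blast
  show ?thesis unfolding 1 2 3 image_image setcompr_eq_image lessThan_iff ..
qed

text \<open>Two tubes that meet B and both meet D precede each other if they are disjoint, a
  2-cycle; so they are nested, and likewise for U. A tube meeting D and one meeting U, both with
  proper nonempty traces, cannot be nested, since the larger would meet both D and U; so they are
  disjoint, and the first trace lies in the complement of the second.\<close>

lemma cuts_tubing:
  assumes B: "poset B s" and T: "T \<in> tubings (X B) (R B s)"
  shows "c \<in> cuts B T \<Longrightarrow> c \<subseteq> B \<and> c \<noteq> {} \<and> c \<noteq> B \<and> below_closed s c"
    "c \<in> cuts B T \<Longrightarrow> c' \<in> cuts B T \<Longrightarrow> c \<subseteq> c' \<or> c' \<subseteq> c"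
proof -
  have lower: "Inr -` \<tau> \<subseteq> B \<and> below_closed s (Inr -` \<tau>) \<and> Inl -` \<tau> \<inter> U = {}"
    if "\<tau> \<in> T" "Inl -` \<tau> \<inter> D \<noteq> {}" "Inr -` \<tau> \<noteq> {}" "Inr -` \<tau> \<noteq> B" for \<tau>
    using outer_tube(2)[OF B tubingsD(1)[OF T that(1)]] proper_tube_vimage(2)[OF B tubingsD(1)[OF T that(1)]] that
    unfolding admissible_def by blast
  have upper: "Inr -` \<tau> \<subseteq> B \<and> above_closed s (Inr -` \<tau>) \<and> Inl -` \<tau> \<inter> D = {}"
    if "\<tau> \<in> T" "Inl -` \<tau> \<inter> U \<noteq> {}" "Inr -` \<tau> \<noteq> {}" "Inr -` \<tau> \<noteq> B" for \<tau>
    using outer_tube(2)[OF B tubingsD(1)[OF T that(1)]] proper_tube_vimage(2)[OF B tubingsD(1)[OF T that(1)]] that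
    unfolding admissible_def by blast
  show "c \<subseteq> B \<and> c \<noteq> {} \<and> c \<noteq> B \<and> below_closed s c" if "c \<in> cuts B T" for c
  proof -
    from that[unfolded cuts_iff]
    consider \<tau> where "c = Inr -` \<tau>" "\<tau> \<in> T" "Inl -` \<tau> \<inter> D \<noteq> {}" "Inr -` \<tau> \<noteq> {}" "Inr -` \<tau> \<noteq> B"
      | \<tau> where "c = B - Inr -` \<tau>" "\<tau> \<in> T" "Inl -` \<tau> \<inter> U \<noteq> {}" "Inr -` \<tau> \<noteq> {}" "Inr -` \<tau> \<noteq> B"
      by (elim disjE exE conjE) simp_all
    then show ?thesis
    proof cases
      case 1
      then show ?thesis using lower[of \<tau>] by simp
    next
      case 2
      then have u: "Inr -` \<tau> \<subseteq> B" "above_closed s (Inr -` \<tau>)" using upper[of \<tau>] by auto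
      then have "below_closed s c"
        using poset_subset[OF B] unfolding 2(1) below_closed_def above_closed_def by blast
      then show ?thesis using 2 u by blast
    qed
  qed
  have cyc: False if "(\<tau>, \<tau>') \<in> {(U, V). U \<in> T \<and> V \<in> T \<and> tube_prec (R B s) U V}"
     "(\<tau>', \<tau>) \<in> {(U, V). U \<in> T \<and> V \<in> T \<and> tube_prec (R B s) U V}" for \<tau> \<tau>'
    using tubingsD(3)[OF T] that unfolding acyclic_def by (meson r_into_trancl trancl_trans)
  have same_side: "Inr -` \<tau> \<subseteq> Inr -` \<tau>' \<or> Inr -` \<tau>' \<subseteq> Inr -` \<tau>"
    if Z: "Z = D \<or> Z = U" and t: "\<tau> \<in> T" "Inl -` \<tau> \<inter> Z \<noteq> {}" "Inr -` \<tau> \<noteq> {}"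
      "\<tau>' \<in> T" "Inl -` \<tau>' \<inter> Z \<noteq> {}" "Inr -` \<tau>' \<noteq> {}"
    for \<tau> \<tau>' Z
  proof -
    have "\<tau> \<inter> \<tau>' \<noteq> {}"
    proof
      assume dj: "\<tau> \<inter> \<tau>' = {}"
      note pt = tubingsD(1)[OF T t(1)] tubingsD(1)[OF T t(4)]
      have "tube_prec (R B s) \<tau> \<tau>'" "tube_prec (R B s) \<tau>' \<tau>"
        using tube_prec_outer[OF B pt(1) _ pt(2)] tube_prec_outer[OF B pt(2) _ pt(1)] t dj Z by blast+
      then show False using cyc[of \<tau> \<tau>'] t by blast
    qed
    then show ?thesis using tubingsD(2)[OF T t(1,4)] by blast
  qed
  have mix: "Inr -` \<tau> \<subseteq> B - Inr -` \<tau>'"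
    if t: "\<tau> \<in> T" "Inl -` \<tau> \<inter> D \<noteq> {}" "Inr -` \<tau> \<noteq> {}" "Inr -` \<tau> \<noteq> B"
      "\<tau>' \<in> T" "Inl -` \<tau>' \<inter> U \<noteq> {}" "Inr -` \<tau>' \<noteq> {}" "Inr -` \<tau>' \<noteq> B"
    for \<tau> \<tau>'
  proof -
    have "\<not> \<tau> \<subseteq> \<tau>'" using upper[OF t(5-8)] t(2) by blast
    moreover have "\<not> \<tau>' \<subseteq> \<tau>" using lower[OF t(1-4)] t(6) by blast
    ultimately have "\<tau> \<inter> \<tau>' = {}" using tubingsD(2)[OF T t(1,5)] by blast
    then show ?thesis using lower[OF t(1-4)] by blast
  qed
  show "c \<subseteq> c' \<or> c' \<subseteq> c" if "c \<in> cuts B T" "c' \<in> cuts B T" for c c'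
  proof -
    from that[unfolded cuts_iff] show ?thesis
    proof (elim disjE exE conjE, goal_cases)
      case (1 \<tau> \<tau>') then show ?case using same_side[of D \<tau> \<tau>'] by simp
    next
      case (2 \<tau> \<tau>') then show ?case using mix[of \<tau> \<tau>'] by simp
    next
      case (3 \<tau> \<tau>') then show ?case using mix[of \<tau>' \<tau>] by simp
    next
      case (4 \<tau> \<tau>') then show ?case using same_side[of U \<tau> \<tau>'] by blast
    qed
  qed
qed

lemma cut_map_surj:
  assumes B: "poset B s" and fin: "finite C"
    and C: "\<And>c. c \<in> C \<Longrightarrow> c \<subseteq> B \<and> c \<noteq> {} \<and> c \<noteq> B \<and> below_closed s c"
    and chain: "\<And>c c'. c \<in> C \<Longrightarrow> c' \<in> C \<Longrightarrow> c \<subseteq> c' \<or> c' \<subseteq> c"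
  defines "\<pi> \<equiv> cut_map B C" and "k \<equiv> Suc (card C)"
  shows "\<pi> \<in> order_surjs B s k" "C = {{b \<in> B. \<pi> b < j} | j. 0 < j \<and> j < k}"
proof -
  have \<pi>: "\<pi> b = card {c \<in> C. b \<notin> c}" if "b \<in> B" for b using that by (simp add: \<pi>_def cut_map_def)
  have finC: "finite {c \<in> C. P c}" for P using fin by simp
  have lt: "\<pi> b < k" if "b \<in> B" for b
    using that card_mono[OF fin, of "{c \<in> C. b \<notin> c}"] by (simp add: \<pi> k_def less_Suc_eq_le)
  \<comment> \<open>If there are cuts strictly inside c, they have a largest one and c has an
    element beyond it; this element is missed exactly by those cuts. With c ranging over the cuts
    and B, every value below k is attained.\<close>
  have pred: "\<exists>b\<in>c. \<pi> b = card {c' \<in> C. c' \<subset> c}" if c: "c = B \<or> c \<in> C" for c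
  proof -
    have cB: "c \<subseteq> B" and cne: "c \<noteq> {}" using c C B by (auto simp: poset_def)
    have cmp: "c' \<subset> c \<or> c \<subseteq> c'" if "c' \<in> C" for c' using c C chain that by blast
    have "\<exists>b\<in>c. \<forall>c'\<in>{c' \<in> C. c' \<subset> c}. b \<notin> c'"
    proof (cases "{c' \<in> C. c' \<subset> c} = {}")
      case True
      show ?thesis unfolding True using cne by auto
    next
      case False
      obtain m where m: "m \<in> {c' \<in> C. c' \<subset> c}" and mx: "\<forall>c'\<in>{c' \<in> C. c' \<subset> c}. m \<subseteq> c' \<longrightarrow> m = c'"
        using finite_has_maximal[OF finC[of "\<lambda>c'. c' \<subset> c"] False] by (elim bexE)
      have le: "c' \<subseteq> m" if c': "c' \<in> {c' \<in> C. c' \<subset> c}" for c'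
      proof (rule ccontr)
        assume n: "\<not> c' \<subseteq> m"
        then have "m \<subseteq> c'" using chain[of m c'] m c' by auto
        then show False using bspec[OF mx c'] n by simp
      qed
      have "m \<subset> c" using m by simp
      then obtain b where b: "b \<in> c" "b \<notin> m" by blast
      have "b \<notin> c'" if "c' \<in> {c' \<in> C. c' \<subset> c}" for c' using subsetD[OF le[OF that]] b(2) by auto
      then show ?thesis using b(1) by (intro bexI[of _ b] ballI)
    qed
    then obtain b where b: "b \<in> c" "\<forall>c'\<in>{c' \<in> C. c' \<subset> c}. b \<notin> c'" by (elim bexE) simp
    have "b \<notin> c' \<longleftrightarrow> c' \<subset> c" if "c' \<in> C" for c'
    proof
      assume "b \<notin> c'"
      then show "c' \<subset> c" using cmp[OF that] b(1) by auto
    next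
      assume "c' \<subset> c"
      then show "b \<notin> c'" using b(2) that by simp
    qed
    then have "{c' \<in> C. b \<notin> c'} = {c' \<in> C. c' \<subset> c}" by (intro Collect_cong conj_cong refl)
    then have "\<pi> b = card {c' \<in> C. c' \<subset> c}" using \<pi>[of b] b(1) cB by auto
    then show ?thesis using b(1) by blast
  qed
  have rank: "bij_betw (\<lambda>c. card {x \<in> C. x \<subset> c}) C {..<card C}"
    using chain by (intro rank_bij(1) fin) blast+
  have onto: "\<exists>b\<in>B. \<pi> b = j" if "j < k" for j
  proof (cases "j = card C")
    case True
    have "{c' \<in> C. c' \<subset> B} = C" using C by blast
    then show ?thesis using pred[of B] True by auto
  next
    case False
    then have "j \<in> (\<lambda>c. card {x \<in> C. x \<subset> c}) ` C"
      using rank that by (simp add: bij_betw_def k_def)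
    then obtain c where "c \<in> C" "j = card {x \<in> C. x \<subset> c}" by blast
    then show ?thesis using pred[of c] C by blast
  qed
  have mono: "\<pi> x \<le> \<pi> y" if "(x, y) \<in> s" for x y
  proof -
    have xy: "x \<in> B" "y \<in> B" using that poset_subset[OF B] by auto
    have "{c \<in> C. x \<notin> c} \<subseteq> {c \<in> C. y \<notin> c}"
      using C that unfolding below_closed_def by blast
    then show ?thesis using xy by (simp add: \<pi> card_mono[OF finC])
  qed
  show "\<pi> \<in> order_surjs B s k"
    unfolding order_surjs_def
  proof (intro CollectI conjI)
    show "\<pi> \<in> B \<rightarrow>\<^sub>E {..<k}" using lt by (auto simp: PiE_iff \<pi>_def cut_map_def)
    show "\<pi> ` B = {..<k}" using lt onto by (auto simp: image_iff)
    show "\<forall>(x, y)\<in>s. \<pi> x \<le> \<pi> y" using mono by blast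
  qed
  have cut: "c = {b \<in> B. \<pi> b < Suc (card {x \<in> C. x \<subset> c})}" if c: "c \<in> C" for c
  proof -
    have "\<pi> b \<le> card {x \<in> C. x \<subset> c} \<longleftrightarrow> b \<in> c" if b: "b \<in> B" for b
    proof
      assume "b \<in> c"
      then have "{c' \<in> C. b \<notin> c'} \<subseteq> {x \<in> C. x \<subset> c}" using chain[OF c] by blast
      then show "\<pi> b \<le> card {x \<in> C. x \<subset> c}" using b by (simp add: \<pi> card_mono[OF finC])
    next
      assume le: "\<pi> b \<le> card {x \<in> C. x \<subset> c}"
      show "b \<in> c"
      proof (rule ccontr)
        assume "b \<notin> c"
        then have "{x \<in> C. x \<subset> c} \<subset> {c' \<in> C. b \<notin> c'}" using c by blast
        then have "card {x \<in> C. x \<subset> c} < \<pi> b" using b psubset_card_mono[OF finC] by (simp add: \<pi>)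
        then show False using le by simp
      qed
    qed
    then show ?thesis using C[OF c] by (auto simp: less_Suc_eq_le)
  qed
  show "C = {{b \<in> B. \<pi> b < j} | j. 0 < j \<and> j < k}"
  proof (intro equalityI subsetI)
    fix c assume c: "c \<in> C"
    have "card {x \<in> C. x \<subset> c} < card C" using rank c by (auto simp: bij_betw_def)
    then show "c \<in> {{b \<in> B. \<pi> b < j} | j. 0 < j \<and> j < k}"
      using cut[OF c] k_def by blast
  next
    fix c assume "c \<in> {{b \<in> B. \<pi> b < j} | j. 0 < j \<and> j < k}"
    then obtain j where j: "c = {b \<in> B. \<pi> b < Suc j}" "j < card C"
      using k_def by (auto simp: gr0_conv_Suc)
    then have "j \<in> (\<lambda>c. card {x \<in> C. x \<subset> c}) ` C" using rank by (simp add: bij_betw_def)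
    then obtain c' where "c' \<in> C" "j = card {x \<in> C. x \<subset> c'}" by blast
    then show "c \<in> C" using cut[of c'] j(1) by simp
  qed
qed

text \<open>Take \<open>\<pi>\<close> from the cuts of T. A proper nonempty trace of an outer tube
  is a cut or the complement of one, hence a union of fibers; an inner tube is contained in or
  disjoint from each tube that makes a cut, so it crosses no cut and stays in one fiber.\<close>

lemma tubing_assembled:
  assumes B: "poset B s" and T: "T \<in> tubings (X B) (R B s)"
  obtains k \<pi> T' N where "k > 0" "\<pi> \<in> order_surjs B s k" "T' \<in> skeletons k"
    "N \<in> inner_tubings B s \<pi>" "T = assemble B \<pi> T' N"
proof -
  define C where "C = cuts B T"
  define \<pi> where "\<pi> = cut_map B C"
  define k where "k = Suc (card C)"
  have k: "k > 0" by (simp add: k_def)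
  note CT = cuts_tubing[OF B T, folded C_def]
  have fin: "finite C"
    by (rule finite_subset[of _ "Pow B"]) (use CT(1) B in \<open>auto simp: poset_def\<close>)
  have surj: "\<pi> \<in> order_surjs B s k" "C = {{b \<in> B. \<pi> b < j} | j. 0 < j \<and> j < k}"
    unfolding \<pi>_def k_def by (rule cut_map_surj[OF B fin], erule CT(1), erule (1) CT(2))+
  note \<pi> = surj(1)
  let ?f = "\<lambda>J. {b \<in> B. \<pi> b \<in> J}"
  let ?O = "{\<tau> \<in> T. Inl -` \<tau> \<noteq> {}}"
  \<comment> \<open>\<open>push\<close> inverts \<open>pull B \<pi>\<close> on the outer tubes of T,
    whose traces are unions of fibers by \<open>shape\<close>.\<close>
  define push where "push \<tau> = (Inl -` \<tau> <+> \<pi> ` (Inr -` \<tau>))" for \<tau> :: "('a + 'b) set"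
  define T' where "T' = push ` ?O"
  define N where "N = {I. {} <+> I \<in> T}"
  have shape: "\<exists>J. J \<subseteq> {..<k} \<and> Inr -` \<tau> = ?f J \<and> admissible {..<k} (chain_rel k) (Inl -` \<tau>) J"
    if \<tau>: "\<tau> \<in> ?O" for \<tau>
  proof -
    have pt: "tube B s \<tau>" using tubingsD(1)[OF T] \<tau> by blast
    have I: "Inr -` \<tau> \<subseteq> B" by (rule proper_tube_vimage(2)[OF B pt])
    have full: "?f {..<k} = B" using \<pi> by (auto simp: order_surjs_def)
    have "admissible B s (Inl -` \<tau>) (Inr -` \<tau>)" using outer_tube(2)[OF B pt] \<tau> by blast
    then consider "Inr -` \<tau> = {}" | "Inr -` \<tau> = B"
      | "Inr -` \<tau> \<noteq> {}" "Inr -` \<tau> \<noteq> B" "Inl -` \<tau> \<inter> D \<noteq> {}" "Inl -` \<tau> \<inter> U = {}"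
      | "Inr -` \<tau> \<noteq> {}" "Inr -` \<tau> \<noteq> B" "Inl -` \<tau> \<inter> U \<noteq> {}" "Inl -` \<tau> \<inter> D = {}"
      unfolding admissible_def by blast
    then show ?thesis
    proof cases
      case 1
      have "admissible {..<k} (chain_rel k) (Inl -` \<tau>) {}" by (simp add: admissible_def)
      moreover have "Inr -` \<tau> = ?f {}" using 1 by simp
      ultimately show ?thesis by (intro exI[of _ "{}"] conjI empty_subsetI)
    next
      case 2
      have "admissible {..<k} (chain_rel k) (Inl -` \<tau>) {..<k}" unfolding admissible_def by (intro disjI1 disjI2 refl)
      moreover have "Inr -` \<tau> = ?f {..<k}" unfolding full by (rule 2)
      ultimately show ?thesis by (intro exI[of _ "{..<k}"] conjI subset_refl)
    next
      case 3
      then have "Inr -` \<tau> \<in> C" unfolding C_def cuts_iff using \<tau> by (intro disjI1 exI[of _ \<tau>]) simp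
      from subsetD[OF equalityD1[OF surj(2)] this]
      obtain j where j: "Inr -` \<tau> = {b \<in> B. \<pi> b < j}" "j < k"
        unfolding mem_Collect_eq by (elim exE conjE)
      have "below_closed (chain_rel k) {..<j}" by (auto simp: below_closed_def chain_rel_def)
      with 3 have "admissible {..<k} (chain_rel k) (Inl -` \<tau>) {..<j}"
        by (simp add: admissible_def)
      moreover have "{..<j} \<subseteq> {..<k}" "Inr -` \<tau> = ?f {..<j}" using j by auto
      ultimately show ?thesis by (intro exI[of _ "{..<j}"] conjI)
    next
      case 4
      then have "B - Inr -` \<tau> \<in> C" unfolding C_def cuts_iff using \<tau> by (intro disjI2 exI[of _ \<tau>]) simp
      from subsetD[OF equalityD1[OF surj(2)] this]
      obtain j where j: "B - Inr -` \<tau> = {b \<in> B. \<pi> b < j}" "j < k"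
        unfolding mem_Collect_eq by (elim exE conjE)
      have "Inr -` \<tau> = B - (B - Inr -` \<tau>)" using I by blast
      also have "\<dots> = ?f {j..<k}" unfolding j(1) using full by auto
      finally have "Inr -` \<tau> = ?f {j..<k}" .
      moreover have "above_closed (chain_rel k) {j..<k}" by (auto simp: above_closed_def chain_rel_def)
      with 4 have "admissible {..<k} (chain_rel k) (Inl -` \<tau>) {j..<k}"
        by (simp add: admissible_def)
      moreover have "{j..<k} \<subseteq> {..<k}" by auto
      ultimately show ?thesis by (intro exI[of _ "{j..<k}"] conjI)
    qed
  qed
  have push: "pull B \<pi> (push \<tau>) = \<tau> \<and> Inl -` push \<tau> = Inl -` \<tau> \<and>
      chain_tube k (push \<tau>)" if \<tau>: "\<tau> \<in> ?O" for \<tau>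
  proof -
    obtain J where J: "J \<subseteq> {..<k}" "Inr -` \<tau> = ?f J" "admissible {..<k} (chain_rel k) (Inl -` \<tau>) J"
      using shape[OF \<tau>] by blast
    have pt: "tube B s \<tau>" using tubingsD(1)[OF T] \<tau> by blast
    have "\<pi> ` (Inr -` \<tau>) = J" unfolding J(2) by (rule image_fiber[OF \<pi> J(1)])
    then have ps: "push \<tau> = Inl -` \<tau> <+> J" by (simp add: push_def)
    have "pull B \<pi> (push \<tau>) = Inl -` \<tau> <+> Inr -` \<tau>" by (simp add: ps pull_def vimage_Plus J(2))
    moreover have "chain_tube k (Inl -` \<tau> <+> J)"
    proof -
      note G = proper_tube_vimage(1)[OF B pt]
      have ne: "Inl -` \<tau> \<noteq> {}" using \<tau> by blast
      have "tube B s (Inl -` \<tau> <+> Inr -` \<tau>)" using pt set_eq_Plus[of \<tau>] by simp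
      then show ?thesis
        unfolding proper_tube_collapsed[OF G ne proper_tube_vimage(2)[OF B pt] B]
          proper_tube_collapsed[OF G ne J(1) poset_chain[OF k]]
        using J(3) unfolding J(2) fiber_empty_iff[OF \<pi> J(1)] fiber_full_iff[OF \<pi> J(1)] by simp
    qed
    ultimately show ?thesis by (simp add: ps vimage_Plus flip: set_eq_Plus)
  qed
  have "(\<lambda>\<tau>. pull B \<pi> (push \<tau>)) ` ?O = id ` ?O"
  proof (rule image_cong[OF refl])
    fix \<tau> assume "\<tau> \<in> ?O"
    from push[OF this] show "pull B \<pi> (push \<tau>) = id \<tau>" by simp
  qed
  then have pullT': "pull B \<pi> ` T' = ?O" unfolding T'_def image_image by simp
  have T'D: "chain_tube k \<tau>" "Inl -` \<tau> \<noteq> {}" if t: "\<tau> \<in> T'" for \<tau>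
  proof -
    obtain \<tau>0 where \<tau>0: "\<tau> = push \<tau>0" "\<tau>0 \<in> ?O" using t unfolding T'_def by (elim imageE)
    show "chain_tube k \<tau>" "Inl -` \<tau> \<noteq> {}"
      using push[OF \<tau>0(2)] \<tau>0 by simp_all
  qed
  have T'J: "Inr -` \<tau> \<subseteq> {..<k}" if "\<tau> \<in> T'" for \<tau>
    using proper_tube_vimage(2)[OF poset_chain[OF k] T'D(1)[OF that]] .
  have "?O \<in> tubings (X B) (R B s)" by (rule tubings_subset[OF T]) blast
  then have T't: "T' \<in> tubings (X {..<k}) (chain_R k)"
    using tubings_pull[where T = T', OF B \<pi> k T'D] pullT' by simp
  have TN: "T = assemble B \<pi> T' N"
  proof -
    have "\<tau> \<in> (<+>) {} ` N" if "\<tau> \<in> T" "Inl -` \<tau> = {}" for \<tau>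
    proof -
      have "\<tau> = {} <+> Inr -` \<tau>" using set_eq_Plus[of \<tau>] that(2) by simp
      then show ?thesis using that(1) unfolding N_def by (metis image_eqI mem_Collect_eq)
    qed
    then show ?thesis unfolding assemble_def pullT' N_def by blast
  qed
  have "?f ` cuts {..<k} T' = C"
    using cuts_pull[where T = T', OF \<pi> T'J] assemble_parts(3)[where T = T' and N = N, OF T'D(2)] TN by (simp add: C_def)
  also have "C = ?f ` {{..<j} | j. 0 < j \<and> j < k}"
    using surj(2) unfolding setcompr_eq_image image_image lessThan_iff .
  finally have im: "?f ` cuts {..<k} T' = ?f ` {{..<j} | j. 0 < j \<and> j < k}" .
  \<comment> \<open>Taking preimages is injective on subsets of \<open>{..<k}\<close>, so the
    equality of the cut families descends from B to the chain.\<close>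
  have inj: "inj_on ?f (Pow {..<k})" using fiber_eq_iff[OF \<pi>] by (auto simp: inj_on_def)
  have "cuts {..<k} T' \<subseteq> Pow {..<k}"
    using cuts_tubing(1)[OF poset_chain[OF k] T't] by blast
  moreover have "{{..<j} | j. 0 < j \<and> j < k} \<subseteq> Pow {..<k}" by auto
  ultimately have "cuts {..<k} T' = {{..<j} | j. 0 < j \<and> j < k}"
    using inj_on_image_eq_iff[OF inj] im by simp
  then have sk: "T' \<in> skeletons k" using T't T'D(2) by (simp add: skeletons_def)
  have "N \<in> inner_tubings B s \<pi>"
    unfolding inner_tubings_def
  proof (intro CollectI conjI ballI subsetI)
    have sub: "(<+>) {} ` N \<subseteq> T" by (auto simp: N_def)
    show "(<+>) {} ` N \<in> tubings (X B) (R B s)" by (rule tubings_subset[OF T sub])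
    fix I assume I: "I \<in> N"
    then have IT: "{} <+> I \<in> T" by (simp add: N_def)
    have pt: "tube B s ({} <+> I)" by (rule tubingsD(1)[OF T IT])
    show IB: "I \<in> Pow B" using proper_tube_vimage(2)[OF B pt] by (simp add: vimage_Plus)
    have in_or_out: "I \<subseteq> c \<or> I \<inter> c = {}" if c: "c \<in> C" for c
    proof -
      obtain \<tau> where \<tau>: "\<tau> \<in> T" "Inl -` \<tau> \<noteq> {}" "c = Inr -` \<tau> \<or> c = B - Inr -` \<tau>"
        using c unfolding C_def cuts_iff by blast
      have "\<not> \<tau> \<subseteq> {} <+> I" using \<tau>(2) by auto
      then have "{} <+> I \<subseteq> \<tau> \<or> \<tau> \<inter> ({} <+> I) = {}" using tubingsD(2)[OF T \<tau>(1) IT] by blast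
      then have "I \<subseteq> Inr -` \<tau> \<or> Inr -` \<tau> \<inter> I = {}"
        by (metis set_eq_Plus Plus_subset_iff Plus_disjoint_iff)
      then show ?thesis using \<tau>(3) IB by blast
    qed
    have "\<pi> x = \<pi> y" if "x \<in> I" "y \<in> I" for x y
    proof -
      have "{c \<in> C. x \<notin> c} = {c \<in> C. y \<notin> c}" using in_or_out that by blast
      moreover have "x \<in> B" "y \<in> B" using that IB by auto
      ultimately show ?thesis by (simp add: \<pi>_def cut_map_def)
    qed
    then show "\<exists>j. \<pi> ` I \<subseteq> {j}" by blast
  qed
  then show ?thesis using that[OF k \<pi> sk _ TN] by blast
qed

section \<open>Summation over skeletons, surjections and inner tubings\<close>

definition skeleton_sum :: "real \<Rightarrow> nat \<Rightarrow> real" where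
  "skeleton_sum y k = (\<Sum>T\<in>skeletons k. y ^ card T)"

text \<open>\<open>cut_map_eq\<close> recovers k and \<open>\<pi>\<close>, and
  \<open>tubing_assembled\<close> makes the assembly onto. The bound n may exceed
  \<open>card B\<close>, so that the chain and all antichains are summed over the same range; for k
  beyond \<open>card B\<close> there is no surjection.\<close>

lemma sum_tubings:
  fixes B :: "'b set"
  assumes B: "poset B s" and n: "card B \<le> n"
  shows "(\<Sum>T\<in>tubings (X B) (R B s). y ^ card T) =
    (\<Sum>k=1..n. skeleton_sum y k * (\<Sum>\<pi>\<in>order_surjs B s k. \<Sum>N\<in>inner_tubings B s \<pi>. y ^ card N))"
proof -
  have finB: "finite B" using B by (simp add: poset_def)
  have fin_sk: "finite (skeletons k)" if "k > 0" for k
    using finite_tubings[OF poset_X(1)[OF poset_chain[OF that]]] by (simp add: skeletons_def)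
  have fin_in: "finite (inner_tubings B s \<pi>)" for \<pi>
    by (rule finite_subset[of _ "Pow (Pow B)"]) (auto simp: inner_tubings_def finB)
  let ?I = "SIGMA k:{1..n}. SIGMA \<pi>:order_surjs B s k. skeletons k \<times> inner_tubings B s \<pi>"
  let ?\<Phi> = "\<lambda>(k, \<pi>, T, N). assemble B \<pi> T N"
  have inj: "inj_on ?\<Phi> ?I"
  proof (rule inj_onI)
    fix p q assume p: "p \<in> ?I" and q: "q \<in> ?I" and eq: "?\<Phi> p = ?\<Phi> q"
    obtain k \<pi> T N where p': "p = (k, \<pi>, T, N)" "k > 0" "\<pi> \<in> order_surjs B s k" "T \<in> skeletons k"
      using p by auto
    obtain k' \<pi>' T' N' where q': "q = (k', \<pi>', T', N')" "k' > 0" "\<pi>' \<in> order_surjs B s k'" "T' \<in> skeletons k'"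
      using q by auto
    have eq': "assemble B \<pi> T N = assemble B \<pi>' T' N'" using eq p'(1) q'(1) by simp
    note cp = cut_map_eq[OF p'(3,2) cuts_assemble[OF p'(3,2,4), of N]]
    note cq = cut_map_eq[OF q'(3,2) cuts_assemble[OF q'(3,2,4), of N']]
    have k: "k = k'" and \<pi>: "\<pi> = \<pi>'" using cp cq unfolding eq' by simp_all
    have "N = N'"
      using assemble_parts(1)[where T = T and N = N and B = B and \<pi> = \<pi>, OF skeletonD(2)[OF p'(4,2)]]
       assemble_parts(1)[where T = T' and N = N' and B = B and \<pi> = \<pi>', OF skeletonD(2)[OF q'(4,2)]] unfolding eq' by simp
    moreover have "pull B \<pi> ` T = pull B \<pi> ` T'"
      using assemble_parts(2)[where T = T and N = N and B = B and \<pi> = \<pi>, OF skeletonD(2)[OF p'(4,2)]]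
       assemble_parts(2)[where T = T' and N = N' and B = B and \<pi> = \<pi>', OF skeletonD(2)[OF q'(4,2)]] \<pi> unfolding eq' by simp
    then have "T = T'"
    proof (rule inj_on_image_eq_iff[THEN iffD1, rotated -1])
      show "inj_on (pull B \<pi>) {\<tau>. Inr -` \<tau> \<subseteq> {..<k}}"
        using pull_eq_iff[OF p'(3)] by (auto simp: inj_on_def)
      show "T \<subseteq> {\<tau>. Inr -` \<tau> \<subseteq> {..<k}}" using skeletonD(3)[OF p'(4,2)] by blast
      show "T' \<subseteq> {\<tau>. Inr -` \<tau> \<subseteq> {..<k}}" using skeletonD(3)[OF q'(4,2)] k by blast
    qed
    ultimately show "p = q" using p'(1) q'(1) k \<pi> by simp
  qed
  have "?\<Phi> ` ?I = tubings (X B) (R B s)"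
  proof (intro equalityI subsetI)
    fix T assume "T \<in> ?\<Phi> ` ?I"
    then show "T \<in> tubings (X B) (R B s)" using assemble_tubing[OF B] by auto
  next
    fix T assume "T \<in> tubings (X B) (R B s)"
    then obtain k \<pi> T' N where *: "k > 0" "\<pi> \<in> order_surjs B s k" "T' \<in> skeletons k"
      "N \<in> inner_tubings B s \<pi>" "T = assemble B \<pi> T' N" by (rule tubing_assembled[OF B])
    have "k = card (\<pi> ` B)" using *(2) by (simp add: order_surjs_def)
    also have "\<dots> \<le> card B" by (rule card_image_le[OF finB])
    finally have "(k, \<pi>, T', N) \<in> ?I" using * n by auto
    then show "T \<in> ?\<Phi> ` ?I" using *(5) by (metis (mono_tags, lifting) case_prod_conv image_eqI)
  qed
  then have "(\<Sum>T\<in>tubings (X B) (R B s). y ^ card T) = (\<Sum>p\<in>?I. y ^ card (?\<Phi> p))"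
    using sum.reindex[OF inj, of "\<lambda>T. y ^ card T"] by (simp add: o_def)
  also have "\<dots> = (\<Sum>(k, \<pi>, T, N)\<in>?I. y ^ card T * y ^ card N)"
  proof (rule sum.cong[OF refl])
    fix p assume "p \<in> ?I"
    then obtain k \<pi> T N where p: "p = (k, \<pi>, T, N)" "k > 0" "\<pi> \<in> order_surjs B s k" "T \<in> skeletons k"
      "N \<in> inner_tubings B s \<pi>" by auto
    have finT: "finite T" "finite N"
      using p finite_tubing[OF poset_X(1)[OF poset_chain[OF p(2)]]] finB
      by (auto simp: skeletons_def inner_tubings_def intro: finite_subset)
    have "pull B \<pi> \<tau> \<noteq> {} <+> I" if "\<tau> \<in> T" for \<tau> I
      using skeletonD(2)[OF p(4,2) that] vimage_pull(1)[of B \<pi> \<tau>] by (metis vimage_Plus(1))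
    then have "pull B \<pi> ` T \<inter> (<+>) {} ` N = {}" by auto
    then have "card (assemble B \<pi> T N) = card (pull B \<pi> ` T) + card ((<+>) {} ` N :: ('a + 'b) set set)"
      unfolding assemble_def using finT by (intro card_Un_disjoint) auto
    moreover have "card (pull B \<pi> ` T) = card T"
      using pull_eq_iff[OF p(3) skeletonD(3)[OF p(4,2)] skeletonD(3)[OF p(4,2)]]
      by (intro card_image) (auto simp: inj_on_def)
    moreover have "card ((<+>) {} ` N :: ('a + 'b) set set) = card N"
      by (intro card_image) (auto simp: inj_on_def Plus_eq_iff)
    ultimately show "y ^ card (?\<Phi> p) = (case p of (k, \<pi>, T, N) \<Rightarrow> y ^ card T * y ^ card N)"
      by (simp add: p(1) power_add)
  qed
  also have "\<dots> = (\<Sum>k=1..n. \<Sum>(\<pi>, T, N)\<in>(SIGMA \<pi>:order_surjs B s k. skeletons k \<times> inner_tubings B s \<pi>). y ^ card T * y ^ card N)"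
  proof (rule sum.Sigma[symmetric])
    show "\<forall>k\<in>{1..n}. finite (SIGMA \<pi>:order_surjs B s k. skeletons k \<times> inner_tubings B s \<pi>)"
      using fin_sk fin_in finite_order_surjs[OF finB] by (intro ballI finite_SigmaI finite_cartesian_product) auto
  qed simp
  also have "\<dots> = (\<Sum>k=1..n. skeleton_sum y k * (\<Sum>\<pi>\<in>order_surjs B s k. \<Sum>N\<in>inner_tubings B s \<pi>. y ^ card N))"
  proof (rule sum.cong[OF refl])
    fix k assume k: "k \<in> {1..n}"
    have "(\<Sum>(\<pi>, T, N)\<in>(SIGMA \<pi>:order_surjs B s k. skeletons k \<times> inner_tubings B s \<pi>). y ^ card T * y ^ card N) =
       (\<Sum>\<pi>\<in>order_surjs B s k. \<Sum>(T, N)\<in>skeletons k \<times> inner_tubings B s \<pi>. y ^ card T * y ^ card N)"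
      using k fin_sk[of k] fin_in finite_order_surjs[OF finB]
      by (intro sum.Sigma[symmetric]) auto
    also have "\<dots> = (\<Sum>\<pi>\<in>order_surjs B s k. skeleton_sum y k * (\<Sum>N\<in>inner_tubings B s \<pi>. y ^ card N))"
      by (simp only: skeleton_sum_def sum_product sum.cartesian_product)
    finally show "(\<Sum>(\<pi>, T, N)\<in>(SIGMA \<pi>:order_surjs B s k. skeletons k \<times> inner_tubings B s \<pi>). y ^ card T * y ^ card N) =
       skeleton_sum y k * (\<Sum>\<pi>\<in>order_surjs B s k. \<Sum>N\<in>inner_tubings B s \<pi>. y ^ card N)"
      by (simp only: sum_distrib_left)
  qed
  finally show ?thesis .
qed

end

section \<open>Chains and antichains\<close>

lemma tubings_image:
  assumes bij: "bij_betw f A A'" and iso: "\<And>x y. x \<in> A \<Longrightarrow> y \<in> A \<Longrightarrow> (f x, f y) \<in> r' \<longleftrightarrow> (x, y) \<in> r"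
    and fin: "finite A" and po: "partial_order_on A r" "partial_order_on A' r'"
    and T: "T \<in> tubings A r"
  shows "(`) f ` T \<in> tubings A' r'"
proof -
  have inj: "inj_on f A" and im: "f ` A = A'" using bij by (auto simp: bij_betw_def)
  have fin': "finite A'" using fin im by blast
  have tA: "U \<subseteq> A" if "U \<in> T" for U using T that by (auto simp: tubings_def proper_tube_def)
  have tube: "proper_tube A' r' (f ` U)" if U: "proper_tube A r U" for U
  proof -
    have U': "U \<subseteq> A" "1 < card U" "card U < card A" "comparably_connected r U" "order_convex A r U"
      using U unfolding proper_tube_iff[OF fin po(1)] by blast+
    have "card (f ` U) = card U" using inj_on_subset[OF inj U'(1)] by (rule card_image)
    moreover have "card A' = card A" using bij_betw_same_card[OF bij] by simp
    moreover have "comparably_connected r' (f ` U)"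
    proof (rule comparably_connectedI)
      fix P assume P: "P \<subseteq> f ` U" "P \<noteq> {}" and
        cl: "\<And>x y. x \<in> P \<Longrightarrow> y \<in> f ` U \<Longrightarrow> (x, y) \<in> r' \<or> (y, x) \<in> r' \<Longrightarrow> y \<in> P"
      have "{x \<in> U. f x \<in> P} = U"
      proof (rule comparably_connectedD[OF U'(4)])
        show "{x \<in> U. f x \<in> P} \<noteq> {}" using P by auto
        fix x y assume x: "x \<in> {x \<in> U. f x \<in> P}" and y: "y \<in> U" and xy: "(x, y) \<in> r \<or> (y, x) \<in> r"
        have "(f x, f y) \<in> r' \<or> (f y, f x) \<in> r'" using xy iso[of x y] iso[of y x] x y U'(1) by auto
        then show "y \<in> {x \<in> U. f x \<in> P}" using cl[of "f x" "f y"] x y by auto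
      qed auto
      then show "f ` U \<subseteq> P" by auto
    qed
    moreover have "order_convex A' r' (f ` U)"
      unfolding order_convex_def
    proof (intro ballI impI)
      fix x' z' y' assume "x' \<in> f ` U" "z' \<in> f ` U" "y' \<in> A'" and le: "(x', y') \<in> r' \<and> (y', z') \<in> r'"
      then obtain x z y where *: "x \<in> U" "z \<in> U" "y \<in> A" "x' = f x" "z' = f z" "y' = f y"
        using im by (metis imageE)
      then have "(x, y) \<in> r \<and> (y, z) \<in> r" using le iso U'(1) by auto
      then have "y \<in> U" using U'(5) * unfolding order_convex_def by blast
      then show "y' \<in> f ` U" using * by simp
    qed
    ultimately show ?thesis
      using U' im unfolding proper_tube_iff[OF fin' po(2)] by auto
  qed
  have dj: "f ` U \<inter> f ` V = {} \<longleftrightarrow> U \<inter> V = {}" if "U \<in> T" "V \<in> T" for U V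
    using inj_on_image_Int[OF inj tA[OF that(1)] tA[OF that(2)]] by (metis image_is_empty)
  have lam: "f ` U \<subseteq> f ` V \<or> f ` V \<subseteq> f ` U \<or> f ` U \<inter> f ` V = {}" if UV: "U \<in> T" "V \<in> T" for U V
  proof -
    have "U \<subseteq> V \<or> V \<subseteq> U \<or> U \<inter> V = {}" using T UV by (simp add: tubings_def)
    then show ?thesis using dj[OF UV] image_mono[of U V f] image_mono[of V U f] by blast
  qed
  have prec: "tube_prec r U V" if "U \<in> T" "V \<in> T" "tube_prec r' (f ` U) (f ` V)" for U V
    using that dj[of U V] tA[of U] tA[of V] iso unfolding tube_prec_def by (auto simp: subset_iff)
  have "acyclic {(U, V). U \<in> (`) f ` T \<and> V \<in> (`) f ` T \<and> tube_prec r' U V}"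
  proof (rule acyclic_map[where f = "(`) (inv_into A f)"])
    show "acyclic {(U, V). U \<in> T \<and> V \<in> T \<and> tube_prec r U V}" using T by (simp add: tubings_def)
    have cancel: "inv_into A f ` f ` U = U" if "U \<in> T" for U
      using inj tA[OF that] by (rule inv_into_image_cancel)
    fix a b assume "(a, b) \<in> {(U, V). U \<in> (`) f ` T \<and> V \<in> (`) f ` T \<and> tube_prec r' U V}"
    then obtain U V where "U \<in> T" "V \<in> T" "a = f ` U" "b = f ` V" "tube_prec r' (f ` U) (f ` V)" by auto
    then show "(inv_into A f ` a, inv_into A f ` b) \<in> {(U, V). U \<in> T \<and> V \<in> T \<and> tube_prec r U V}"
      using prec cancel by simp
  qed
  moreover have "\<forall>U\<in>(`) f ` T. proper_tube A' r' U" using tube T by (auto simp: tubings_def)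
  moreover have "\<forall>U\<in>(`) f ` T. \<forall>V\<in>(`) f ` T. U \<subseteq> V \<or> V \<subseteq> U \<or> U \<inter> V = {}" using lam by blast
  ultimately show ?thesis by (simp add: tubings_def)
qed

lemma sum_tubings_iso:
  assumes bij: "bij_betw f A A'" and iso: "\<And>x y. x \<in> A \<Longrightarrow> y \<in> A \<Longrightarrow> (f x, f y) \<in> r' \<longleftrightarrow> (x, y) \<in> r"
    and fin: "finite A" and po: "partial_order_on A r" "partial_order_on A' r'"
  shows "(\<Sum>T\<in>tubings A r. g (card T)) = (\<Sum>T\<in>tubings A' r'. g (card T))"
proof -
  let ?h = "inv_into A f"
  have inj: "inj_on f A" and im: "f ` A = A'" using bij by (auto simp: bij_betw_def)
  have bij': "bij_betw ?h A' A" by (rule bij_betw_inv_into[OF bij])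
  have iso': "(?h x, ?h y) \<in> r \<longleftrightarrow> (x, y) \<in> r'" if "x \<in> A'" "y \<in> A'" for x y
    using that iso[of "?h x" "?h y"] im by (simp add: inv_into_into f_inv_into_f)
  have hf: "?h ` f ` U = U" if "U \<subseteq> A" for U using inj that by (rule inv_into_image_cancel)
  have fh: "f ` ?h ` U = U" if "U \<subseteq> A'" for U using im that by (rule image_inv_into_cancel)
  have sub: "U \<subseteq> A" if "T \<in> tubings A r" "U \<in> T" for T U
    using that by (auto simp: tubings_def proper_tube_def)
  have sub': "U \<subseteq> A'" if "T \<in> tubings A' r'" "U \<in> T" for T U
    using that by (auto simp: tubings_def proper_tube_def)
  show ?thesis
  proof (rule sum.reindex_bij_witness[where j = "(`) ((`) f)" and i = "(`) ((`) ?h)"], goal_cases)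
    case (1 T)
    then show ?case using hf[OF sub[OF 1]] by (simp add: image_image)
  next
    case (2 T)
    then show ?case using tubings_image[OF bij iso fin po] by simp
  next
    case (3 T)
    then show ?case using fh[OF sub'[OF 3]] by (simp add: image_image)
  next
    case (4 T)
    then show ?case using tubings_image[OF bij' iso' _ po(2,1)] fin im by blast
  next
    case (5 T)
    have "inj_on ((`) f) T"
      by (rule inj_on_inverseI[where g = "(`) ?h"]) (rule hf[OF sub[OF 5]])
    then show ?case by (simp add: card_image)
  qed
qed

section \<open>Inner tubings of antichains and chains\<close>

context autonomous_subposet
begin

lemma D_U_disjoint: "D \<inter> U = {}"
proof (rule ccontr)
  assume "D \<inter> U \<noteq> {}"
  then obtain z a b where z: "z \<in> A" "z \<notin> S" "a \<in> S" "(z, a) \<in> r" "b \<in> S" "(b, z) \<in> r"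
    by (auto simp: D_def U_def)
  then have "(a, z) \<in> r" using aut unfolding autonomous_def by blast
  then have "z = a" using z(4) po by (auto simp: partial_order_on_def dest: antisymD)
  then show False using z by simp
qed

abbreviation antichain_R :: "nat \<Rightarrow> ('a + nat) rel" where
  "antichain_R i \<equiv> R {..<i} (Id_on {..<i})"

lemma poset_antichain: "i > 0 \<Longrightarrow> poset {..<i :: nat} (Id_on {..<i})"
  by (auto simp: poset_def partial_order_on_def preorder_on_def refl_on_def trans_def antisym_def)

text \<open>Distinct elements of an antichain are incomparable, so a nonempty connected inner set is
  a single point, too small for a tube.\<close>

lemma inner_tubings_antichain:
  assumes "i > 0"
  shows "inner_tubings {..<i :: nat} (Id_on {..<i}) \<pi> = {{}}"
proof -
  have no: "\<not> proper_tube (X {..<i}) (antichain_R i) ({} <+> I)" for I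
  proof
    assume "proper_tube (X {..<i}) (antichain_R i) ({} <+> I)"
    then have c: "1 < card ({} <+> I :: ('a + nat) set)" "comparably_connected (antichain_R i) ({} <+> I)"
      unfolding proper_tube_iff[OF poset_X[OF poset_antichain[OF assms]]] by blast+
    then have "I \<noteq> {}" by (auto simp: Plus_def)
    then obtain x where x: "x \<in> I" by blast
    have "{Inr x :: 'a + nat} = {} <+> I"
    proof (rule comparably_connectedD[OF c(2)])
      fix u v assume "u \<in> {Inr x :: 'a + nat}" "v \<in> {} <+> I"
        "(u, v) \<in> antichain_R i \<or> (v, u) \<in> antichain_R i"
      then show "v \<in> {Inr x}" by (auto simp: R_mem)
    qed (use x in auto)
    then have "card ({} <+> I :: ('a + nat) set) = 1" by (metis is_singletonI is_singleton_altdef)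
    then show False using c(1) by simp
  qed
  have "N = {}" if N: "N \<in> inner_tubings {..<i} (Id_on {..<i}) \<pi>" for N
  proof (rule ccontr)
    assume "N \<noteq> {}"
    then obtain I where I: "I \<in> N" by blast
    have t: "(<+>) {} ` N \<in> tubings (X {..<i}) (antichain_R i)"
      using N by (simp add: inner_tubings_def)
    show False using tubingsD(1)[OF t imageI[OF I]] no by blast
  qed
  moreover have "{} \<in> inner_tubings {..<i} (Id_on {..<i}) \<pi>"
    by (simp add: inner_tubings_def empty_in_tubings)
  ultimately show ?thesis by blast
qed

text \<open>Convex subsets of a chain are intervals. Conversely, an interval is convex in the whole
  poset because no outside element lies above one chain element and below another
  (\<open>D_U_disjoint\<close>), and it is smaller than the whole poset because \<open>E\<close> is
  nonempty.\<close>

lemma inner_tube_chain: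
  assumes n: "n > 0"
  shows "chain_tube n ({} <+> I) \<longleftrightarrow> I \<in> long_intervals 0 n"
proof
  assume L: "chain_tube n ({} <+> I)"
  have I: "I \<subseteq> {..<n}" using proper_tube_vimage(2)[OF poset_chain[OF n] L] by (simp add: vimage_Plus)
  have fin: "finite I" using I finite_subset by blast
  have "1 < card ({} <+> I :: ('a + nat) set)" using L by (simp add: proper_tube_def)
  then have card: "1 < card I" using fin by (simp add: card_Plus)
  then have ne: "I \<noteq> {}" by auto
  define a b where "a = Min I" and "b = Max I"
  have ab: "a \<in> I" "b \<in> I" and bd: "\<And>x. x \<in> I \<Longrightarrow> a \<le> x \<and> x \<le> b"
    using fin ne by (auto simp: a_def b_def)
  have "b < n" using ab I by blast
  have "y \<in> I" if y: "a \<le> y" "y \<le> b" for y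
  proof -
    have "(Inr a, Inr y) \<in> chain_R n" "(Inr y, Inr b) \<in> chain_R n"
      using y \<open>b < n\<close> by (auto simp: R_mem chain_rel_def)
    moreover have "order_convex (X {..<n}) (chain_R n) ({} <+> I)"
      using L by (simp add: proper_tube_def)
    moreover have "Inr y \<in> X {..<n}" using y \<open>b < n\<close> by (auto simp: X_eq)
    ultimately have "Inr y \<in> ({} <+> I :: ('a + nat) set)"
      using ab unfolding order_convex_def by (meson InrI)
    then show ?thesis by auto
  qed
  then have eq: "I = {a..<Suc b}" using bd by force
  moreover have "a + 1 < Suc b" using card unfolding eq by simp
  ultimately show "I \<in> long_intervals 0 n" using \<open>b < n\<close> by (simp add: long_intervalsI)
next
  assume I: "I \<in> long_intervals 0 n"
  then obtain i j where ij: "I = {i..<j}" "i + 1 < j" "j \<le> n" by (auto simp: long_intervals_def)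
  have sub: "I \<subseteq> {..<n}" using ij by auto
  have fin: "finite I" using ij by simp
  have "card I \<le> n" using sub card_mono[of "{..<n}" I] by simp
  moreover have "card E > 0" using finite_E E_nonempty by (simp add: card_gt_0_iff)
  ultimately have "card ({} <+> I :: ('a + nat) set) < card (X {..<n})"
    using fin finite_E by (simp add: card_Plus X_eq)
  moreover have "1 < card ({} <+> I :: ('a + nat) set)" using fin ij by (simp add: card_Plus)
  moreover have "comparably_connected (chain_R n) ({} <+> I)"
  proof (rule comparably_connectedI)
    fix P :: "('a + nat) set" assume P: "P \<subseteq> {} <+> I" "P \<noteq> {}" and
      cl: "\<And>x y. x \<in> P \<Longrightarrow> y \<in> {} <+> I \<Longrightarrow> (x, y) \<in> chain_R n \<or> (y, x) \<in> chain_R n \<Longrightarrow> y \<in> P"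
    obtain x where x: "Inr x \<in> P" "x \<in> I" using P by auto
    show "{} <+> I \<subseteq> P"
    proof
      fix v assume v: "v \<in> ({} <+> I :: ('a + nat) set)"
      then obtain y where y: "v = Inr y" "y \<in> I" by auto
      have "(x, y) \<in> chain_rel n \<or> (y, x) \<in> chain_rel n" using x y sub by (auto simp: chain_rel_def)
      then have "(Inr x, v) \<in> chain_R n \<or> (v, Inr x) \<in> chain_R n"
        using x y sub by (auto simp: R_mem)
      then show "v \<in> P" using cl[OF x(1) v] by blast
    qed
  qed
  moreover have "order_convex (X {..<n}) (chain_R n) ({} <+> I)"
    unfolding order_convex_def
  proof (intro ballI impI)
    fix x z y assume x: "x \<in> ({} <+> I :: ('a + nat) set)" and z: "z \<in> ({} <+> I :: ('a + nat) set)"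
      and le: "(x, y) \<in> chain_R n \<and> (y, z) \<in> chain_R n"
    obtain p q where pq: "x = Inr p" "z = Inr q" "p \<in> I" "q \<in> I" using x z by auto
    show "y \<in> {} <+> I"
    proof (cases y)
      case (Inl e)
      then have "e \<in> D \<inter> U" using le pq by (auto simp: R_mem)
      then show ?thesis using D_U_disjoint by blast
    next
      case (Inr b)
      then have "p \<le> b" "b \<le> q" using le pq by (auto simp: R_mem chain_rel_def)
      then show ?thesis using pq Inr ij by auto
    qed
  qed
  moreover have "{} <+> I \<subseteq> X {..<n}" using sub by (auto simp: X_eq)
  ultimately show "chain_tube n ({} <+> I)"
    unfolding proper_tube_iff[OF poset_X[OF poset_chain[OF n]]] by blast
qed

lemma inner_tubings_chain:
  assumes n: "n > 0"
  shows "inner_tubings {..<n} (chain_rel n) \<pi> = fiber_families n \<pi>"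
proof -
  let ?J = "\<lambda>I. {} <+> I :: ('a + nat) set"
  have sub: "N \<subseteq> Pow {..<n}" if "N \<subseteq> long_intervals 0 n" for N
    using that long_intervals_subset[of _ 0 n] by (fastforce simp: atLeast0LessThan)
  \<comment> \<open>Acyclicity is automatic: of two disjoint intervals, the preceding one has the
    smaller minimum.\<close>
  have ac: "acyclic {(U, V). U \<in> ?J ` N \<and> V \<in> ?J ` N \<and> tube_prec (chain_R n) U V}"
    if N: "N \<subseteq> long_intervals 0 n" for N
  proof (rule acyclic_map[where f = "\<lambda>\<tau>. Min (Inr -` \<tau>)"])
    show "acyclic {(x :: nat, y). x < y}" by (rule wf_acyclic[OF wf])
    fix a b assume "(a, b) \<in> {(U, V). U \<in> ?J ` N \<and> V \<in> ?J ` N \<and> tube_prec (chain_R n) U V}"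
    then obtain I J where IJ: "I \<in> N" "J \<in> N" "a = ?J I" "b = ?J J" "tube_prec (chain_R n) (?J I) (?J J)"
      by auto
    obtain i j where ij: "I = {i..<j}" "i + 1 < j" "j \<le> n" using IJ(1) N by (auto simp: long_intervals_def)
    obtain k l where kl: "J = {k..<l}" "k + 1 < l" "l \<le> n" using IJ(2) N by (auto simp: long_intervals_def)
    have "I \<subseteq> {..<n}" "J \<subseteq> {..<n}" using ij kl by auto
    from IJ(5)[unfolded tube_prec_Plus[OF empty_subsetI empty_subsetI this]]
    obtain x y where xy: "x \<in> I" "y \<in> J" "x \<le> y" "I \<inter> J = {}" by (auto simp: chain_rel_def)
    have "x \<notin> J" using xy by blast
    then have "x < k" using xy kl by auto
    then have "i < k" using xy ij by auto
    moreover have "Min {i..<j} = i" "Min {k..<l} = k" using ij kl by (auto intro!: Min_eqI)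
    ultimately show "(Min (Inr -` a), Min (Inr -` b)) \<in> {(x, y). x < y}"
      using IJ ij kl by (simp add: vimage_Plus)
  qed
  have lam: "(\<forall>U\<in>?J ` N. \<forall>V\<in>?J ` N. U \<subseteq> V \<or> V \<subseteq> U \<or> U \<inter> V = {}) \<longleftrightarrow> laminar N" for N
    unfolding laminar_def ball_simps Plus_subset_iff Plus_disjoint_iff by simp
  have tub: "?J ` N \<in> tubings (X {..<n}) (chain_R n) \<longleftrightarrow> N \<in> interval_families 0 n" for N
  proof -
    have "(\<forall>U\<in>?J ` N. chain_tube n U) \<longleftrightarrow> N \<subseteq> long_intervals 0 n"
      by (simp only: ball_simps inner_tube_chain[OF n] subset_eq)
    then show ?thesis unfolding tubings_def interval_families_def mem_Collect_eq lam
      using ac[of N] by argo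
  qed
  have pow: "N \<subseteq> Pow {..<n}" if "N \<in> interval_families 0 n" for N
    using sub that by (simp add: interval_families_def)
  show ?thesis unfolding inner_tubings_def fiber_families_def tub
  proof (rule Collect_cong)
    fix N
    show "N \<subseteq> Pow {..<n} \<and> N \<in> interval_families 0 n \<and> (\<forall>I\<in>N. \<exists>j. \<pi> ` I \<subseteq> {j}) \<longleftrightarrow>
      N \<in> interval_families 0 n \<and> (\<forall>I\<in>N. \<exists>j. \<pi> ` I \<subseteq> {j})"
      using pow[of N] by argo
  qed
qed

lemma sum_tubings_antichain:
  assumes "i > 0" "i \<le> n"
  shows "(\<Sum>T\<in>tubings (X {..<i}) (antichain_R i). y ^ card T) =
    (\<Sum>k=1..n. skeleton_sum y k * (fact k * real (Stirling i k)))"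
  using sum_tubings[OF poset_antichain[OF assms(1)], of n y] assms
  by (simp add: inner_tubings_antichain card_order_surjs_Id)

lemma sum_tubings_chain:
  assumes "n > 0"
  shows "(\<Sum>T\<in>tubings (X {..<n}) (chain_R n). y ^ card T) =
    (\<Sum>k=1..n. skeleton_sum y k * chain_sum y n k)"
  using sum_tubings[OF poset_chain[OF assms], of n y]
  by (simp add: inner_tubings_chain[OF assms] chain_sum_def family_sum_def)

end

section \<open>The formula for h-polynomials\<close>

lemma poly_h_poly: "poly (h_poly Q) (1 + t) = poly (f_poly Q) t"
  by (simp add: h_poly_def poly_pcompose)

text \<open>Infinitely many common values force equality. This allows working at real points 1 + t
  with t > 0, where 1/t is available as the weight of a tube.\<close>

lemma poly_eqI_gt:
  fixes p q :: "real poly"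
  assumes "\<And>x. x > a \<Longrightarrow> poly p x = poly q x"
  shows "p = q"
proof (rule ccontr)
  assume "p \<noteq> q"
  then have "finite {x. poly (p - q) x = 0}" by (intro poly_roots_finite) simp
  moreover have "{a<..} \<subseteq> {x. poly (p - q) x = 0}" using assms by auto
  ultimately show False using infinite_Ioi[of a] finite_subset by blast
qed

theorem theorem3p1:
  fixes A :: "'a set" and r :: "'a rel" and S :: "'a set" and n :: nat
    and Q :: "'e::euclidean_space set" and R :: "nat \<Rightarrow> 'f::euclidean_space set"
  assumes "finite A" and "partial_order_on A r" and "hasse_connected r A"
    and "autonomous A r S" and "S \<noteq> A" and "S \<in> Chains r" and "card S = n" and "n \<ge> 1"
    and "poset_associahedron A r Q"
    and "\<And>i. i \<in> {1..n} \<Longrightarrow>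
           poset_associahedron (replace_carrier A S {..<i})
             (replace_order A r S {..<i} (Id_on {..<i})) (R i)"
  shows "h_poly Q = smult (1 / fact n)
           (\<Sum>w | w permutes {1..n}. narayana_B_perm n w * h_poly (R (card (perm_cycles n w))))"
proof -
  have "S \<noteq> {}" using assms(7,8) by auto
  then interpret P: autonomous_subposet A r S
    using assms by unfold_locales
  have n: "n > 0" using assms(8) by simp
  have finS: "finite S" using finite_subset[OF P.S_subset assms(1)] .
  have r: "r \<subseteq> A \<times> A" "refl_on A r" "trans r" "antisym r"
    using assms(2) by (auto simp: partial_order_on_def preorder_on_def)
  have chain: "(x, y) \<in> r \<or> (y, x) \<in> r" if "x \<in> S" "y \<in> S" for x y
    using assms(6) that by (auto simp: Chains_def)
  define lt where "lt x y \<longleftrightarrow> (x, y) \<in> r \<and> x \<noteq> y" for x y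
  have lt: "\<not> lt x x" "lt x y \<Longrightarrow> lt y z \<Longrightarrow> lt x z" for x y z
    unfolding lt_def using transD[OF r(3)] antisymD[OF r(4)] by blast+
  have tot: "lt x y \<or> lt y x" if "x \<in> S" "y \<in> S" "x \<noteq> y" for x y
    using chain[OF that(1,2)] that(3) unfolding lt_def by blast
  define rank where "rank s = card {x \<in> S. lt x s}" for s
  have rank: "bij_betw rank S {..<n}"
    unfolding rank_def assms(7)[symmetric] by (rule rank_bij(1)[OF finS lt tot])
  have mono: "rank x < rank y" if "x \<in> S" "y \<in> S" "lt x y" for x y
    unfolding rank_def by (rule rank_bij(2)[OF finS lt tot that])
  have rank_le: "rank x \<le> rank y \<longleftrightarrow> (x, y) \<in> r" if "x \<in> S" "y \<in> S" for x y
  proof (cases "x = y")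
    case True
    then show ?thesis using refl_onD[OF r(2)] that P.S_subset by auto
  next
    case False
    from tot[OF that False] show ?thesis
    proof
      assume l: "lt x y"
      then show ?thesis using mono[OF that l] by (simp add: lt_def)
    next
      assume l: "lt y x"
      then have "(x, y) \<notin> r" using antisymD[OF r(4), of x y] by (auto simp: lt_def)
      then show ?thesis using mono[OF that(2,1) l] by simp
    qed
  qed
  \<comment> \<open>P itself is the replacement of S by a chain: \<open>f\<close> is the
    isomorphism, ranking the elements of S and fixing the others.\<close>
  define f where "f x = (if x \<in> S then Inr (rank x) else Inl x)" for x
  have bij: "bij_betw f A (P.X {..<n})"
  proof -
    have "bij_betw f S (Inr ` {..<n})"
    proof -
      have "bij_betw (Inr \<circ> rank) S (Inr ` {..<n})"
        by (rule bij_betw_trans[OF rank]) (simp add: bij_betw_def)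
      then show ?thesis by (rule bij_betw_cong[THEN iffD1, rotated]) (simp add: f_def)
    qed
    moreover have "bij_betw f (A - S) (Inl ` (A - S))"
      by (auto simp: bij_betw_def inj_on_def f_def)
    ultimately have "bij_betw f (S \<union> (A - S)) (Inr ` {..<n} \<union> Inl ` (A - S))"
      by (rule bij_betw_combine) auto
    moreover have "S \<union> (A - S) = A" using P.S_subset by blast
    moreover have "Inr ` {..<n} \<union> Inl ` (A - S) = P.X {..<n}" by (auto simp: replace_carrier_def)
    ultimately show ?thesis by simp
  qed
  have iso: "(f x, f y) \<in> P.chain_R n \<longleftrightarrow> (x, y) \<in> r" if xy: "x \<in> A" "y \<in> A" for x y
  proof -
    have rn: "rank x < n" if "x \<in> S" for x using rank that by (auto simp: bij_betw_def)
    have same: "(x, z) \<in> r \<longleftrightarrow> (y, z) \<in> r" "(z, x) \<in> r \<longleftrightarrow> (z, y) \<in> r"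
      if "x \<in> S" "y \<in> S" "z \<in> A - S" for x y z
      using bspec[OF bspec[OF bspec[OF conjunct2[OF assms(4)[unfolded autonomous_def]] that(1)] that(2)] that(3)]
      by (rule conjunct1, rule conjunct2)
    consider "x \<in> S" "y \<in> S" | "x \<in> S" "y \<notin> S" | "x \<notin> S" "y \<in> S" | "x \<notin> S" "y \<notin> S" by blast
    then show ?thesis
    proof cases
      case 1
      then show ?thesis using rank_le[OF 1] rn by (simp add: f_def P.R_mem chain_rel_def)
    next
      case 2
      have y: "y \<in> A - S" using 2 xy by simp
      then have "y \<in> P.U \<longleftrightarrow> (\<exists>x'\<in>S. (x', y) \<in> r)" by (simp add: P.U_def)
      also have "\<dots> \<longleftrightarrow> (x, y) \<in> r" using same(1)[OF _ 2(1) y] 2(1) by blast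
      finally have "y \<in> P.U \<longleftrightarrow> (x, y) \<in> r" .
      then show ?thesis using 2 rn by (simp add: f_def P.R_mem)
    next
      case 3
      have x: "x \<in> A - S" using 3 xy by simp
      then have "x \<in> P.D \<longleftrightarrow> (\<exists>y'\<in>S. (x, y') \<in> r)" by (simp add: P.D_def)
      also have "\<dots> \<longleftrightarrow> (x, y) \<in> r" using same(2)[OF _ 3(2) x] 3(2) by blast
      finally have "x \<in> P.D \<longleftrightarrow> (x, y) \<in> r" .
      then show ?thesis using 3 rn by (simp add: f_def P.R_mem)
    next
      case 4
      then show ?thesis using xy by (simp add: f_def P.R_mem P.E_def)
    qed
  qed
  define e where "e = card (A - S)"
  have cardA: "card A = e + n"
    using card_Diff_subset[OF finS P.S_subset] card_mono[OF assms(1) P.S_subset] assms(7)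
    by (simp add: e_def)
  have cardX: "card (P.X {..<i}) = e + i" for i :: nat
    using assms(1) by (simp add: replace_carrier_def card_Plus e_def)
  show ?thesis
  proof (rule poly_eqI_gt[of 1])
    fix x :: real assume "x > 1"
    define t where "t = x - 1"
    have t: "t > 0" and x: "x = 1 + t" using \<open>x > 1\<close> by (simp_all add: t_def)
    \<comment> \<open>This is t^(e - 2), the factor common to P and every P_i, where e counts the
      elements outside S.\<close>
    define c where "c = t ^ e / t\<^sup>2"
    define \<sigma> where "\<sigma> = P.skeleton_sum (1 / t)"
    let ?St = "\<lambda>k l. fact k * real (Stirling l k)"
    have chain_f: "poly (h_poly Q) x = c * (t ^ n * (\<Sum>k=1..n. \<sigma> k * chain_sum (1 / t) n k))"
    proof -
      have "(\<Sum>T\<in>tubings A r. (1 / t) ^ card T) = (\<Sum>T\<in>tubings (P.X {..<n}) (P.chain_R n). (1 / t) ^ card T)"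
        by (rule sum_tubings_iso[OF bij _ assms(1,2) P.poset_X(2)[OF P.poset_chain[OF n]]]) (rule iso)
      then show ?thesis
        unfolding x poly_h_poly poly_f_poly_poset_associahedron[OF assms(9,1) t] P.sum_tubings_chain[OF n]
        by (simp add: cardA power_add c_def \<sigma>_def)
    qed
    have anti_f: "poly (h_poly (R i)) x = c * (t ^ i * (\<Sum>k=1..n. \<sigma> k * ?St k i))" if i: "i \<in> {1..n}" for i
    proof -
      have i0: "i > 0" and "i \<le> n" using i by auto
      have fin: "finite (P.X {..<i})" using assms(1) by (simp add: replace_carrier_def)
      show ?thesis
        unfolding x poly_h_poly poly_f_poly_poset_associahedron[OF assms(10)[OF i] fin t]
          P.sum_tubings_antichain[OF i0 \<open>i \<le> n\<close>]
        by (simp add: cardX power_add c_def \<sigma>_def)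
    qed
    let ?w = "\<lambda>w. \<Prod>C\<in>perm_cycles n w. t * poly (narayana_B (card C)) (1 + t)"
    \<comment> \<open>The l cycles of w absorb the t^l that comes from the l elements of the
      antichain.\<close>
    have summand: "poly (narayana_B_perm n w * h_poly (R (card (perm_cycles n w)))) x =
        (\<Sum>k=1..n. c * \<sigma> k * (?w w * ?St k (card (perm_cycles n w))))" for w
    proof -
      have "card (perm_cycles n w) > 0" using n by (auto simp: perm_cycles_def card_gt_0_iff)
      moreover have "card (perm_cycles n w) \<le> n"
        using card_image_le[of "{1..n}" "orbit w"] by (simp add: perm_cycles_def)
      ultimately have l: "card (perm_cycles n w) \<in> {1..n}" by simp
      have "?w w = t ^ card (perm_cycles n w) * poly (narayana_B_perm n w) x"
        by (simp add: narayana_B_perm_def poly_prod x prod.distrib)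
      then show ?thesis
        by (simp only: poly_mult anti_f[OF l] sum_distrib_left) (simp add: mult_ac)
    qed
    have "poly (smult (1 / fact n) (\<Sum>w | w permutes {1..n}. narayana_B_perm n w * h_poly (R (card (perm_cycles n w))))) x =
      1 / fact n * (\<Sum>w | w permutes {1..n}. \<Sum>k=1..n. c * \<sigma> k * (?w w * ?St k (card (perm_cycles n w))))"
      by (simp only: poly_smult poly_sum summand)
    \<comment> \<open>Exchanging the sums isolates each k, which \<open>cycle_sum_narayana\<close>
      then settles.\<close>
    also have "\<dots> = 1 / fact n * (\<Sum>k=1..n. c * \<sigma> k *
        cycle_sum {1..n} (\<lambda>m. t * poly (narayana_B m) (1 + t)) (?St k))"
      unfolding cycle_sum_def perm_cycles_def
      by (subst sum.swap) (simp only: sum_distrib_left)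
    also have "\<dots> = 1 / fact n * (\<Sum>k=1..n. c * \<sigma> k * (fact n * (t ^ n * chain_sum (1 / t) n k)))"
      unfolding cycle_sum_narayana[OF t] ..
    also have "\<dots> = poly (h_poly Q) x"
      unfolding chain_f by (simp add: sum_distrib_left mult_ac)
    finally show "poly (h_poly Q) x = poly (smult (1 / fact n)
        (\<Sum>w | w permutes {1..n}. narayana_B_perm n w * h_poly (R (card (perm_cycles n w))))) x" ..
  qed
qed

end
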